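(* Let $N$ be a planar directed network on a cylinder with edge weights $x_e$, face weights $y_f$ and a chosen trail of weight $t$ (as in the context). Then for every directed path $P$ between two boundary vertices of $N$, $wt(P,y,t)=x_P$, where $x_P=\prod_{e\in P}x_e$.
   Context: A cylinder is drawn as a rectangle with its two boundary components on the left and right and top and bottom identified. A planar directed network on it is a directed graph embedded in the cylinder with some vertices on the boundary (sources or sinks) and a positive weight $x_e$ on each edge. Face weight: for a face $f$, $y_f=\prod_{e\in I^+_f}x_e\prod_{e\in I^-_f}x_e^{-1}$, where $I^+_f$ consists of the edges on the outer boundary of $f$ oriented clockwise and the edges on the inner boundary (if $f$ is not simply connected) oriented counterclockwise, and $I^-_f$ of the edges on the outer boundary oriented counterclockwise and on the inner boundary oriented clockwise. A trail is a sequence of vertices $v_1,\dots,v_{m+1}$ with $v_1,v_{m+1}$ boundary vertices on different boundary components and, for each $i$, $(v_i,v_{i+1})$ or $(v_{i+1},v_i)$ an edge; its weight $t$ is the product of $x_{(v_i,v_{i+1})}$ over forward edges times the product of $x_{(v_{i+1},v_i)}^{-1}$ over backward edges. Definition of $wt(P,y,t)$, drawing $P$ as a connected curve on enough copies of the fundamental domain (universal cover): (1) if $P$ goes from $b_i$ to $b_j$ on the same boundary component, $P$ together with the boundary segment between $b_i$ and $b_j$ bounds a region $P_b$; $wt(P,y,t)$ is the product of the weights of the faces inside $P_b$ if $P_b$ lies to the right of $P$, and the inverse of this product if $P_b$ lies to the left of $P$. (2) If $P$ begins on the component where the trail begins and ends on the other component, choose a copy of the trail lying completely to the right of $P$; $wt(P,y,t)$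 is $t$ times the product of the weights of the faces lying to the right of $P$ and to the left of that copy of the trail. (3) If $P$ begins on the component where the trail ends and ends on the other component, choose a copy of the trail lying completely to the right of $P$; $wt(P,y,t)$ is $t^{-1}$ times the product of the weights of the faces lying to the right of $P$ and to the right of that copy of the trail. (These are independent of the copy chosen.) *)

theory Defs
  imports "HOL-Complex_Analysis.Complex_Analysis" "Graph_Theory.Arc_Walk"
begin

section \<open>Planar directed networks on a cylinder\<close>

text \<open>
  The cylinder is the annulus \<open>1 \<le> |z| \<le> e\<close>.  Its universal cover is the strip
  \<open>0 \<le> Re w \<le> 1\<close> with covering map \<open>exp\<close> and deck transformations
  \<open>w \<mapsto> w + 2\<pi>ik\<close>: this is the rectangle drawing (left boundary \<open>Re w = 0\<close>, right boundary
  \<open>Re w = 1\<close>, top and bottom identified), continued vertically.  Since \<open>exp\<close> preserves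
  orientation, left, right, clockwise and counterclockwise mean the same in both pictures.
\<close>

definition cylinder :: "complex set" where
  "cylinder = {z. 1 \<le> cmod z \<and> cmod z \<le> exp 1}"

definition open_cylinder :: "complex set" where
  "open_cylinder = {z. 1 < cmod z \<and> cmod z < exp 1}"

text \<open>Parallel and antiparallel edges and loops are allowed in the underlying digraph.\<close>

record ('v, 'e) network =
  graph :: "('v, 'e) pre_digraph"
  pos :: "'v \<Rightarrow> complex"
  curve :: "'e \<Rightarrow> real \<Rightarrow> complex"
  weight :: "'e \<Rightarrow> real"

definition edge_interior :: "('v, 'e) network \<Rightarrow> 'e \<Rightarrow> complex set" where
  "edge_interior N e = curve N e ` {0<..<1}"

definition boundary_verts :: "('v, 'e) network \<Rightarrow> 'v set" where
  "boundary_verts N = {v \<in> verts (graph N). pos N v \<in> cylinder - open_cylinder}"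

text \<open>
  Edges meet the boundary of the cylinder only in boundary vertices: an edge running along the
  boundary would have a face on one side only, so its weight could not be recovered from the
  face weights.
\<close>

definition cylinder_network :: "('v, 'e) network \<Rightarrow> bool" where
  "cylinder_network N \<longleftrightarrow>
     fin_digraph (graph N) \<and>
     inj_on (pos N) (verts (graph N)) \<and>
     pos N ` verts (graph N) \<subseteq> cylinder \<and>
     (\<forall>e \<in> arcs (graph N).
        simple_path (curve N e) \<and>
        pathstart (curve N e) = pos N (tail (graph N) e) \<and>
        pathfinish (curve N e) = pos N (head (graph N) e) \<and>
        edge_interior N e \<subseteq> open_cylinder - pos N ` verts (graph N) \<and>
        0 < weight N e) \<and>
     (\<forall>e \<in> arcs (graph N). \<forall>e' \<in> arcs (graph N). e \<noteq> e' \<longrightarrow>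
        edge_interior N e \<inter> edge_interior N e' = {}) \<and>
     (\<forall>v \<in> boundary_verts N. in_arcs (graph N) v = {} \<or> out_arcs (graph N) v = {})"


section \<open>Faces and face weights\<close>

definition drawing :: "('v, 'e) network \<Rightarrow> complex set" where
  "drawing N = pos N ` verts (graph N) \<union> (\<Union>e \<in> arcs (graph N). path_image (curve N e))"

definition faces :: "('v, 'e) network \<Rightarrow> complex set set" where
  "faces N = components (open_cylinder - drawing N)"

text \<open>
  \<open>on_right c f\<close>: the region \<open>f\<close> lies along the curve \<open>c\<close> on its right-hand side.  To make
  sense of the side of a curve that is merely continuous, a piece of \<open>c\<close> is completed to a
  clockwise Jordan curve; the right-hand side of that piece is the inside of the Jordan curve.
\<close>

definition on_right :: "(real \<Rightarrow> complex) \<Rightarrow> complex set \<Rightarrow> bool" where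
  "on_right c f \<longleftrightarrow>
     (\<exists>a b t g. 0 \<le> a \<and> a < t \<and> t < b \<and> b \<le> 1 \<and>
        pathstart g = c b \<and> pathfinish g = c a \<and>
        simple_path (subpath a b c +++ g) \<and>
        (\<forall>z \<in> inside (path_image (subpath a b c +++ g)).
            winding_number (subpath a b c +++ g) z = -1) \<and>
        c t \<in> closure (f \<inter> inside (path_image (subpath a b c +++ g))))"

definition on_left :: "(real \<Rightarrow> complex) \<Rightarrow> complex set \<Rightarrow> bool" where
  "on_left c f \<longleftrightarrow> on_right (reversepath c) f"

text \<open>
  An edge on the outer boundary of \<open>f\<close> is oriented clockwise, and an edge on an inner boundary
  is oriented counterclockwise, precisely when \<open>f\<close> is on its right.  An edge with \<open>f\<close> on both
  sides belongs to both sets, and its contributions to the face weight cancel.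
\<close>

definition I_plus :: "('v, 'e) network \<Rightarrow> complex set \<Rightarrow> 'e set" where
  "I_plus N f = {e \<in> arcs (graph N). on_right (curve N e) f}"

definition I_minus :: "('v, 'e) network \<Rightarrow> complex set \<Rightarrow> 'e set" where
  "I_minus N f = {e \<in> arcs (graph N). on_left (curve N e) f}"

definition face_weight :: "('v, 'e) network \<Rightarrow> complex set \<Rightarrow> real" where
  "face_weight N f = (\<Prod>e \<in> I_plus N f. weight N e) * (\<Prod>e \<in> I_minus N f. inverse (weight N e))"


section \<open>Trails, and curves on the universal cover\<close>

text \<open>
  A step \<open>(e, True)\<close> traverses the edge \<open>e\<close> forward, \<open>(e, False)\<close> backward.  Recording the edges
  rather than only the vertices of a trail makes its weight unambiguous when there are parallel
  or antiparallel edges.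
\<close>

type_synonym 'e step = "'e \<times> bool"

fun step_start :: "('v, 'e) network \<Rightarrow> 'e step \<Rightarrow> 'v" where
  "step_start N (e, fwd) = (if fwd then tail (graph N) e else head (graph N) e)"

fun step_finish :: "('v, 'e) network \<Rightarrow> 'e step \<Rightarrow> 'v" where
  "step_finish N (e, fwd) = (if fwd then head (graph N) e else tail (graph N) e)"

fun step_curve :: "('v, 'e) network \<Rightarrow> 'e step \<Rightarrow> real \<Rightarrow> complex" where
  "step_curve N (e, fwd) = (if fwd then curve N e else reversepath (curve N e))"

fun step_weight :: "('v, 'e) network \<Rightarrow> 'e step \<Rightarrow> real" where
  "step_weight N (e, fwd) = (if fwd then weight N e else inverse (weight N e))"

fun steps_connect :: "('v, 'e) network \<Rightarrow> 'v \<Rightarrow> 'e step list \<Rightarrow> 'v \<Rightarrow> bool" where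
  "steps_connect N a [] b \<longleftrightarrow> a = b"
| "steps_connect N a (s # ss) b \<longleftrightarrow>
     fst s \<in> arcs (graph N) \<and> step_start N s = a \<and> steps_connect N (step_finish N s) ss b"

fun steps_curve :: "('v, 'e) network \<Rightarrow> 'v \<Rightarrow> 'e step list \<Rightarrow> real \<Rightarrow> complex" where
  "steps_curve N a [] = linepath (pos N a) (pos N a)"
| "steps_curve N a (s # ss) = step_curve N s +++ steps_curve N (step_finish N s) ss"

definition is_trail :: "('v, 'e) network \<Rightarrow> 'v \<Rightarrow> 'e step list \<Rightarrow> 'v \<Rightarrow> bool" where
  "is_trail N a T b \<longleftrightarrow>
     a \<in> boundary_verts N \<and> b \<in> boundary_verts N \<and> cmod (pos N a) \<noteq> cmod (pos N b) \<and>
     steps_connect N a T b"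

definition trail_weight :: "('v, 'e) network \<Rightarrow> 'e step list \<Rightarrow> real" where
  "trail_weight N T = prod_list (map (step_weight N) T)"

definition path_curve :: "('v, 'e) network \<Rightarrow> 'v \<Rightarrow> 'e awalk \<Rightarrow> real \<Rightarrow> complex" where
  "path_curve N u p = steps_curve N u (map (\<lambda>e. (e, True)) p)"

definition path_weight :: "('v, 'e) network \<Rightarrow> 'e awalk \<Rightarrow> real" where
  "path_weight N p = prod_list (map (weight N) p)"

definition is_copy :: "(real \<Rightarrow> complex) \<Rightarrow> (real \<Rightarrow> complex) \<Rightarrow> bool" where
  "is_copy q c \<longleftrightarrow> path q \<and> (\<forall>s \<in> {0..1}. exp (q s) = c s)"


section \<open>The weight of a path in terms of face and trail weights\<close>

text \<open>
  A directed path may wind around the cylinder and may even contain contractible cycles, in which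
  case its copies on the universal cover cross themselves.  Therefore regions are counted with
  multiplicity, by winding numbers.

  \<open>enclosed_mult q z\<close> is for a curve \<open>q\<close> with both ends on the same boundary line; \<open>q\<close> is closed
  up by the boundary segment.  If the resulting loop is simple, then the multiplicity is 1 on the
  enclosed region \<open>P\<^sub>b\<close> if that region is to the right of \<open>q\<close>, it is -1 on \<open>P\<^sub>b\<close> if \<open>P\<^sub>b\<close> is to
  the left of \<open>q\<close>, and it is 0 outside (see the lemmas below).
\<close>

definition boundary_loop :: "(real \<Rightarrow> complex) \<Rightarrow> real \<Rightarrow> complex" where
  "boundary_loop q = q +++ linepath (pathfinish q) (pathstart q)"

definition enclosed_mult :: "(real \<Rightarrow> complex) \<Rightarrow> complex \<Rightarrow> int" where
  "enclosed_mult q z = (THE n. of_int n = - winding_number (boundary_loop q) z)"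

lemma enclosed_mult_eqI:
  assumes "winding_number (boundary_loop q) z = - of_int k"
  shows "enclosed_mult q z = k"
  unfolding enclosed_mult_def assms minus_minus of_int_eq_iff by (rule the_equality) (rule refl)

lemma enclosed_mult_right:
  "winding_number (boundary_loop q) z = -1 \<Longrightarrow> enclosed_mult q z = 1"
  by (rule enclosed_mult_eqI) simp

lemma enclosed_mult_left:
  "winding_number (boundary_loop q) z = 1 \<Longrightarrow> enclosed_mult q z = -1"
  by (rule enclosed_mult_eqI) simp

lemma enclosed_mult_outside:
  assumes "simple_path (boundary_loop q)" "z \<in> outside (path_image (boundary_loop q))"
  shows "enclosed_mult q z = 0"
proof -
  have "winding_number (boundary_loop q) z = 0"
    using assms by (intro winding_number_zero_in_outside)
      (auto simp: boundary_loop_def simple_path_imp_path)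
  then show ?thesis by (intro enclosed_mult_eqI) simp
qed

text \<open>
  The remaining multiplicities are for a curve \<open>q\<close> in the strip from one boundary line to the
  other.  The right-hand side of \<open>q\<close> is below \<open>q\<close> if \<open>q\<close> runs from the left boundary line to the
  right one, and above \<open>q\<close> otherwise.  The curve \<open>q\<close> is closed up through the points
  \<open>2 + hi\<close> and \<open>-1 + hi\<close> outside of the strip; for large \<open>|h|\<close> the loop encircles a given point on
  the chosen side of \<open>q\<close> once.  For simple \<open>q\<close>, \<open>right_mult q\<close> (\<open>left_mult q\<close>) is thus the
  indicator function of the part of the strip to the right (left) of \<open>q\<close>.
\<close>

definition closing_loop :: "(real \<Rightarrow> complex) \<Rightarrow> real \<Rightarrow> real \<Rightarrow> complex" where
  "closing_loop q h =
     (let c = (\<lambda>w. Complex (3 * Re w - 1) h) in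
      q +++ linepath (pathfinish q) (c (pathfinish q))
        +++ linepath (c (pathfinish q)) (c (pathstart q))
        +++ linepath (c (pathstart q)) (pathstart q))"

definition right_mult :: "(real \<Rightarrow> complex) \<Rightarrow> complex \<Rightarrow> int" where
  "right_mult q z =
     (THE n. \<forall>\<^sub>F d in at_top.
        of_int n = - winding_number (closing_loop q (if Re (pathstart q) = 0 then - d else d)) z)"

definition left_mult :: "(real \<Rightarrow> complex) \<Rightarrow> complex \<Rightarrow> int" where
  "left_mult q z =
     (THE n. \<forall>\<^sub>F d in at_top.
        of_int n = winding_number (closing_loop q (if Re (pathstart q) = 0 then d else - d)) z)"

definition completely_right_of :: "(real \<Rightarrow> complex) \<Rightarrow> (real \<Rightarrow> complex) \<Rightarrow> bool" where
  "completely_right_of r q \<longleftrightarrow>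
     path_image r \<inter> path_image q = {} \<and> (\<forall>z \<in> path_image r. right_mult q z = 1)"

text \<open>
  \<open>region_weight N y m\<close> multiplies the weights of all copies \<open>F\<close>, on the universal cover, of all
  faces \<open>f\<close>, where \<open>F\<close> is counted with the constant value on \<open>F\<close> of the multiplicity function \<open>m\<close>.
\<close>

definition face_mult :: "(complex \<Rightarrow> int) \<Rightarrow> complex set \<Rightarrow> int" where
  "face_mult m F = (THE n. \<forall>z \<in> F. m z = n)"

definition region_weight ::
    "('v, 'e) network \<Rightarrow> (complex set \<Rightarrow> real) \<Rightarrow> (complex \<Rightarrow> int) \<Rightarrow> real" where
  "region_weight N y m =
     (\<Prod>(f, F) \<in> {(f, F). f \<in> faces N \<and> F \<in> components (exp -` f) \<and> face_mult m F \<noteq> 0}.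
        y f powi face_mult m F)"

text \<open>
  \<open>wt_value N a T y t u p w\<close>: \<open>w\<close> is the weight of the path \<open>p\<close> from \<open>u\<close>, computed with some copy
  \<open>q\<close> of the path and some admissible copy \<open>r\<close> of the trail \<open>T\<close> from \<open>a\<close>.
  A product of two multiplicities counts the points lying in both of the regions.
\<close>

inductive wt_value ::
    "('v, 'e) network \<Rightarrow> 'v \<Rightarrow> 'e step list \<Rightarrow> (complex set \<Rightarrow> real) \<Rightarrow> real \<Rightarrow>
     'v \<Rightarrow> 'e awalk \<Rightarrow> real \<Rightarrow> bool"
  for N a T y t u p where
  same_boundary:
    "\<lbrakk>is_copy q (path_curve N u p);
      Re (pathstart q) = Re (pathfinish q)\<rbrakk>
     \<Longrightarrow> wt_value N a T y t u p (region_weight N y (enclosed_mult q))"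
| along_trail:
    "\<lbrakk>is_copy q (path_curve N u p); is_copy r (steps_curve N a T);
      Re (pathstart q) \<noteq> Re (pathfinish q); Re (pathstart q) = Re (pathstart r);
      completely_right_of r q\<rbrakk>
     \<Longrightarrow> wt_value N a T y t u p
           (t * region_weight N y (\<lambda>z. right_mult q z * left_mult r z))"
| against_trail:
    "\<lbrakk>is_copy q (path_curve N u p); is_copy r (steps_curve N a T);
      Re (pathstart q) \<noteq> Re (pathfinish q); Re (pathstart q) = Re (pathfinish r);
      completely_right_of r q\<rbrakk>
     \<Longrightarrow> wt_value N a T y t u p
           (inverse t * region_weight N y (\<lambda>z. right_mult q z * right_mult r z))"

text \<open>The value does not depend on the copies that are chosen.\<close>

definition wt ::
    "('v, 'e) network \<Rightarrow> 'v \<Rightarrow> 'e step list \<Rightarrow> (complex set \<Rightarrow> real) \<Rightarrow> real \<Rightarrow>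
     'v \<Rightarrow> 'e awalk \<Rightarrow> real" where
  "wt N a T y t u p = (THE w. wt_value N a T y t u p w)"

end

theory Submission
  imports Defs
begin

text \<open>
  Write a region weight as a product over edges: an edge \<open>e\<close> contributes \<open>x\<^sub>e\<close> with exponent the
  total multiplicity of the lifts of the face on its right, minus that of the lifts of the face on
  its left. The multiplicities are, up to sign, winding numbers of a closed curve in the strip,
  which is made of the copy of the path, the copy of the trail (backwards) and boundary segments.
  Each time this curve runs along a lift of \<open>e\<close>, it makes the multiplicity on the right of that
  lift exceed the one on its left by one. So the exponent of \<open>x\<^sub>e\<close> is the number of times the path
  uses \<open>e\<close> minus the signed number of times the trail uses \<open>e\<close>, and the latter cancels against
  the trail weight.

  As the edges are merely continuous arcs, the two sides of an edge are found by completing a piece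
  of it to a Jordan curve by an arc of a small circle. Janiszewski's theorem shows that each side
  of this Jordan curve lies, near an inner point of the edge, in a single face. The winding number
  of an arc that starts and ends away from the point jumps there like the winding number of the
  Jordan curve.
\<close>

section \<open>Completing a piece of a curve to a clockwise Jordan curve\<close>

text \<open>An edge may have the same face on both sides, so a one-sided limit cannot be taken
  inside a face. It is taken along a filter that approaches a point of a lifted edge from one side
  of a Jordan curve. In the crossing cases the region is given by a product of two multiplicities,
  which is not a winding number by itself. Because the trail copy \<open>r\<close> lies completely
  to the right of the path copy \<open>q\<close>, the product of \<open>right_mult q\<close> and
  \<open>left_mult r\<close> equals \<open>right_mult q - right_mult r\<close>, and this difference
  is one. The lifts of a face are counted through the translates of one point. It is not shown that
  faces do not wind around the cylinder; a lift containing two translates of a point is unbounded,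
  and its multiplicity is 0 because winding numbers vanish far away. The sums run over finite
  windows \<open>{-K..K}\<close>, since the winding numbers of the single pieces, which are not
  closed, need not vanish far away. As \<open>wt\<close> is a definite description, existence of a
  value is also needed: a trail copy moved far enough along the strip is admissible.\<close>

lemma first_exit_time:
  fixes f :: "real \<Rightarrow> real"
  assumes "continuous_on {t..u} f" "t \<le> u" "f t < \<rho>" "\<rho> < f u"
  obtains b where "t < b" "b < u" "f b = \<rho>" "\<And>s. t \<le> s \<Longrightarrow> s < b \<Longrightarrow> f s < \<rho>"
proof -
  define S where "S = {s \<in> {t..u}. f s = \<rho>}"
  have "S = {t..u} \<inter> f -` {\<rho>}"
    by (auto simp: S_def)
  moreover have "closed ({t..u} \<inter> f -` {\<rho>})"
    by (rule continuous_closed_preimage[OF assms(1)]) auto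
  ultimately have "compact S"
    by (metis bounded_closed_interval bounded_Int compact_eq_bounded_closed)
  moreover have "S \<noteq> {}"
  proof -
    have "\<exists>x\<ge>t. x \<le> u \<and> f x = \<rho>"
      by (rule IVT') (use assms in auto)
    then show ?thesis by (auto simp: S_def)
  qed
  ultimately obtain b where b: "b \<in> S" "\<And>s. s \<in> S \<Longrightarrow> b \<le> s"
    using compact_attains_inf[of S] by metis
  have "f s < \<rho>" if "t \<le> s" "s < b" for s
  proof (rule ccontr)
    assume "\<not> f s < \<rho>"
    moreover have "continuous_on {t..s} f"
      using assms(1) by (rule continuous_on_subset) (use that b in \<open>auto simp: S_def\<close>)
    ultimately have "\<exists>s'\<ge>t. s' \<le> s \<and> f s' = \<rho>"
      by (intro IVT') (use assms(3) that in auto)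
    then obtain s' where "t \<le> s'" "s' \<le> s" "f s' = \<rho>"
      by blast
    then have "s' \<in> S"
      using that b by (auto simp: S_def)
    with b(2) \<open>s' \<le> s\<close> that show False by fastforce
  qed
  moreover have "t \<noteq> b" "b \<noteq> u"
    using b(1) assms by (auto simp: S_def)
  ultimately show thesis
    using b(1) by (intro that[of b]) (auto simp: S_def)
qed

text \<open>The part of \<open>on_right\<close> that concerns the completion alone; contact point
  and region are left out, so that one completion can serve several of them.\<close>

definition right_cap :: "(real \<Rightarrow> complex) \<Rightarrow> real \<Rightarrow> real \<Rightarrow> (real \<Rightarrow> complex) \<Rightarrow> bool" where
  "right_cap c a b g \<longleftrightarrow>
     0 \<le> a \<and> b \<le> 1 \<and> pathstart g = c b \<and> pathfinish g = c a \<and>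
     simple_path (subpath a b c +++ g) \<and>
     (\<forall>z \<in> inside (path_image (subpath a b c +++ g)).
        winding_number (subpath a b c +++ g) z = -1)"

lemma on_right_iff:
  "on_right c f \<longleftrightarrow>
     (\<exists>a b g t. right_cap c a b g \<and> a < t \<and> t < b \<and>
        c t \<in> closure (f \<inter> inside (path_image (subpath a b c +++ g))))"
  unfolding on_right_def right_cap_def by blast

lemma right_cap_loop:
  assumes "right_cap c a b g"
  shows "pathfinish (subpath a b c +++ g) = pathstart (subpath a b c +++ g)"
  using assms by (simp add: right_cap_def)

lemma right_cap_paths:
  assumes "right_cap c a b g"
  shows "path (subpath a b c)" "path g" "path (subpath a b c +++ g)"
    "path_image (subpath a b c +++ g) = path_image (subpath a b c) \<union> path_image g"
proof -
  show "path (subpath a b c +++ g)"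
    using assms by (simp add: right_cap_def simple_path_imp_path)
  then show "path (subpath a b c)" "path g"
    using assms by (auto simp: right_cap_def)
  show "path_image (subpath a b c +++ g) = path_image (subpath a b c) \<union> path_image g"
    using assms by (simp add: right_cap_def path_image_join)
qed

lemma right_cap_inside_iff:
  assumes "right_cap c a b g" "z \<notin> path_image (subpath a b c +++ g)"
  shows "z \<in> inside (path_image (subpath a b c +++ g)) \<longleftrightarrow>
      winding_number (subpath a b c +++ g) z = -1"
    "z \<in> outside (path_image (subpath a b c +++ g)) \<longleftrightarrow>
      winding_number (subpath a b c +++ g) z = 0"
proof -
  let ?J = "subpath a b c +++ g"
  have 1: "z \<in> inside (path_image ?J) \<Longrightarrow> winding_number ?J z = -1"
    using assms by (auto simp: right_cap_def)
  have 2: "z \<in> outside (path_image ?J) \<Longrightarrow> winding_number ?J z = 0"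
    using right_cap_paths(3)[OF assms(1)] right_cap_loop[OF assms(1)]
    by (rule winding_number_zero_in_outside)
  have 3: "z \<in> inside (path_image ?J) \<or> z \<in> outside (path_image ?J)"
    using assms(2) inside_Un_outside[of "path_image ?J"] by blast
  show "z \<in> inside (path_image ?J) \<longleftrightarrow> winding_number ?J z = -1"
    "z \<in> outside (path_image ?J) \<longleftrightarrow> winding_number ?J z = 0"
    using 1 2 3 by auto
qed

lemma right_cap_on_curve:
  assumes "right_cap c a b g" "a < t" "t < b"
  shows "(subpath a b c +++ g) ((t - a) / (b - a) / 2) = c t"
    "0 < (t - a) / (b - a) / 2" "(t - a) / (b - a) / 2 < 1 / 2"
proof -
  define s where "s = (t - a) / (b - a)"
  have s: "0 < s" "s < 1" "(b - a) * s + a = t"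
    using assms by (auto simp: s_def field_simps)
  then show "(subpath a b c +++ g) ((t - a) / (b - a) / 2) = c t"
    "0 < (t - a) / (b - a) / 2" "(t - a) / (b - a) / 2 < 1 / 2"
    unfolding s_def[symmetric] by (auto simp: joinpaths_def subpath_def)
qed

text \<open>By the Jordan curve theorem the whole curve is the frontier of either side.\<close>

lemma right_cap_closure:
  assumes "right_cap c a b g" "a < t" "t < b" "0 < d"
  obtains z z' where "z \<in> ball (c t) d" "z \<in> inside (path_image (subpath a b c +++ g))"
    "z' \<in> ball (c t) d" "z' \<in> outside (path_image (subpath a b c +++ g))"
proof -
  let ?J = "subpath a b c +++ g"
  have "simple_path ?J"
    using assms by (simp add: right_cap_def)
  note J = Jordan_inside_outside[OF this right_cap_loop[OF assms(1)]]
  define s where "s = (t - a) / (b - a) / 2"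
  have "?J s = c t" "0 < s" "s < 1 / 2"
    using right_cap_on_curve[OF assms(1-3)] by (auto simp only: s_def)
  then have "c t \<in> path_image ?J"
    unfolding path_image_def by (intro image_eqI[of _ _ s]) auto
  then have "c t \<in> closure (inside (path_image ?J))" "c t \<in> closure (outside (path_image ?J))"
    using J by (auto simp: frontier_def)
  then obtain z z' where "z \<in> inside (path_image ?J)" "dist z (c t) < d"
    "z' \<in> outside (path_image ?J)" "dist z' (c t) < d"
    using \<open>0 < d\<close> unfolding closure_approachable by blast
  then show thesis
    by (intro that[of z z']) (auto simp: dist_commute)
qed

text \<open>The complex radius \<open>w\<close> lets the circle start at a prescribed point. At the
  centre the winding number is read off from a logarithm; on the disc it is constant.\<close>

lemma winding_number_rotated_circlepath:
  assumes "dist x z < norm w"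
  shows "winding_number (\<lambda>s. x + w * exp (2 * of_real pi * \<i> * of_real s)) z = 1"
proof -
  let ?\<kappa> = "\<lambda>s::real. x + w * exp (2 * of_real pi * \<i> * of_real s)"
  have w: "w \<noteq> 0"
    using assms by (metis norm_zero not_less zero_le_dist)
  have p: "path ?\<kappa>"
    unfolding path_def by (intro continuous_intros)
  have "winding_number ?\<kappa> x = winding_number (exp \<circ> (\<lambda>s. Ln w + 2 * of_real pi * \<i> * of_real s)) 0"
    using w by (subst winding_number_offset) (simp add: o_def exp_add)
  also have "\<dots> = 1"
    by (subst winding_number_compose_exp)
      (auto simp: path_def pathfinish_def pathstart_def intro!: continuous_intros)
  finally have x: "winding_number ?\<kappa> x = 1" .
  have "path_image ?\<kappa> \<subseteq> sphere x (norm w)"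
    by (auto simp: path_image_def dist_norm norm_mult norm_exp_eq_Re)
  then have "ball x (norm w) \<inter> path_image ?\<kappa> = {}"
    by auto
  then have "winding_number ?\<kappa> constant_on ball x (norm w)"
    using p by (intro winding_number_constant) (auto simp: pathfinish_def pathstart_def)
  then show ?thesis
    using x w assms unfolding constant_on_def by (metis centre_in_ball mem_ball zero_less_norm_iff)
qed

text \<open>A theta-curve argument. In a small disc about \<open>c t\<close>, the piece
  \<open>S\<close> of \<open>c\<close> runs from circle to circle, and the circle offers two ways
  back: \<open>g1\<close> counterclockwise, \<open>g2\<close> clockwise. Returning along
  \<open>g2\<close> instead of \<open>g1\<close> lowers the winding number about points of the disc
  by one. A point near \<open>c t\<close> outside \<open>S +++ g1\<close> has 0 for that curve,
  hence -1 for \<open>S +++ g2\<close>, which is therefore the clockwise one.\<close>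

lemma crosscut:
  fixes c :: "real \<Rightarrow> complex"
  assumes c: "simple_path c" and t: "0 < t" "t < 1" and "0 < r"
  obtains a b g where "right_cap c a b g" "a < t" "t < b"
    "path_image (subpath a b c +++ g) \<subseteq> cball (c t) r"
proof -
  define x where "x = c t"
  have inj: "u = v \<or> u = 0 \<and> v = 1 \<or> u = 1 \<and> v = 0"
    if "0 \<le> u" "u \<le> 1" "0 \<le> v" "v \<le> 1" "c u = c v" for u v
    using c that unfolding simple_path_def loop_free_def by auto
  have ne: "x \<noteq> c 0" "x \<noteq> c 1"
    using inj[of t 0] inj[of t 1] t by (auto simp: x_def)
  have contc: "continuous_on {0..1} c"
    using c by (simp add: simple_path_def path_def)
  \<comment> \<open>Halving the distances puts both ends of \<open>c\<close> outside the closed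
    disc, so \<open>c\<close> leaves it before and after \<open>t\<close>.\<close>
  define \<rho> where "\<rho> = min r (min (dist x (c 0)) (dist x (c 1)) / 2)"
  have "0 < dist x (c 0)" "0 < dist x (c 1)"
    using ne by auto
  then have \<rho>: "0 < \<rho>" "\<rho> \<le> r" "\<rho> < dist x (c 0)" "\<rho> < dist x (c 1)"
    using \<open>0 < r\<close> unfolding \<rho>_def by linarith+
  obtain b where b: "t < b" "b < 1" "dist x (c b) = \<rho>" "\<And>s. t \<le> s \<Longrightarrow> s < b \<Longrightarrow> dist x (c s) < \<rho>"
  proof (rule first_exit_time[of t 1 "\<lambda>s. dist x (c s)" \<rho>])
    show "continuous_on {t..1} (\<lambda>s. dist x (c s))"
      by (intro continuous_intros continuous_on_subset[OF contc]) (use t in auto)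
  qed (use t \<rho> in \<open>auto simp: x_def\<close>)
  \<comment> \<open>The last entry into the disc before \<open>t\<close> is the first exit of the
    reversed curve.\<close>
  obtain a' where a': "1 - t < a'" "a' < 1" "dist x (c (1 - a')) = \<rho>"
    "\<And>s. 1 - t \<le> s \<Longrightarrow> s < a' \<Longrightarrow> dist x (c (1 - s)) < \<rho>"
  proof (rule first_exit_time[of "1 - t" 1 "\<lambda>s. dist x (c (1 - s))" \<rho>])
    show "continuous_on {1 - t..1} (\<lambda>s. dist x (c (1 - s)))"
      by (intro continuous_intros continuous_on_compose2[OF contc]) (use t in auto)
  qed (use t \<rho> in \<open>auto simp: x_def\<close>)
  define a where "a = 1 - a'"
  have a: "0 < a" "a < t" "dist x (c a) = \<rho>"
    using a' by (auto simp: a_def)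
  have lt: "dist x (c s) < \<rho>" if "a < s" "s < b" for s
    using b(4)[of s] a'(4)[of "1 - s"] that by (cases "t \<le> s") (auto simp: a_def)
  have neab: "c a \<noteq> c b"
    using inj[of a b] a b t by auto
  define w where "w = c b - x"
  have w: "norm w = \<rho>"
    using b by (simp add: w_def dist_norm norm_minus_commute)
  define \<kappa> where "\<kappa> = (\<lambda>s::real. x + w * exp (2 * of_real pi * \<i> * of_real s))"
  have \<kappa>_eq: "\<kappa> = (\<lambda>v. x + w * v) \<circ> circlepath 0 1"
    by (auto simp: \<kappa>_def circlepath o_def)
  have w0: "w \<noteq> 0"
    using w \<rho> by auto
  have "simple_path \<kappa>"
    unfolding \<kappa>_eq
    by (intro simple_path_continuous_image continuous_intros) (auto simp: inj_on_def w0 simple_path_circlepath)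
  have im\<kappa>: "path_image \<kappa> = sphere x \<rho>"
  proof -
    have "path_image \<kappa> = (\<lambda>v. x + w * v) ` sphere 0 1"
      by (simp add: \<kappa>_eq path_image_compose)
    also have "\<dots> = sphere x \<rho>"
    proof (intro subset_antisym subsetI)
      fix v assume v: "v \<in> sphere x \<rho>"
      have "v = x + w * ((v - x) / w)" "(v - x) / w \<in> sphere 0 1"
        using w0 v w \<rho> by (auto simp: norm_divide dist_norm norm_minus_commute)
      then show "v \<in> (\<lambda>v. x + w * v) ` sphere 0 1" by blast
    qed (auto simp: norm_mult w dist_norm)
    finally show ?thesis .
  qed
  have \<kappa>01: "\<kappa> 0 = c b" "\<kappa> 1 = c b"
    by (auto simp: \<kappa>_def w_def)
  have "c a \<in> path_image \<kappa>"
    using a by (simp add: im\<kappa>)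
  then obtain s where s: "0 \<le> s" "s \<le> 1" "\<kappa> s = c a"
    by (auto simp: path_image_def)
  define S where "S = subpath a b c"
  define g1 where "g1 = subpath 0 s \<kappa>"
  define g2 where "g2 = subpath 1 s \<kappa>"
  have arcS: "arc S"
    unfolding S_def using c a b t neab by (intro arc_simple_path_subpath) auto
  have arcg: "arc g1" "arc g2"
    unfolding g1_def g2_def using \<open>simple_path \<kappa>\<close> s \<kappa>01 neab
    by (auto intro!: arc_simple_path_subpath)
  have ends: "pathstart S = c a" "pathfinish S = c b" "pathstart g1 = c b" "pathfinish g1 = c a"
    "pathstart g2 = c b" "pathfinish g2 = c a"
    using s \<kappa>01 by (auto simp: S_def g1_def g2_def)
  have imS: "path_image S = c ` {a..b}"
    using a b by (simp add: S_def path_image_subpath)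
  have img: "path_image g1 \<subseteq> sphere x \<rho>" "path_image g2 \<subseteq> sphere x \<rho>"
    using path_image_subpath_subset[of 0 s \<kappa>] path_image_subpath_subset[of 1 s \<kappa>] s im\<kappa>
    by (auto simp: g1_def g2_def)
  have "path_image S \<inter> sphere x \<rho> \<subseteq> {c a, c b}"
  proof
    fix y assume "y \<in> path_image S \<inter> sphere x \<rho>"
    then obtain v where v: "a \<le> v" "v \<le> b" "y = c v" "dist x (c v) = \<rho>"
      by (auto simp: imS)
    then have "v = a \<or> v = b"
      using lt[of v] by force
    with v show "y \<in> {c a, c b}" by auto
  qed
  then have simp12: "simple_path (S +++ g1)" "simple_path (S +++ g2)"
    using arcS arcg ends img by (auto intro!: simple_path_join_loop)
  have x_S: "x \<in> path_image (S +++ g1)"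
    using a b t ends by (auto simp: path_image_join imS x_def)
  have "x \<in> closure (outside (path_image (S +++ g1)))"
    using Jordan_inside_outside[OF simp12(1)] ends x_S by (auto simp: frontier_def)
  then obtain z where z: "z \<in> outside (path_image (S +++ g1))" "dist z x < \<rho>"
    using \<rho>(1) by (meson closure_approachable)
  have "z \<notin> path_image (S +++ g1)"
    using z outside_no_overlap[of "path_image (S +++ g1)"] by blast
  then have zS: "z \<notin> path_image S" "z \<notin> path_image g1" "z \<notin> path_image \<kappa>" "z \<notin> path_image g2"
    using z ends img im\<kappa> by (auto simp: path_image_join dist_commute)
  have paths: "path S" "path g1" "path g2" "path \<kappa>"
    using arcS arcg \<open>simple_path \<kappa>\<close> by (auto simp: arc_imp_path simple_path_imp_path)
  have "winding_number (S +++ g1) z = 0"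
    using z simp12 ends by (intro winding_number_zero_in_outside) (auto simp: simple_path_imp_path)
  then have W1: "winding_number S z + winding_number g1 z = 0"
    using zS paths ends by (simp add: winding_number_join)
  have W2: "winding_number (S +++ g2) z = winding_number S z + winding_number g2 z"
    using zS paths ends by (simp add: winding_number_join)
  \<comment> \<open>The full circle is \<open>g1\<close> followed by the reverse of
    \<open>g2\<close>.\<close>
  have "winding_number g1 z + winding_number (subpath s 1 \<kappa>) z = winding_number \<kappa> z"
    unfolding g1_def using winding_number_subpath_combine[of \<kappa> z 0 s 1] paths zS s by simp
  moreover have "winding_number \<kappa> z = 1"
    unfolding \<kappa>_def using z w by (intro winding_number_rotated_circlepath) (simp add: dist_commute)
  moreover have "winding_number (subpath s 1 \<kappa>) z = - winding_number g2 z"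
    using winding_number_reversepath[of g2 z] paths zS by (simp add: g2_def reversepath_subpath)
  ultimately have "winding_number g2 z = winding_number g1 z - 1"
    by (simp add: algebra_simps)
  then have W: "winding_number (S +++ g2) z = -1"
    using W1 W2 by simp
  have zin: "z \<in> inside (path_image (S +++ g2))"
  proof (rule ccontr)
    assume "z \<notin> inside (path_image (S +++ g2))"
    moreover have "z \<notin> path_image (S +++ g2)"
      using zS ends by (simp add: path_image_join)
    ultimately have "z \<in> outside (path_image (S +++ g2))"
      using inside_Un_outside[of "path_image (S +++ g2)"] by blast
    then have "winding_number (S +++ g2) z = 0"
      using simp12 ends by (intro winding_number_zero_in_outside) (auto simp: simple_path_imp_path)
    with W show False by simp
  qed
  have "winding_number (S +++ g2) z' = -1" if "z' \<in> inside (path_image (S +++ g2))" for z'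
    using simple_closed_path_winding_number_inside[OF simp12(2)] W zin that
    by (metis one_neq_neg_one)
  then have "right_cap c a b g2"
    using a b t simp12 ends by (auto simp: right_cap_def S_def)
  moreover have "path_image (S +++ g2) \<subseteq> cball x r"
  proof -
    have "dist x (c v) \<le> \<rho>" if "a \<le> v" "v \<le> b" for v
      using lt[of v] a b that by (cases "v = a \<or> v = b") auto
    then show ?thesis
      using img \<rho> ends by (force simp: path_image_join imS)
  qed
  ultimately show thesis
    using a b by (intro that[of a b g2]) (auto simp: S_def x_def)
qed

section \<open>The two sides of an edge\<close>

text \<open>Janiszewski's theorem for the curve \<open>?A\<close> and the rest \<open>C\<close> of
  the obstacle. Two nearby points on the same side are not separated by \<open>?A\<close>, nor by
  \<open>C\<close>, which stays away from \<open>\<gamma> s\<close>; as \<open>?A\<close> and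
  \<open>C\<close> meet in a connected set, their union does not separate the points either.\<close>

lemma jordan_side_connected:
  fixes \<gamma> :: "real \<Rightarrow> complex"
  assumes \<gamma>: "simple_path \<gamma>" "pathfinish \<gamma> = pathstart \<gamma>" and s: "0 < s" "s < 1"
    and K: "closed K" and "0 < e" and e: "ball (\<gamma> s) e \<inter> K \<subseteq> path_image \<gamma>"
  obtains d where "0 < d"
    "\<And>z z'. \<lbrakk>z \<in> ball (\<gamma> s) d; z' \<in> ball (\<gamma> s) d;
       z \<in> inside (path_image \<gamma>) \<and> z' \<in> inside (path_image \<gamma>) \<or>
       z \<in> outside (path_image \<gamma>) \<and> z' \<in> outside (path_image \<gamma>)\<rbrakk>
     \<Longrightarrow> connected_component (- K) z z'"
proof -
  let ?A = "path_image \<gamma>"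
  have cont: "continuous_on {0..1} \<gamma>"
    using \<gamma> by (simp add: simple_path_def path_def)
  then obtain \<eta>' where \<eta>': "\<eta>' > 0" "\<And>u. u \<in> {0..1} \<Longrightarrow> dist u s < \<eta>' \<Longrightarrow> dist (\<gamma> u) (\<gamma> s) < e"
    using s \<open>0 < e\<close> unfolding continuous_on_iff by (metis atLeastAtMost_iff less_eq_real_def)
  define \<eta> where "\<eta> = min \<eta>' (min s (1 - s))"
  have \<eta>: "0 < \<eta>" "\<eta> \<le> s" "\<eta> \<le> 1 - s" "\<And>u. u \<in> {0..1} \<Longrightarrow> dist u s < \<eta> \<Longrightarrow> \<gamma> u \<in> ball (\<gamma> s) e"
    using \<eta>' s by (auto simp: \<eta>_def dist_commute)
  \<comment> \<open>The curve without a short open arc around the parameter \<open>s\<close>. It is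
    connected because the curve closes up at its ends.\<close>
  define R where "R = \<gamma> ` {0..s - \<eta>} \<union> \<gamma> ` {s + \<eta>..1}"
  have sub: "{0..s - \<eta>} \<subseteq> {0..1}" "{s + \<eta>..1} \<subseteq> {0..1}"
    using \<eta> s by auto
  have "compact R"
    unfolding R_def using sub continuous_on_subset[OF cont]
    by (intro compact_Un compact_continuous_image) auto
  have "connected R"
    unfolding R_def
  proof (rule connected_Un)
    show "connected (\<gamma> ` {0..s - \<eta>})" "connected (\<gamma> ` {s + \<eta>..1})"
      using sub continuous_on_subset[OF cont] by (auto intro!: connected_continuous_image)
    have "\<gamma> 0 \<in> \<gamma> ` {0..s - \<eta>}" "\<gamma> 1 \<in> \<gamma> ` {s + \<eta>..1}"
      using \<eta> by auto
    moreover have "\<gamma> 0 = \<gamma> 1"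
      using \<gamma> by (simp add: pathfinish_def pathstart_def)
    ultimately show "\<gamma> ` {0..s - \<eta>} \<inter> \<gamma> ` {s + \<eta>..1} \<noteq> {}" by auto
  qed
  have RA: "R \<subseteq> ?A"
    using sub by (auto simp: R_def path_image_def)
  have AR: "\<gamma> u \<in> R \<or> \<gamma> u \<in> ball (\<gamma> s) e" if "u \<in> {0..1}" for u
  proof (cases "dist u s < \<eta>")
    case False
    then have "u \<in> {0..s - \<eta>} \<union> {s + \<eta>..1}"
      using that by (auto simp: dist_real_def)
    then show ?thesis
      by (auto simp: R_def)
  qed (use \<eta>(4)[OF that] in auto)
  have "\<gamma> s \<notin> R"
  proof
    assume "\<gamma> s \<in> R"
    then obtain u where "u \<in> {0..s - \<eta>} \<union> {s + \<eta>..1}" "\<gamma> u = \<gamma> s"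
      unfolding R_def by fastforce
    then show False
      using \<gamma>(1) s \<eta> sub unfolding simple_path_def loop_free_def
      by (smt (verit) UnE atLeastAtMost_iff)
  qed
  \<comment> \<open>\<open>K\<close> may meet the curve in any way outside the ball; adding
    \<open>R\<close> makes the intersection of \<open>?A\<close> and \<open>C\<close> exactly the
    connected set \<open>R\<close>.\<close>
  define C where "C = (K - ball (\<gamma> s) e) \<union> R"
  have "closed C"
    unfolding C_def using K compact_imp_closed[OF \<open>compact R\<close>] by (intro closed_Un closed_Diff open_ball)
  moreover have "\<gamma> s \<notin> C"
    using \<open>\<gamma> s \<notin> R\<close> \<open>0 < e\<close> by (auto simp: C_def)
  ultimately obtain d where d: "0 < d" "ball (\<gamma> s) d \<subseteq> - C"
    by (metis ComplI open_Compl open_contains_ball)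
  have AC: "?A \<inter> C = R"
  proof -
    have "?A \<subseteq> R \<union> ball (\<gamma> s) e"
      using AR unfolding path_image_def by blast
    with RA show ?thesis
      by (auto simp: C_def)
  qed
  have KAC: "- (?A \<union> C) \<subseteq> - K"
    using e by (auto simp: C_def)
  have J: "connected (inside ?A)" "connected (outside ?A)"
    using Jordan_inside_outside[OF \<gamma>] by auto
  show thesis
  proof (rule that[OF d(1)])
    fix z z' assume z: "z \<in> ball (\<gamma> s) d" "z' \<in> ball (\<gamma> s) d"
      and "z \<in> inside ?A \<and> z' \<in> inside ?A \<or> z \<in> outside ?A \<and> z' \<in> outside ?A"
    then have 1: "connected_component (- ?A) z z'"
      using J inside_no_overlap[of ?A] outside_no_overlap[of ?A]
      unfolding connected_component_def
      by (metis (no_types) compl_le_swap1 disjoint_eq_subset_Compl)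
    have 2: "connected_component (- C) z z'"
      using z d unfolding connected_component_def by (metis connected_ball)
    have "connected_component (- (?A \<union> C)) z z'"
      by (rule Janiszewski)
        (use 1 2 \<gamma> \<open>closed C\<close> \<open>connected R\<close> AC in \<open>auto simp: simple_path_imp_path\<close>)
    then show "connected_component (- K) z z'"
      using KAC connected_component_mono by blast
  qed
qed

text \<open>Only the piece from \<open>a\<close> to \<open>b\<close> passes through
  \<open>c t\<close>. The remaining pieces of \<open>c\<close> and the completion \<open>g\<close>
  miss that point, so their winding numbers are continuous there, and the jump of \<open>c\<close>
  is that of the Jordan curve.\<close>

lemma winding_number_cap:
  assumes "path c" "right_cap c a b g" "a < t" "t < b"
    "c t \<notin> c ` {0..a}" "c t \<notin> c ` {b..1}" "c t \<notin> path_image g"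
  obtains h where "isCont h (c t)"
    "\<And>z. z \<notin> path_image c \<Longrightarrow> z \<notin> path_image g \<Longrightarrow>
       winding_number c z = winding_number (subpath a b c +++ g) z + h z"
proof -
  define h where "h = (\<lambda>z. winding_number (subpath 0 a c) z + winding_number (subpath b 1 c) z
    - winding_number g z)"
  have ab: "a \<in> {0..1}" "b \<in> {0..1}"
    using assms by (auto simp: right_cap_def)
  note p = right_cap_paths[OF assms(2)]
  have "isCont h (c t)"
    unfolding h_def
    by (intro continuous_intros continuous_at_winding_number path_subpath)
      (use assms ab p in \<open>auto simp: path_image_subpath right_cap_def\<close>)
  moreover have "winding_number c z = winding_number (subpath a b c +++ g) z + h z"
    if z: "z \<notin> path_image c" "z \<notin> path_image g" for z
  proof -
    have "z \<notin> path_image (subpath a b c)"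
      using path_image_subpath_subset[OF ab, of c] z by auto
    then have "winding_number (subpath a b c +++ g) z = winding_number (subpath a b c) z + winding_number g z"
      using z p assms(2) by (intro winding_number_join) (auto simp: right_cap_def)
    moreover have "winding_number c z = winding_number (subpath 0 a c) z +
        winding_number (subpath a b c) z + winding_number (subpath b 1 c) z"
      using winding_number_subpath_combine[of c z 0 a b] winding_number_subpath_combine[of c z 0 b 1]
        assms(1) z ab by simp
    ultimately show ?thesis
      by (simp add: h_def)
  qed
  ultimately show thesis
    using that by blast
qed

lemma simple_path_interior_point:
  assumes "simple_path c" "0 \<le> a" "a < t" "t < b" "b \<le> 1"
  shows "c t \<notin> c ` {0..a}" "c t \<notin> c ` {b..1}"
proof -
  have inj: "u = v \<or> u = 0 \<and> v = 1 \<or> u = 1 \<and> v = 0"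
    if "u \<in> {0..1}" "v \<in> {0..1}" "c u = c v" for u v
    using assms(1) that unfolding simple_path_def loop_free_def by auto
  show "c t \<notin> c ` {0..a}" "c t \<notin> c ` {b..1}"
    using inj[of t] assms(2-) by (auto simp: image_iff) (metis atLeastAtMost_iff less_eq_real_def
      not_less order.strict_trans1 order.strict_trans2)+
qed

lemma right_cap_not_in_completion:
  assumes "right_cap c a b g" "a < t" "t < b"
  shows "c t \<notin> path_image g"
proof
  let ?J = "subpath a b c +++ g"
  assume "c t \<in> path_image g"
  then obtain u where u: "u \<in> {0..1}" "g u = c t"
    by (auto simp: path_image_def)
  define s where "s = (t - a) / (b - a) / 2"
  have s: "?J s = c t" "0 < s" "s < 1 / 2"
    using right_cap_on_curve[OF assms] by (auto simp only: s_def)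
  \<comment> \<open>At \<open>u = 0\<close> the join evaluates its first path, hence the case
    distinction.\<close>
  have "?J ((u + 1) / 2) = c t"
  proof (cases "u = 0")
    case True
    then show ?thesis
      using assms(1) u by (auto simp: joinpaths_def subpath_def right_cap_def pathstart_def)
  next
    case False
    then have "2 * ((u + 1) / 2) - 1 = u" "\<not> (u + 1) / 2 \<le> 1 / 2"
      using u by (auto simp: field_simps)
    then show ?thesis
      unfolding joinpaths_def using u by simp
  qed
  moreover have "(u + 1) / 2 \<in> {0..1}" "(u + 1) / 2 \<ge> 1 / 2" "s \<in> {0..1}"
    using u s by auto
  moreover have "loop_free ?J"
    using assms(1) by (auto simp: right_cap_def simple_path_def)
  ultimately show False
    using s unfolding loop_free_def by (smt (verit, best))
qed

lemma arc_near_interior_point: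
  assumes "simple_path c" "0 \<le> a" "a < t" "t < b" "b \<le> 1" "closed K0" "c t \<notin> K0"
  obtains e where "0 < e" "ball (c t) e \<inter> (K0 \<union> path_image c) \<subseteq> c ` {a<..<b}"
proof -
  have cont: "continuous_on {0..1} c"
    using assms(1) by (simp add: simple_path_def path_def)
  define C where "C = K0 \<union> (c ` {0..a} \<union> c ` {b..1})"
  have "compact (c ` {0..a})" "compact (c ` {b..1})"
    using continuous_on_subset[OF cont] assms by (auto intro!: compact_continuous_image)
  then have "closed C"
    unfolding C_def using assms(6) compact_imp_closed by (intro closed_Un) auto
  moreover have "c t \<notin> C"
    using simple_path_interior_point[OF assms(1-5)] assms by (auto simp: C_def)
  ultimately obtain e where e: "0 < e" "ball (c t) e \<subseteq> - C"
    by (metis ComplI open_Compl open_contains_ball)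
  have "K0 \<union> path_image c \<subseteq> C \<union> c ` {a<..<b}"
    using assms by (force simp: C_def path_image_def)
  with e show thesis
    by (intro that[of e]) auto
qed

text \<open>Both winding numbers jump in the same way across the common piece of the two Jordan curves;
  this is why the right-hand side of a curve does not depend on the completion.\<close>

lemma right_caps_compare:
  fixes \<sigma> :: complex
  assumes c: "simple_path c" "simple_path c'" "path_image c' = path_image c" "c' t' = c t"
    and J: "right_cap c a b g" "a < t" "t < b"
    and J': "right_cap c' a' b' g'" "a' < t'" "t' < b'"
    and \<sigma>: "\<sigma> = 1 \<or> \<sigma> = -1"
      "\<And>z. z \<notin> path_image c \<Longrightarrow> winding_number c' z = \<sigma> * winding_number c z"
  obtains d where "0 < d" "\<And>z. z \<in> ball (c t) d \<Longrightarrow> z \<notin> path_image c \<Longrightarrow>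
    z \<notin> path_image (subpath a b c +++ g) \<and> z \<notin> path_image (subpath a' b' c' +++ g') \<and>
    winding_number (subpath a' b' c' +++ g') z =
      \<sigma> * winding_number (subpath a b c +++ g) z + (\<sigma> - 1) / 2"
proof -
  let ?J = "subpath a b c +++ g" and ?J' = "subpath a' b' c' +++ g'"
  have pc: "path c" "path c'"
    using c by (auto simp: simple_path_imp_path)
  have ab: "0 \<le> a" "b \<le> 1" "0 \<le> a'" "b' \<le> 1"
    using J J' by (auto simp: right_cap_def)
  have g: "c t \<notin> path_image g" "c t \<notin> path_image g'"
    using right_cap_not_in_completion[OF J] right_cap_not_in_completion[OF J'] c by auto
  obtain h where h: "isCont h (c t)" "\<And>z. z \<notin> path_image c \<Longrightarrow> z \<notin> path_image g \<Longrightarrow>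
       winding_number c z = winding_number ?J z + h z"
    using winding_number_cap[OF pc(1) J simple_path_interior_point[OF c(1) ab(1) J(2,3) ab(2)] g(1)] by metis
  obtain h' where h': "isCont h' (c' t')" "\<And>z. z \<notin> path_image c' \<Longrightarrow> z \<notin> path_image g' \<Longrightarrow>
       winding_number c' z = winding_number ?J' z + h' z"
    using winding_number_cap[OF pc(2) J' simple_path_interior_point[OF c(2) ab(3) J'(2,3) ab(4)]
        g(2)[folded c(4)]] by metis
  \<comment> \<open>\<open>k\<close> compares the continuous remainders of the two curves. Near
    \<open>c t\<close> it varies by less than 1, but off \<open>c\<close> it is an integer
    combination of winding numbers of the two Jordan curves.\<close>
  define k where "k = (\<lambda>z. \<sigma> * h z - h' z)"
  have "isCont k (c t)"
    unfolding k_def using h(1) h'(1) c(4) by (intro continuous_intros) auto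
  then obtain e2 where e2: "0 < e2" "\<And>z. dist z (c t) < e2 \<Longrightarrow> dist (k z) (k (c t)) < 1 / 2"
    unfolding continuous_at_eps_delta by (metis dist_norm half_gt_zero_iff zero_less_one)
  have "closed (path_image g \<union> path_image g')"
    using right_cap_paths(2)[OF J(1)] right_cap_paths(2)[OF J'(1)] by (intro closed_Un closed_path_image)
  then obtain e1 where e1: "0 < e1"
    "ball (c t) e1 \<inter> (path_image g \<union> path_image g' \<union> path_image c) \<subseteq> c ` {a<..<b}"
    using arc_near_interior_point[OF c(1) ab(1) J(2,3) ab(2)] g by (metis UnE)
  define d where "d = min e1 e2"
  have "0 < d"
    using e1 e2 by (simp add: d_def)
  have im: "c ` {a<..<b} \<subseteq> path_image c"
    using ab by (auto simp: path_image_def)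
  have off: "z \<notin> path_image g" "z \<notin> path_image g'" "z \<notin> path_image ?J" "z \<notin> path_image ?J'"
    if "z \<in> ball (c t) d" "z \<notin> path_image c" for z
  proof -
    have "z \<in> ball (c t) e1"
      using that by (auto simp: d_def)
    then show *: "z \<notin> path_image g" "z \<notin> path_image g'"
      using that e1 im by blast+
    show "z \<notin> path_image ?J" "z \<notin> path_image ?J'"
      using that * right_cap_paths(4)[OF J(1)] right_cap_paths(4)[OF J'(1)] ab J J' c(3)
        path_image_subpath_subset[of a b c] path_image_subpath_subset[of a' b' c']
      by auto
  qed
  have off': "z \<notin> path_image c" if "z \<in> ball (c t) d" "z \<notin> path_image ?J" for z
  proof
    assume "z \<in> path_image c"
    moreover have "z \<in> ball (c t) e1"
      using that by (auto simp: d_def)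
    ultimately have "z \<in> c ` {a<..<b}"
      using e1 by blast
    then show False
      using that right_cap_paths(4)[OF J(1)] J by (auto simp: path_image_subpath)
  qed
  have k: "winding_number ?J' z - \<sigma> * winding_number ?J z = k z"
    if "z \<in> ball (c t) d" "z \<notin> path_image c" for z
    using h(2)[of z] h'(2)[of z] off[OF that] that c(3) \<sigma>(2)[of z] by (simp add: algebra_simps k_def)
  have ints: "winding_number ?J z \<in> {-1, 0}" "winding_number ?J' z \<in> {-1, 0}"
    if "z \<in> ball (c t) d" "z \<notin> path_image c" for z
    using right_cap_inside_iff[OF J(1)] right_cap_inside_iff[OF J'(1)] off[OF that]
      inside_Un_outside[of "path_image ?J"] inside_Un_outside[of "path_image ?J'"] by blast+
  obtain z z' where z: "z \<in> ball (c t) d" "z \<in> inside (path_image ?J)"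
    "z' \<in> ball (c t) d" "z' \<in> outside (path_image ?J)"
    using right_cap_closure[OF J \<open>0 < d\<close>] by blast
  then have "z \<notin> path_image ?J" "z' \<notin> path_image ?J"
    using inside_no_overlap[of "path_image ?J"] outside_no_overlap[of "path_image ?J"] by blast+
  then have zz': "z \<notin> path_image c" "z' \<notin> path_image c"
    and W: "winding_number ?J z = -1" "winding_number ?J z' = 0"
    using right_cap_inside_iff[OF J(1)] z off' by auto
  \<comment> \<open>A point inside and a point outside the first Jordan curve leave two possible
    values each. Being less than 1 apart they coincide: the common value is 0 for \<sigma> = 1 and
    -1 for \<sigma> = -1, that is \<open>(\<sigma> - 1) / 2\<close>.\<close>
  have kz: "k z \<in> {\<sigma> - 1, \<sigma>}" "k z' \<in> {-1, 0}"
    using k[OF z(1) zz'(1)] k[OF z(3) zz'(2)] ints[OF z(1) zz'(1)] ints[OF z(3) zz'(2)] W by auto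
  have dist: "dist (k y) (k x) < 1" if "y \<in> ball (c t) d" "x \<in> ball (c t) d" for x y
  proof (rule dist_triangle_half_r)
    show "dist (k (c t)) (k y) < 1 / 2" "dist (k (c t)) (k x) < 1 / 2"
      using e2(2)[of x] e2(2)[of y] that by (auto simp: d_def dist_commute)
  qed
  have kz: "k z = (\<sigma> - 1) / 2"
    using kz dist[OF z(1) z(3)] \<sigma>(1) by (elim disjE insertE emptyE) (simp_all add: dist_norm)
  have "winding_number ?J' y = \<sigma> * winding_number ?J y + (\<sigma> - 1) / 2"
    if y: "y \<in> ball (c t) d" "y \<notin> path_image c" for y
  proof -
    have "norm (winding_number ?J' y - \<sigma> * winding_number ?J y - (\<sigma> - 1) / 2) < 1"
      using dist[OF y(1) z(1)] k[OF y] kz by (simp add: dist_norm)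
    with ints[OF y] \<sigma>(1) show ?thesis
      by (elim disjE insertE emptyE) simp_all
  qed
  with off \<open>0 < d\<close> show thesis
    by (intro that[of d]) auto
qed

section \<open>The faces on the two sides of an arc\<close>

lemma components_eqI:
  assumes "f \<in> components S" "f' \<in> components S" "z \<in> f" "z \<in> f'"
  shows "f = f'"
  using components_nonoverlap[OF assms(1,2)] assms(3,4) by blast

text \<open>\<open>K0\<close> collects all other obstacles. The arc may meet it at its end points
  only, and it may be closed, so loops and edges with common vertices are covered.\<close>

locale free_arc =
  fixes K0 :: "complex set" and c :: "real \<Rightarrow> complex"
  assumes closed_K0: "closed K0" and simple: "simple_path c" and disj: "c ` {0<..<1} \<inter> K0 = {}"
begin

definition K :: "complex set" where
  "K = K0 \<union> path_image c"

lemma closed_K: "closed K"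
  using closed_K0 simple by (auto simp: K_def simple_path_imp_path closed_path_image)

text \<open>\<open>f\<close> is on the right and \<open>f'\<close> on the left of \<open>c\<close>
  at the parameter \<open>t\<close>. Unlike in \<open>on_right\<close>, the whole one-sided
  neighbourhood has to lie in the face; this is what makes the pair unique and locally constant in
  \<open>t\<close>.\<close>

definition side_faces :: "real \<Rightarrow> complex set \<Rightarrow> complex set \<Rightarrow> bool" where
  "side_faces t f f' \<longleftrightarrow> f \<in> components (- K) \<and> f' \<in> components (- K) \<and>
     (\<exists>a b g d. right_cap c a b g \<and> a < t \<and> t < b \<and> 0 < d \<and>
        inside (path_image (subpath a b c +++ g)) \<inter> ball (c t) d \<subseteq> f \<and>
        outside (path_image (subpath a b c +++ g)) \<inter> ball (c t) d \<subseteq> f')"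

text \<open>Near \<open>c t\<close> the obstacle is part of the Jordan curve, so
  \<open>jordan_side_connected\<close> puts each side into a single component.\<close>

lemma right_cap_side_faces:
  assumes J: "right_cap c a b g" "a < t" "t < b"
  obtains f f' d where "0 < d" "f \<in> components (- K)" "f' \<in> components (- K)"
    "inside (path_image (subpath a b c +++ g)) \<inter> ball (c t) d \<subseteq> f"
    "outside (path_image (subpath a b c +++ g)) \<inter> ball (c t) d \<subseteq> f'"
proof -
  let ?J = "subpath a b c +++ g"
  have ab: "0 \<le> a" "b \<le> 1"
    using J by (auto simp: right_cap_def)
  have "t \<in> {0<..<1}"
    using J ab by auto
  then have "c t \<notin> K0"
    using disj by blast
  then obtain e where e: "0 < e" "ball (c t) e \<inter> K \<subseteq> c ` {a<..<b}"
    unfolding K_def using arc_near_interior_point[OF simple ab(1) J(2,3) ab(2) closed_K0] by blast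
  define s where "s = (t - a) / (b - a) / 2"
  have s: "?J s = c t" "0 < s" "s < 1 / 2"
    using right_cap_on_curve[OF J] by (auto simp only: s_def)
  have "c ` {a<..<b} \<subseteq> path_image ?J"
    using right_cap_paths(4)[OF J(1)] J by (auto simp: path_image_subpath)
  then have eJ: "ball (c t) e \<inter> K \<subseteq> path_image ?J"
    using e by blast
  have "simple_path ?J"
    using J by (simp add: right_cap_def)
  then obtain d0 where d0: "0 < d0"
    "\<And>z z'. \<lbrakk>z \<in> ball (c t) d0; z' \<in> ball (c t) d0;
       z \<in> inside (path_image ?J) \<and> z' \<in> inside (path_image ?J) \<or>
       z \<in> outside (path_image ?J) \<and> z' \<in> outside (path_image ?J)\<rbrakk>
     \<Longrightarrow> connected_component (- K) z z'"
    using jordan_side_connected[of ?J s K e] right_cap_loop[OF J(1)] s closed_K e eJ by auto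
  define d where "d = min d0 e"
  have d: "0 < d" "ball (c t) d \<subseteq> ball (c t) d0" "ball (c t) d \<subseteq> ball (c t) e"
    using d0 e by (auto simp: d_def)
  obtain z z' where z: "z \<in> ball (c t) d" "z \<in> inside (path_image ?J)"
    "z' \<in> ball (c t) d" "z' \<in> outside (path_image ?J)"
    using right_cap_closure[OF J d(1)] by blast
  have "z \<in> - K" "z' \<in> - K"
    using z d eJ inside_no_overlap[of "path_image ?J"] outside_no_overlap[of "path_image ?J"] by blast+
  then have "connected_component_set (- K) z \<in> components (- K)"
    "connected_component_set (- K) z' \<in> components (- K)"
    by (auto intro: componentsI)
  moreover have "inside (path_image ?J) \<inter> ball (c t) d \<subseteq> connected_component_set (- K) z"
    "outside (path_image ?J) \<inter> ball (c t) d \<subseteq> connected_component_set (- K) z'"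
    using d0(2) z d by blast+
  ultimately show thesis
    using d(1) by (intro that[of d "connected_component_set (- K) z" "connected_component_set (- K) z'"])
qed

text \<open>\<open>right_caps_compare\<close> with factor 1: close to \<open>c t\<close>, a point
  off \<open>c\<close> inside one Jordan curve is inside the other.\<close>

lemma side_faces_unique:
  assumes "side_faces t f1 f1'" "side_faces t f2 f2'"
  shows "f1 = f2" "f1' = f2'"
proof -
  obtain a b g d1 where J: "right_cap c a b g" "a < t" "t < b" and d1: "0 < d1"
    "inside (path_image (subpath a b c +++ g)) \<inter> ball (c t) d1 \<subseteq> f1"
    "outside (path_image (subpath a b c +++ g)) \<inter> ball (c t) d1 \<subseteq> f1'"
    and f1: "f1 \<in> components (- K)" "f1' \<in> components (- K)"
    using assms(1) unfolding side_faces_def by blast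
  obtain a' b' g' d2 where J': "right_cap c a' b' g'" "a' < t" "t < b'" and d2: "0 < d2"
    "inside (path_image (subpath a' b' c +++ g')) \<inter> ball (c t) d2 \<subseteq> f2"
    "outside (path_image (subpath a' b' c +++ g')) \<inter> ball (c t) d2 \<subseteq> f2'"
    and f2: "f2 \<in> components (- K)" "f2' \<in> components (- K)"
    using assms(2) unfolding side_faces_def by blast
  let ?J = "subpath a b c +++ g" and ?J' = "subpath a' b' c +++ g'"
  obtain d3 where d3: "0 < d3" "\<And>z. z \<in> ball (c t) d3 \<Longrightarrow> z \<notin> path_image c \<Longrightarrow>
    z \<notin> path_image ?J \<and> z \<notin> path_image ?J' \<and> winding_number ?J' z = winding_number ?J z"
    using right_caps_compare[OF simple simple refl refl J J', of 1] by auto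
  define d where "d = min d1 (min d2 d3)"
  have d: "0 < d" "ball (c t) d \<subseteq> ball (c t) d1" "ball (c t) d \<subseteq> ball (c t) d2"
      "ball (c t) d \<subseteq> ball (c t) d3"
    using d1 d2 d3 by (auto simp: d_def)
  obtain z z' where z: "z \<in> ball (c t) d" "z \<in> inside (path_image ?J)"
    "z' \<in> ball (c t) d" "z' \<in> outside (path_image ?J)"
    using right_cap_closure[OF J d(1)] by blast
  have zf: "z \<in> f1" "z' \<in> f1'"
    using z d d1 by blast+
  then have "z \<notin> path_image c" "z' \<notin> path_image c"
    using f1 in_components_subset unfolding K_def by blast+
  moreover have "z \<in> ball (c t) d3" "z' \<in> ball (c t) d3"
    using z d by blast+
  ultimately have W: "z \<notin> path_image ?J" "z \<notin> path_image ?J'" "winding_number ?J' z = winding_number ?J z"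
    "z' \<notin> path_image ?J" "z' \<notin> path_image ?J'" "winding_number ?J' z' = winding_number ?J z'"
    using d3(2) by blast+
  then have "z \<in> inside (path_image ?J')" "z' \<in> outside (path_image ?J')"
    using z right_cap_inside_iff(1)[OF J(1) W(1)] right_cap_inside_iff(1)[OF J'(1) W(2)]
      right_cap_inside_iff(2)[OF J(1) W(4)] right_cap_inside_iff(2)[OF J'(1) W(5)] by simp_all
  then have "z \<in> f2" "z' \<in> f2'"
    using z d d2 by blast+
  with zf f1 f2 show "f1 = f2" "f1' = f2'"
    using components_eqI by metis+
qed

lemma side_faces_ex:
  assumes "0 < t" "t < 1"
  obtains f f' where "side_faces t f f'"
proof -
  obtain a b g where J: "right_cap c a b g" "a < t" "t < b"
    by (rule crosscut[OF simple assms zero_less_one])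
  show thesis
  proof (rule right_cap_side_faces[OF J])
    fix f f' d
    assume "0 < d" "f \<in> components (- K)" "f' \<in> components (- K)"
      "inside (path_image (subpath a b c +++ g)) \<inter> ball (c t) d \<subseteq> f"
      "outside (path_image (subpath a b c +++ g)) \<inter> ball (c t) d \<subseteq> f'"
    with J show thesis
      by (intro that[of f f']) (unfold side_faces_def, blast)
  qed
qed

text \<open>The completion for \<open>t\<close> also serves nearby parameters, with a smaller disc
  inside the old one.\<close>

lemma side_faces_locally_constant:
  assumes "side_faces t f f'"
  obtains e where "0 < e" "\<And>t'. dist t' t < e \<Longrightarrow> side_faces t' f f'"
proof -
  obtain a b g d where J: "right_cap c a b g" "a < t" "t < b" and d: "0 < d"
    "inside (path_image (subpath a b c +++ g)) \<inter> ball (c t) d \<subseteq> f"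
    "outside (path_image (subpath a b c +++ g)) \<inter> ball (c t) d \<subseteq> f'"
    and f: "f \<in> components (- K)" "f' \<in> components (- K)"
    using assms(1) unfolding side_faces_def by blast
  have ab: "0 \<le> a" "b \<le> 1"
    using J by (auto simp: right_cap_def)
  have "continuous_on {0..1} c"
    using simple by (simp add: simple_path_def path_def)
  then obtain e0 where e0: "0 < e0" "\<And>t'. t' \<in> {0..1} \<Longrightarrow> dist t' t < e0 \<Longrightarrow> dist (c t') (c t) < d"
  proof (rule continuous_onE)
    show "t \<in> {0..1}"
      using J ab by auto
  qed (use d(1) in auto)
  define e where "e = min e0 (min (t - a) (b - t))"
  have "0 < e"
    using e0 J by (simp add: e_def)
  moreover have "side_faces t' f f'" if t': "dist t' t < e" for t'
  proof -
    have J': "a < t'" "t' < b"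
      using t' by (auto simp: e_def dist_real_def)
    then have "dist (c t') (c t) < d"
      using e0(2)[of t'] t' ab by (auto simp: e_def)
    moreover define d' where "d' = d - dist (c t') (c t)"
    ultimately have "0 < d'" "ball (c t') d' \<subseteq> ball (c t) d"
      by (auto simp: d'_def dist_commute intro: le_less_trans[OF dist_triangle])
        (metis add_less_cancel_left diff_add_cancel dist_commute dist_triangle le_less_trans less_diff_eq)
    then show ?thesis
      using J J' f d unfolding side_faces_def by blast
  qed
  ultimately show thesis
    using that by blast
qed

text \<open>A unique and locally constant pair is constant on the connected interval of inner
  parameters.\<close>

lemma side_faces_everywhere:
  obtains R L where "\<And>t. 0 < t \<Longrightarrow> t < 1 \<Longrightarrow> side_faces t R L"
proof -
  define F where "F t = (SOME p. side_faces t (fst p) (snd p))" for t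
  have F: "side_faces t (fst (F t)) (snd (F t))" if t: "0 < t" "t < 1" for t
  proof -
    obtain f f' where "side_faces t f f'"
      by (rule side_faces_ex[OF t])
    then have "side_faces t (fst (f, f')) (snd (f, f'))"
      by simp
    then show ?thesis
      unfolding F_def by (rule someI)
  qed
  have "F constant_on {0<..<1}"
  proof (rule locally_constant_imp_constant)
    fix t :: real assume t: "t \<in> {0<..<1}"
    then have Ft: "side_faces t (fst (F t)) (snd (F t))"
      using F by auto
    obtain e where e: "0 < e" "\<And>t'. dist t' t < e \<Longrightarrow> side_faces t' (fst (F t)) (snd (F t))"
      using side_faces_locally_constant[OF Ft] by blast
    have "F t' = F t" if "t' \<in> {0<..<1} \<inter> ball t e" for t'
    proof -
      have "0 < t'" "t' < 1" "dist t' t < e"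
        using that by (auto simp: dist_commute)
      then show ?thesis
        using side_faces_unique[OF F e(2)] by (simp add: prod_eq_iff)
    qed
    moreover have "openin (top_of_set {0<..<1}) ({0<..<1} \<inter> ball t e)"
      by (simp add: openin_open_Int)
    ultimately show "\<exists>T. openin (top_of_set {0<..<1}) T \<and> t \<in> T \<and> (\<forall>x\<in>T. F x = F t)"
      using t e(1) by (metis IntI centre_in_ball)
  qed (rule connected_Ioo)
  then obtain p where "\<And>t. 0 < t \<Longrightarrow> t < 1 \<Longrightarrow> F t = p"
    unfolding constant_on_def by (metis greaterThanLessThan_iff)
  with F show thesis
    by (metis that)
qed

text \<open>\<open>on_right\<close> may use any completion and any contact point; all of them detect
  the same face.\<close>

lemma on_right_iff_side_faces:
  assumes RL: "\<And>t. 0 < t \<Longrightarrow> t < 1 \<Longrightarrow> side_faces t R L" and f: "f \<in> components (- K)"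
  shows "on_right c f \<longleftrightarrow> f = R"
proof
  assume "on_right c f"
  then obtain a b g t where J: "right_cap c a b g" "a < t" "t < b"
      and cl: "c t \<in> closure (f \<inter> inside (path_image (subpath a b c +++ g)))"
    unfolding on_right_iff by blast
  obtain f1 f1' d where d: "0 < d" "f1 \<in> components (- K)" "f1' \<in> components (- K)"
    "inside (path_image (subpath a b c +++ g)) \<inter> ball (c t) d \<subseteq> f1"
    "outside (path_image (subpath a b c +++ g)) \<inter> ball (c t) d \<subseteq> f1'"
    by (rule right_cap_side_faces[OF J])
  then have "side_faces t f1 f1'"
    using J unfolding side_faces_def by blast
  then have "f1 = R"
    using side_faces_unique RL J by (meson right_cap_def less_le_trans le_less_trans)
  obtain z where "z \<in> f" "z \<in> inside (path_image (subpath a b c +++ g))" "dist z (c t) < d"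
    using cl d(1) unfolding closure_approachable by blast
  then have "z \<in> f" "z \<in> f1"
    using d(4) by (auto simp: dist_commute)
  then show "f = R"
    using f d(2) \<open>f1 = R\<close> components_eqI by blast
next
  assume "f = R"
  obtain a b g d where J: "right_cap c a b g" "a < 1/2" "1/2 < b" and d: "0 < d"
    "inside (path_image (subpath a b c +++ g)) \<inter> ball (c (1/2)) d \<subseteq> R"
    using RL[of "1/2"] unfolding side_faces_def by auto
  have "c (1/2) \<in> closure (f \<inter> inside (path_image (subpath a b c +++ g)))"
    unfolding closure_approachable
  proof (intro allI impI)
    fix e :: real assume "0 < e"
    then have "0 < min d e"
      using d by simp
    then obtain z where "z \<in> ball (c (1/2)) (min d e)" "z \<in> inside (path_image (subpath a b c +++ g))"
      using right_cap_closure[OF J] by blast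
    then show "\<exists>y\<in>f \<inter> inside (path_image (subpath a b c +++ g)). dist y (c (1/2)) < e"
      using d \<open>f = R\<close> by (intro bexI[of _ z]) (auto simp: dist_commute)
  qed
  with J show "on_right c f"
    unfolding on_right_iff by blast
qed

text \<open>The face on the left is obtained as the face on the right of the reversed arc.
  \<open>right_caps_compare\<close> with factor -1 identifies it with the face outside the clockwise
  completions of \<open>c\<close> itself.\<close>

lemma two_sides:
  obtains R L where "R \<in> components (- K)" "L \<in> components (- K)"
    "\<And>f. f \<in> components (- K) \<Longrightarrow> on_right c f \<longleftrightarrow> f = R"
    "\<And>f. f \<in> components (- K) \<Longrightarrow> on_left c f \<longleftrightarrow> f = L"
    "\<And>a b g t. \<lbrakk>right_cap c a b g; a < t; t < b\<rbrakk> \<Longrightarrow> \<exists>d>0.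
       inside (path_image (subpath a b c +++ g)) \<inter> ball (c t) d \<subseteq> R \<and>
       outside (path_image (subpath a b c +++ g)) \<inter> ball (c t) d \<subseteq> L"
proof -
  obtain R L where RL: "\<And>t. 0 < t \<Longrightarrow> t < 1 \<Longrightarrow> side_faces t R L"
    using side_faces_everywhere by blast
  have comp: "R \<in> components (- K)" "L \<in> components (- K)"
    using RL[of "1/2"] unfolding side_faces_def by auto
  let ?r = "reversepath c"
  interpret rev: free_arc K0 ?r
  proof
    show "?r ` {0<..<1} \<inter> K0 = {}"
    proof -
      have "?r ` {0<..<1} \<subseteq> c ` {0<..<1}"
        by (auto simp: reversepath_def)
      with disj show ?thesis by blast
    qed
  qed (use closed_K0 simple in \<open>auto simp: simple_path_reversepath\<close>)
  have K': "rev.K = K"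
    by (simp add: K_def rev.K_def)
  obtain R' L' where RL': "\<And>t. 0 < t \<Longrightarrow> t < 1 \<Longrightarrow> rev.side_faces t R' L'"
    using rev.side_faces_everywhere by blast
  have "R' = L"
  proof -
    obtain a b g d1 where J: "right_cap c a b g" "a < 1/2" "1/2 < b" and d1: "0 < d1"
      "outside (path_image (subpath a b c +++ g)) \<inter> ball (c (1/2)) d1 \<subseteq> L"
      using RL[of "1/2"] unfolding side_faces_def by auto
    have r: "?r (1/2) = c (1/2)"
      by (simp add: reversepath_def)
    obtain a' b' g' d2 where J': "right_cap ?r a' b' g'" "a' < 1/2" "1/2 < b'" and d2: "0 < d2"
      "inside (path_image (subpath a' b' ?r +++ g')) \<inter> ball (c (1/2)) d2 \<subseteq> R'"
      and R': "R' \<in> components (- K)"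
      using RL'[of "1/2"] unfolding rev.side_faces_def r K' by auto
    let ?J = "subpath a b c +++ g" and ?J' = "subpath a' b' ?r +++ g'"
    obtain d3 where d3: "0 < d3" "\<And>z. z \<in> ball (c (1/2)) d3 \<Longrightarrow> z \<notin> path_image c \<Longrightarrow>
      z \<notin> path_image ?J \<and> z \<notin> path_image ?J' \<and> winding_number ?J' z = - 1 - winding_number ?J z"
    proof (rule right_caps_compare[OF simple rev.simple _ r J J', of "-1"])
      show "\<And>z. z \<notin> path_image c \<Longrightarrow> winding_number ?r z = - 1 * winding_number c z"
        using simple by (simp add: winding_number_reversepath simple_path_imp_path)
    qed auto
    define d where "d = min d1 (min d2 d3)"
    have d: "0 < d" "ball (c (1/2)) d \<subseteq> ball (c (1/2)) d1" "ball (c (1/2)) d \<subseteq> ball (c (1/2)) d2"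
        "ball (c (1/2)) d \<subseteq> ball (c (1/2)) d3"
      using d1 d2 d3 by (auto simp: d_def)
    obtain z where z: "z \<in> ball (c (1/2)) d" "z \<in> outside (path_image ?J)"
      using right_cap_closure[OF J d(1)] by blast
    have zf: "z \<in> L"
      using z d d1 by blast+
    then have "z \<notin> path_image c"
      using comp in_components_subset unfolding K_def by blast
    then have z': "z \<notin> path_image ?J" "z \<notin> path_image ?J'" "winding_number ?J' z = - 1 - winding_number ?J z"
      using d3(2)[of z] z d by auto
    then have "z \<in> inside (path_image ?J')"
      using right_cap_inside_iff[OF J(1) z'(1)] right_cap_inside_iff[OF J'(1) z'(2)] z by auto
    then have "z \<in> R'"
      using z d d2 by blast
    with zf comp R' show "R' = L"
      using components_eqI by metis
  qed
  then have left: "on_left c f \<longleftrightarrow> f = L" if "f \<in> components (- K)" for f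
    using rev.on_right_iff_side_faces[OF RL', of f] that unfolding K' on_left_def by simp
  show thesis
  proof (rule that[OF comp on_right_iff_side_faces[OF RL] left])
    fix a b g t assume J: "right_cap c a b g" "a < t" "t < b"
    obtain f1 f1' d where d: "0 < d" "f1 \<in> components (- K)" "f1' \<in> components (- K)"
      "inside (path_image (subpath a b c +++ g)) \<inter> ball (c t) d \<subseteq> f1"
      "outside (path_image (subpath a b c +++ g)) \<inter> ball (c t) d \<subseteq> f1'"
      by (rule right_cap_side_faces[OF J])
    then have "side_faces t f1 f1'"
      using J unfolding side_faces_def by blast
    then have "f1 = R" "f1' = L"
      using side_faces_unique[OF _ RL] J by (meson right_cap_def less_le_trans le_less_trans)+
    with d show "\<exists>d>0. inside (path_image (subpath a b c +++ g)) \<inter> ball (c t) d \<subseteq> R \<and>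
       outside (path_image (subpath a b c +++ g)) \<inter> ball (c t) d \<subseteq> L"
      by blast
  qed auto
qed

end

lemma power_int_prod_distrib:
  fixes x :: "'a \<Rightarrow> 'b :: field"
  shows "(\<Prod>i\<in>A. x i) powi n = (\<Prod>i\<in>A. x i powi n)"
  by (induction A rule: infinite_finite_induct) (auto simp: power_int_mult_distrib)

section \<open>The faces along an edge of a network\<close>

locale cyl_net =
  fixes N :: "('v, 'e) network"
  assumes net: "cylinder_network N"
begin

abbreviation "E \<equiv> arcs (graph N)"
abbreviation "V \<equiv> verts (graph N)"

lemma finite_E: "finite E" and finite_V: "finite V"
  using net by (auto simp: cylinder_network_def fin_digraph_def fin_digraph_axioms_def)

lemma arc_verts: "e \<in> E \<Longrightarrow> tail (graph N) e \<in> V" "e \<in> E \<Longrightarrow> head (graph N) e \<in> V"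
  using net by (auto simp: cylinder_network_def fin_digraph_def wf_digraph_def)

lemma curve_simple: "e \<in> E \<Longrightarrow> simple_path (curve N e)"
  and curve_start: "e \<in> E \<Longrightarrow> pathstart (curve N e) = pos N (tail (graph N) e)"
  and curve_finish: "e \<in> E \<Longrightarrow> pathfinish (curve N e) = pos N (head (graph N) e)"
  and edge_interior: "e \<in> E \<Longrightarrow> edge_interior N e \<subseteq> open_cylinder - pos N ` V"
  and weight_pos: "e \<in> E \<Longrightarrow> 0 < weight N e"
  and edges_disjoint: "e \<in> E \<Longrightarrow> e' \<in> E \<Longrightarrow> e \<noteq> e' \<Longrightarrow> edge_interior N e \<inter> edge_interior N e' = {}"
  and pos_cylinder: "pos N ` V \<subseteq> cylinder"
  using net unfolding cylinder_network_def by simp_all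

lemma curve_path: "e \<in> E \<Longrightarrow> path (curve N e)"
  by (simp add: curve_simple simple_path_imp_path)

lemma open_cylinder_open: "open open_cylinder"
proof -
  have "open_cylinder = norm -` {1<..<exp 1}"
    by (auto simp: open_cylinder_def)
  moreover have "open (norm -` {1<..<exp 1} :: complex set)"
    by (intro open_vimage continuous_intros open_greaterThanLessThan)
  ultimately show ?thesis by simp
qed

lemma curve_image:
  assumes "e \<in> E"
  shows "path_image (curve N e) \<subseteq> edge_interior N e \<union> pos N ` V"
proof
  fix z assume "z \<in> path_image (curve N e)"
  then obtain s where s: "0 \<le> s" "s \<le> 1" "z = curve N e s"
    by (auto simp: path_image_def)
  consider "s = 0" | "s = 1" | "s \<in> {0<..<1}"
    using s by fastforce
  then show "z \<in> edge_interior N e \<union> pos N ` V"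
  proof cases
    case 1
    then show ?thesis
      using s curve_start[OF assms] arc_verts[OF assms] by (auto simp: pathstart_def)
  next
    case 2
    then show ?thesis
      using s curve_finish[OF assms] arc_verts[OF assms] by (auto simp: pathfinish_def)
  qed (use s in \<open>auto simp: edge_interior_def\<close>)
qed

lemma interior_not_other:
  assumes "e \<in> E" "0 < t" "t < 1" "e' \<in> E" "e' \<noteq> e"
  shows "curve N e t \<notin> path_image (curve N e')"
proof -
  have "curve N e t \<in> edge_interior N e"
    using assms by (auto simp: edge_interior_def)
  then show ?thesis
    using curve_image[OF assms(4)] edge_interior[OF assms(1)] edges_disjoint[OF assms(1,4)] assms(5)
    by blast
qed

lemma interior_not_vertex:
  assumes "e \<in> E" "0 < t" "t < 1" "v \<in> V"
  shows "curve N e t \<noteq> pos N v"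
proof -
  have "curve N e t \<in> edge_interior N e"
    using assms by (auto simp: edge_interior_def)
  then show ?thesis
    using edge_interior[OF assms(1)] assms(4) by blast
qed

lemma compact_drawing: "compact (drawing N)"
  unfolding drawing_def using finite_E finite_V curve_path
  by (intro compact_Un compact_UN) (auto intro: finite_imp_compact compact_path_image)

lemma open_complement: "open (open_cylinder - drawing N)"
  using open_cylinder_open compact_drawing by (intro open_Diff compact_imp_closed)

lemma drawing_cylinder: "drawing N \<subseteq> cylinder"
proof -
  have "open_cylinder \<subseteq> cylinder"
    by (auto simp: open_cylinder_def cylinder_def)
  then have "path_image (curve N e) \<subseteq> cylinder" if "e \<in> E" for e
    using curve_image[OF that] edge_interior[OF that] pos_cylinder by blast
  then show ?thesis
    unfolding drawing_def using pos_cylinder by blast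
qed

lemma faces_subset: "f \<in> faces N \<Longrightarrow> f \<subseteq> open_cylinder - drawing N"
  unfolding faces_def by (rule in_components_subset)

lemma edge_two_sides:
  assumes e: "e \<in> E"
  shows "\<exists>R L. R \<in> faces N \<and> L \<in> faces N \<and>
    (\<forall>f\<in>faces N. on_right (curve N e) f \<longleftrightarrow> f = R) \<and>
    (\<forall>f\<in>faces N. on_left (curve N e) f \<longleftrightarrow> f = L) \<and>
    (\<forall>a b g t. right_cap (curve N e) a b g \<longrightarrow> a < t \<longrightarrow> t < b \<longrightarrow> (\<exists>d>0.
       inside (path_image (subpath a b (curve N e) +++ g)) \<inter> ball (curve N e t) d \<subseteq> R \<and>
       outside (path_image (subpath a b (curve N e) +++ g)) \<inter> ball (curve N e t) d \<subseteq> L))"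
proof -
  \<comment> \<open>Everything that the inner part of the edge avoids. Together with the edge this
    is exactly the complement of the union of the faces.\<close>
  define K0 where "K0 = - open_cylinder \<union> (pos N ` V \<union> (\<Union>e'\<in>E - {e}. path_image (curve N e')))"
  interpret free_arc K0 "curve N e"
  proof
    have "compact (pos N ` V \<union> (\<Union>e'\<in>E - {e}. path_image (curve N e')))"
      using finite_E finite_V curve_path
      by (intro compact_Un compact_UN) (auto intro: finite_imp_compact compact_path_image)
    then show "closed K0"
      unfolding K0_def using open_cylinder_open by (intro closed_Un[OF _ compact_imp_closed]) auto
    show "simple_path (curve N e)"
      using e by (rule curve_simple)
    have "curve N e t \<notin> K0" if "t \<in> {0<..<1}" for t
    proof -
      have "curve N e t \<in> edge_interior N e"
        using that by (auto simp: edge_interior_def)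
      then show ?thesis
        using edge_interior[OF e] interior_not_other[OF e, of t] that unfolding K0_def by auto
    qed
    then show "curve N e ` {0<..<1} \<inter> K0 = {}"
      by blast
  qed
  have "- K = open_cylinder - drawing N"
    unfolding K_def unfolding K0_def drawing_def using e by auto
  then have "components (- K) = faces N"
    by (simp add: faces_def)
  with two_sides show ?thesis
    by metis
qed

text \<open>Both faces are chosen at once, because the last clause ties them to the two sides of the
  same completion.\<close>

definition sides :: "'e \<Rightarrow> complex set \<times> complex set" where
  "sides e = (SOME p. fst p \<in> faces N \<and> snd p \<in> faces N \<and>
    (\<forall>f\<in>faces N. on_right (curve N e) f \<longleftrightarrow> f = fst p) \<and>
    (\<forall>f\<in>faces N. on_left (curve N e) f \<longleftrightarrow> f = snd p) \<and>
    (\<forall>a b g t. right_cap (curve N e) a b g \<longrightarrow> a < t \<longrightarrow> t < b \<longrightarrow> (\<exists>d>0.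
       inside (path_image (subpath a b (curve N e) +++ g)) \<inter> ball (curve N e t) d \<subseteq> fst p \<and>
       outside (path_image (subpath a b (curve N e) +++ g)) \<inter> ball (curve N e t) d \<subseteq> snd p)))"

definition rface :: "'e \<Rightarrow> complex set" where "rface e = fst (sides e)"
definition lface :: "'e \<Rightarrow> complex set" where "lface e = snd (sides e)"

lemma sides_props:
  assumes "e \<in> E"
  shows "rface e \<in> faces N \<and> lface e \<in> faces N \<and>
    (\<forall>f\<in>faces N. on_right (curve N e) f \<longleftrightarrow> f = rface e) \<and>
    (\<forall>f\<in>faces N. on_left (curve N e) f \<longleftrightarrow> f = lface e) \<and>
    (\<forall>a b g t. right_cap (curve N e) a b g \<longrightarrow> a < t \<longrightarrow> t < b \<longrightarrow> (\<exists>d>0.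
       inside (path_image (subpath a b (curve N e) +++ g)) \<inter> ball (curve N e t) d \<subseteq> rface e \<and>
       outside (path_image (subpath a b (curve N e) +++ g)) \<inter> ball (curve N e t) d \<subseteq> lface e))"
proof -
  obtain R L where RL: "R \<in> faces N \<and> L \<in> faces N \<and>
    (\<forall>f\<in>faces N. on_right (curve N e) f \<longleftrightarrow> f = R) \<and>
    (\<forall>f\<in>faces N. on_left (curve N e) f \<longleftrightarrow> f = L) \<and>
    (\<forall>a b g t. right_cap (curve N e) a b g \<longrightarrow> a < t \<longrightarrow> t < b \<longrightarrow> (\<exists>d>0.
       inside (path_image (subpath a b (curve N e) +++ g)) \<inter> ball (curve N e t) d \<subseteq> R \<and>
       outside (path_image (subpath a b (curve N e) +++ g)) \<inter> ball (curve N e t) d \<subseteq> L))"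
    using edge_two_sides[OF assms] by (elim exE) (rule that)
  show ?thesis
    unfolding rface_def lface_def sides_def by (rule someI[of _ "(R, L)"]) (use RL in simp)
qed

lemma I_plus_iff: "e \<in> I_plus N f \<longleftrightarrow> e \<in> E \<and> f = rface e" if "f \<in> faces N"
  using sides_props that by (auto simp: I_plus_def)

lemma I_minus_iff: "e \<in> I_minus N f \<longleftrightarrow> e \<in> E \<and> f = lface e" if "f \<in> faces N"
  using sides_props that by (auto simp: I_minus_def)

lemma cap_faces:
  assumes "e \<in> E" "right_cap (curve N e) a b g" "a < t" "t < b"
  obtains d where "0 < d"
    "inside (path_image (subpath a b (curve N e) +++ g)) \<inter> ball (curve N e t) d \<subseteq> rface e"
    "outside (path_image (subpath a b (curve N e) +++ g)) \<inter> ball (curve N e t) d \<subseteq> lface e"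
  using sides_props[OF assms(1)] assms(2-) by (elim conjE) metis

lemma connected_open_cylinder: "connected (open_cylinder - pos N ` V)"
proof (rule connected_open_delete_finite[OF open_cylinder_open])
  have *: "open_cylinder = {z. 1 < norm (z - 0) \<and> norm (z - 0) < exp 1}"
    by (simp add: open_cylinder_def)
  show "connected open_cylinder"
    unfolding * by (rule connected_annulus) simp
qed (use finite_V in auto)

text \<open>The open cylinder without the vertices is connected, and because of the edges the face
  is a proper part of it; so the face has a frontier point there. This point is inner to some edge,
  and near it only the two faces along that edge occur. It follows that there are finitely many
  faces.\<close>

lemma face_along_edge:
  assumes f: "f \<in> faces N" and "E \<noteq> {}"
  obtains e where "e \<in> E" "f = rface e \<or> f = lface e"
proof -
  let ?U = "open_cylinder - drawing N" and ?X = "open_cylinder - pos N ` V"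
  have fU: "f \<subseteq> ?U" "f \<noteq> {}"
    using f faces_subset in_components_nonempty unfolding faces_def by auto
  have "f \<subseteq> ?X"
    using fU by (auto simp: drawing_def)
  have "open f"
    using f open_complement open_components unfolding faces_def by blast
  have "f \<noteq> ?X"
  proof -
    obtain e where e: "e \<in> E"
      using \<open>E \<noteq> {}\<close> by blast
    have "curve N e (1/2) \<in> edge_interior N e" "curve N e (1/2) \<in> path_image (curve N e)"
      by (auto simp: edge_interior_def path_image_def)
    moreover from this have "curve N e (1/2) \<in> drawing N"
      using e by (auto simp: drawing_def)
    ultimately have "curve N e (1/2) \<in> edge_interior N e" "curve N e (1/2) \<in> drawing N"
      by blast+
    then show ?thesis
      using edge_interior[OF e] fU by blast
  qed
  then have "frontier f \<inter> ?X \<noteq> {}"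
    using connected_Int_frontier[OF connected_open_cylinder, of f] \<open>f \<subseteq> ?X\<close> fU by blast
  then obtain x where x: "x \<in> frontier f" "x \<in> open_cylinder" "x \<notin> pos N ` V"
    by blast
  have "frontier f \<subseteq> - ?U"
  proof (rule frontier_of_components_closed_complement)
    show "closed (- ?U)"
      using open_complement by (rule closed_Compl)
    show "f \<in> components (- (- ?U))"
      using f by (simp only: faces_def double_compl)
  qed
  with x obtain e where e: "e \<in> E" "x \<in> edge_interior N e"
    using curve_image by (fastforce simp: drawing_def)
  then obtain t where t: "0 < t" "t < 1" "x = curve N e t"
    by (auto simp: edge_interior_def)
  obtain a b g where J: "right_cap (curve N e) a b g" "a < t" "t < b"
    by (rule crosscut[OF curve_simple[OF e(1)] t(1,2) zero_less_one])
  let ?J = "subpath a b (curve N e) +++ g"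
  obtain d where d: "0 < d" "inside (path_image ?J) \<inter> ball (curve N e t) d \<subseteq> rface e"
    "outside (path_image ?J) \<inter> ball (curve N e t) d \<subseteq> lface e"
    by (rule cap_faces[OF e(1) J])
  have faces: "rface e \<in> faces N" "lface e \<in> faces N"
    using sides_props[OF e(1)] by auto
  \<comment> \<open>Comparing the completion with itself yields that near the point everything off
    the edge is also off the Jordan curve.\<close>
  obtain d' where d': "0 < d'" "\<And>z. z \<in> ball (curve N e t) d' \<Longrightarrow> z \<notin> path_image (curve N e) \<Longrightarrow>
      z \<notin> path_image ?J"
    by (rule right_caps_compare[OF curve_simple[OF e(1)] curve_simple[OF e(1)] refl refl J J, of 1]) auto
  have "x \<in> closure f"
    using x(1) by (simp add: frontier_def)
  moreover have "0 < min d d'"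
    using d d' by simp
  ultimately obtain z where z: "z \<in> f" "dist z x < min d d'"
    unfolding closure_approachable by blast
  have "z \<notin> path_image (curve N e)"
    using z fU e(1) by (auto simp: drawing_def)
  moreover have zball: "z \<in> ball (curve N e t) d'" "z \<in> ball (curve N e t) d"
    using z(2) t(3) by (auto simp: dist_commute)
  ultimately have "z \<notin> path_image ?J"
    using d'(2) by blast
  then have "z \<in> inside (path_image ?J) \<or> z \<in> outside (path_image ?J)"
    using inside_Un_outside[of "path_image ?J"] by blast
  then have "z \<in> rface e \<or> z \<in> lface e"
    using d(2,3) zball by blast
  then have "f = rface e \<or> f = lface e"
    using components_eqI z(1) f faces unfolding faces_def by metis
  with e(1) show thesis
    by (rule that)
qed

lemma finite_faces:
  assumes "E \<noteq> {}"
  shows "finite (faces N)"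
proof (rule finite_subset)
  show "faces N \<subseteq> rface ` E \<union> lface ` E"
    using face_along_edge[OF _ assms] by blast
qed (use finite_E in auto)

lemma face_weight_eq:
  assumes "f \<in> faces N"
  shows "face_weight N f = (\<Prod>e\<in>E. (if f = rface e then weight N e else 1) *
    (if f = lface e then inverse (weight N e) else 1))"
proof -
  have "(\<Prod>e\<in>I_plus N f. weight N e) = (\<Prod>e\<in>E. if f = rface e then weight N e else 1)"
    using finite_E I_plus_iff[OF assms] by (intro prod.mono_neutral_cong_left) auto
  moreover have "(\<Prod>e\<in>I_minus N f. inverse (weight N e)) =
      (\<Prod>e\<in>E. if f = lface e then inverse (weight N e) else 1)"
    using finite_E I_minus_iff[OF assms] by (intro prod.mono_neutral_cong_left) auto
  ultimately show ?thesis
    by (simp add: face_weight_def prod.distrib)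
qed

text \<open>After interchanging the products, each edge sees only the two faces along it; if these
  coincide, its exponent is 0.\<close>

lemma prod_face_weights:
  fixes S :: "complex set \<Rightarrow> int"
  assumes "E \<noteq> {}"
  shows "(\<Prod>f\<in>faces N. face_weight N f powi S f) =
    (\<Prod>e\<in>E. weight N e powi (S (rface e) - S (lface e)))"
proof -
  have "(\<Prod>f\<in>faces N. face_weight N f powi S f) =
     (\<Prod>f\<in>faces N. \<Prod>e\<in>E. (if f = rface e then weight N e powi S f else 1) *
      (if f = lface e then inverse (weight N e) powi S f else 1))"
    by (intro prod.cong refl) (auto simp: face_weight_eq power_int_prod_distrib power_int_mult_distrib intro!: prod.cong)
  also have "\<dots> = (\<Prod>e\<in>E. \<Prod>f\<in>faces N. (if f = rface e then weight N e powi S f else 1) *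
      (if f = lface e then inverse (weight N e) powi S f else 1))"
    by (rule prod.swap)
  also have "\<dots> = (\<Prod>e\<in>E. weight N e powi (S (rface e) - S (lface e)))"
  proof (intro prod.cong refl)
    fix e assume e: "e \<in> E"
    have "(\<Prod>f\<in>faces N. (if f = rface e then weight N e powi S f else 1) *
        (if f = lface e then inverse (weight N e) powi S f else 1)) =
      weight N e powi S (rface e) * inverse (weight N e) powi S (lface e)"
      using sides_props[OF e] finite_faces[OF assms] by (simp add: prod.distrib prod.delta')
    also have "\<dots> = weight N e powi (S (rface e) - S (lface e))"
      using weight_pos[OF e] by (simp add: power_int_diff power_int_inverse divide_inverse)
    finally show "(\<Prod>f\<in>faces N. (if f = rface e then weight N e powi S f else 1) *
        (if f = lface e then inverse (weight N e) powi S f else 1)) =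
      weight N e powi (S (rface e) - S (lface e))" .
  qed
  finally show ?thesis .
qed

end

section \<open>Winding numbers under the covering map\<close>

lemma simple_path_cong:
  assumes "\<And>s. s \<in> {0..1} \<Longrightarrow> p s = q s"
  shows "simple_path p \<longleftrightarrow> simple_path q"
proof -
  have "continuous_on {0..1} p \<longleftrightarrow> continuous_on {0..1} q"
    using assms by (intro continuous_on_cong) auto
  then show ?thesis
    using assms by (simp add: simple_path_def path_def loop_free_def)
qed

text \<open>On the disc, \<open>exp u - exp w\<close> is \<open>u - w\<close> times a continuous
  function without zeros. That function has a continuous logarithm, which returns to its initial
  value along a closed curve and so adds nothing to the winding number.\<close>

lemma winding_number_exp_local:
  assumes \<gamma>: "path \<gamma>" "pathfinish \<gamma> = pathstart \<gamma>" "path_image \<gamma> \<subseteq> ball x r" "r \<le> pi"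
    and w: "w \<in> ball x r" "w \<notin> path_image \<gamma>"
  shows "winding_number (exp \<circ> \<gamma>) (exp w) = winding_number \<gamma> w"
proof -
  \<comment> \<open>The difference quotient of \<open>exp\<close>, continued by the derivative. It
    has no zeros, since two points of the disc are less than 2 pi apart and \<open>exp\<close> is
    injective there.\<close>
  define h where "h = (\<lambda>u. if u = w then exp w else (exp u - exp w) / (u - w))"
  have h: "exp u - exp w = (u - w) * h u" for u
    by (simp add: h_def)
  have h0: "h u \<noteq> 0" if "u \<in> ball x r" for u
  proof (cases "u = w")
    case False
    have "\<bar>Im u - Im w\<bar> \<le> norm (u - w)"
      using abs_Im_le_cmod[of "u - w"] by simp
    also have "\<dots> < 2 * pi"
      using dist_triangle_less_add[of u x r w r] that w \<gamma>(4) by (simp add: dist_norm norm_minus_commute)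
    finally have "exp u \<noteq> exp w"
      using exp_complex_eqI[of u w] False by auto
    then show ?thesis
      using False by (simp add: h_def)
  qed (simp add: h_def)
  have "isCont h u" for u
  proof (cases "u = w")
    case True
    have "((\<lambda>u. (exp u - exp w) / (u - w)) \<longlongrightarrow> exp w) (at w)"
      using DERIV_exp[of w] by (simp add: has_field_derivative_iff)
    then have "(h \<longlongrightarrow> exp w) (at w)"
      by (rule Lim_transform_eventually) (auto simp: h_def eventually_at_filter)
    then show ?thesis
      by (simp add: True isCont_def h_def)
  next
    case False
    have "isCont (\<lambda>u. (exp u - exp w) / (u - w)) u"
      using False by (intro continuous_intros) auto
    moreover have "eventually (\<lambda>u. u \<noteq> w) (nhds u)"
      using False by (intro t1_space_nhds) auto
    then have "eventually (\<lambda>u. h u = (exp u - exp w) / (u - w)) (nhds u)"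
      by eventually_elim (simp add: h_def)
    ultimately show ?thesis
      using isCont_cong by metis
  qed
  then have "continuous_on (ball x r) h"
    by (simp add: continuous_at_imp_continuous_on)
  then obtain k where k: "continuous_on (ball x r) k" "\<And>u. u \<in> ball x r \<Longrightarrow> h u = exp (k u)"
    using continuous_logarithm_on_ball[of x r h] h0 by metis
  obtain q where q: "path q" "pathfinish q - pathstart q = 2 * of_real pi * \<i> * winding_number \<gamma> w"
    "\<And>s. s \<in> {0..1} \<Longrightarrow> \<gamma> s = w + exp (q s)"
    by (rule winding_number_as_continuous_log[OF \<gamma>(1) w(2)]) metis
  have pk: "path (\<lambda>s. q s + k (\<gamma> s))"
  proof -
    have "path (k \<circ> \<gamma>)"
      using \<gamma>(1,3) k(1) by (meson path_continuous_image continuous_on_subset)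
    then show ?thesis
      using q(1) unfolding path_def comp_def by (intro continuous_on_add)
  qed
  have "winding_number (exp \<circ> \<gamma>) (exp w) = winding_number (\<lambda>s. exp (\<gamma> s) - exp w) 0"
    by (subst winding_number_offset) (simp add: o_def)
  also have "\<dots> = winding_number (exp \<circ> (\<lambda>s. q s + k (\<gamma> s))) 0"
  proof (rule winding_number_cong)
    fix s :: real assume "0 \<le> s" "s \<le> 1"
    then have "s \<in> {0..1}" "\<gamma> s \<in> path_image \<gamma>"
      by (auto simp: path_image_def)
    then have s: "s \<in> {0..1}" "\<gamma> s \<in> ball x r"
      using \<gamma>(3) by blast+
    show "exp (\<gamma> s) - exp w = (exp \<circ> (\<lambda>s. q s + k (\<gamma> s))) s"
      using h[of "\<gamma> s"] k(2)[OF s(2)] q(3)[OF s(1)] by (simp add: exp_add)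
  qed
  also have "\<dots> = winding_number \<gamma> w"
  proof -
    have "\<gamma> 1 = \<gamma> 0"
      using \<gamma>(2) by (simp add: pathfinish_def pathstart_def)
    then show ?thesis
      using q(2) by (subst winding_number_compose_exp[OF pk]) (simp add: pathfinish_def pathstart_def)
  qed
  finally show ?thesis .
qed

abbreviation shift :: "int \<Rightarrow> complex \<Rightarrow> complex" where
  "shift k w \<equiv> w + 2 * of_real pi * \<i> * of_int k"

lemma exp_shift: "exp (shift k w) = exp w"
  by (auto simp: exp_eq)

lemma exp_eq_shift: "exp w = exp z \<longleftrightarrow> (\<exists>k. w = shift k z)"
  by (auto simp: exp_eq algebra_simps)

lemma winding_number_shift:
  "winding_number (\<lambda>s. shift j (c s)) (shift k w) = winding_number c (shift (k - j) w)"
  by (subst (1 2) winding_number_offset) (simp add: algebra_simps)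

text \<open>The difference of two copies is continuous, and its values are integer multiples of 2 pi
  i, which are at least 2 pi apart.\<close>

lemma copies_differ_by_shift:
  assumes "is_copy q c" "is_copy q' c"
  obtains j where "\<And>s. s \<in> {0..1} \<Longrightarrow> q s = shift j (q' s)"
proof -
  have ex: "\<exists>j. q s = shift j (q' s)" if "s \<in> {0..1}" for s
    using assms that exp_eq_shift[of "q s" "q' s"] by (simp add: is_copy_def)
  have "(\<lambda>s. q s - q' s) constant_on {0..1}"
  proof (rule continuous_discrete_range_constant)
    show "continuous_on {0..1} (\<lambda>s. q s - q' s)"
      using assms by (intro continuous_intros) (auto simp: is_copy_def path_def)
    fix s :: real assume s: "s \<in> {0..1}"
    have "2 * pi \<le> norm ((q u - q' u) - (q s - q' s))"
      if u: "u \<in> {0..1}" and ne: "q u - q' u \<noteq> q s - q' s" for u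
    proof -
      obtain j k where jk: "q u = shift j (q' u)" "q s = shift k (q' s)"
        using ex u s by metis
      then have "(q u - q' u) - (q s - q' s) = 2 * of_real pi * \<i> * of_int (j - k)"
        by (simp add: algebra_simps)
      moreover have "j \<noteq> k"
        using ne jk by auto
      then have "1 \<le> \<bar>real_of_int (j - k)\<bar>"
        by linarith
      ultimately show ?thesis
        by (simp add: norm_mult del: of_int_diff)
    qed
    then show "\<exists>e>0. \<forall>u. u \<in> {0..1} \<and> q u - q' u \<noteq> q s - q' s \<longrightarrow> e \<le> norm ((q u - q' u) - (q s - q' s))"
      by (intro exI[of _ "2 * pi"]) auto
  qed auto
  then obtain d where d: "\<And>s. s \<in> {0..1} \<Longrightarrow> q s - q' s = d"
    unfolding constant_on_def by blast
  obtain j where "q 0 = shift j (q' 0)"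
    using ex[of 0] by auto
  then have "q s = shift j (q' s)" if "s \<in> {0..1}" for s
    using d[OF that] d[of 0] by (simp add: algebra_simps)
  then show thesis
    by (rule that)
qed

text \<open>A continuous logarithm of a curve that avoids 0 is a lift along
  \<open>exp\<close>.\<close>

lemma copy_exists:
  assumes "path c" "0 \<notin> path_image c"
  obtains q where "is_copy q c"
  by (rule winding_number_as_continuous_log[OF assms]) (use that in \<open>auto simp: is_copy_def\<close>)

section \<open>Jumps across an edge\<close>

text \<open>\<open>FR\<close> and \<open>FL\<close> stand for the approach from the right and from
  the left. Only the difference of the two limits is recorded, so terms continuous at the point can
  be added freely; thus curves that are not closed, with their non-integer winding numbers, are
  covered.\<close>

definition jump :: "complex filter \<Rightarrow> complex filter \<Rightarrow> (complex \<Rightarrow> complex) \<Rightarrow> complex \<Rightarrow> bool" where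
  "jump FR FL \<phi> n \<longleftrightarrow> (\<exists>l. (\<phi> \<longlongrightarrow> l + n) FR \<and> (\<phi> \<longlongrightarrow> l) FL)"

lemma jump_add:
  assumes "jump FR FL \<phi> m" "jump FR FL \<psi> n"
  shows "jump FR FL (\<lambda>w. \<phi> w + \<psi> w) (m + n)"
proof -
  obtain l l' where "(\<phi> \<longlongrightarrow> l + m) FR" "(\<phi> \<longlongrightarrow> l) FL" "(\<psi> \<longlongrightarrow> l' + n) FR" "(\<psi> \<longlongrightarrow> l') FL"
    using assms unfolding jump_def by blast
  then have "((\<lambda>w. \<phi> w + \<psi> w) \<longlongrightarrow> (l + l') + (m + n)) FR" "((\<lambda>w. \<phi> w + \<psi> w) \<longlongrightarrow> l + l') FL"
    using tendsto_add[of \<phi> "l + m" FR \<psi> "l' + n"] tendsto_add[of \<phi> l FL \<psi> l'] by (simp_all add: algebra_simps)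
  then show ?thesis
    unfolding jump_def by blast
qed

lemma jump_uminus:
  assumes "jump FR FL \<phi> m"
  shows "jump FR FL (\<lambda>w. - \<phi> w) (- m)"
proof -
  obtain l where "(\<phi> \<longlongrightarrow> l + m) FR" "(\<phi> \<longlongrightarrow> l) FL"
    using assms unfolding jump_def by blast
  then have "((\<lambda>w. - \<phi> w) \<longlongrightarrow> - l + - m) FR" "((\<lambda>w. - \<phi> w) \<longlongrightarrow> - l) FL"
    using tendsto_minus[of \<phi> "l + m" FR] by (auto intro: tendsto_minus)
  then show ?thesis
    unfolding jump_def by blast
qed

lemma jump_const: "jump FR FL (\<lambda>w. c) 0"
  unfolding jump_def by (intro exI[of _ c]) auto

lemma jump_sum:
  assumes "\<And>i. i \<in> I \<Longrightarrow> jump FR FL (\<phi> i) (n i)"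
  shows "jump FR FL (\<lambda>w. \<Sum>i\<in>I. \<phi> i w) (\<Sum>i\<in>I. n i)"
  using assms by (induction I rule: infinite_finite_induct) (simp_all add: jump_const jump_add)

lemma jump_cong:
  assumes "jump FR FL \<phi> n" "eventually (\<lambda>w. \<phi> w = \<psi> w) FR" "eventually (\<lambda>w. \<phi> w = \<psi> w) FL"
  shows "jump FR FL \<psi> n"
proof -
  obtain l where "(\<phi> \<longlongrightarrow> l + n) FR" "(\<phi> \<longlongrightarrow> l) FL"
    using assms(1) unfolding jump_def by blast
  then have "(\<psi> \<longlongrightarrow> l + n) FR" "(\<psi> \<longlongrightarrow> l) FL"
    using assms(2,3) by (auto intro: Lim_transform_eventually)
  then show ?thesis
    unfolding jump_def by blast
qed

lemma jump_isCont:
  assumes "isCont \<phi> x" "FR \<le> nhds x" "FL \<le> nhds x"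
  shows "jump FR FL \<phi> 0"
proof -
  have "(\<phi> \<longlongrightarrow> \<phi> x) (nhds x)"
    using assms(1) by (simp add: isCont_def tendsto_at_iff_tendsto_nhds)
  then have "(\<phi> \<longlongrightarrow> \<phi> x) FR" "(\<phi> \<longlongrightarrow> \<phi> x) FL"
    using assms(2,3) tendsto_mono by blast+
  then show ?thesis
    unfolding jump_def by auto
qed

text \<open>An inner point of one lift of \<open>e\<close> with an approach from each side. The jump
  is -1 because the right-hand side is the inside of a clockwise Jordan curve.\<close>

locale edge_germ = cyl_net N for N :: "('v, 'e) network" +
  fixes e :: 'e and ct :: "real \<Rightarrow> complex" and t :: real and FR FL :: "complex filter"
  assumes e: "e \<in> arcs (graph N)" and ct: "is_copy ct (curve N e)" and t: "0 < t" "t < 1"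
    and FR: "FR \<noteq> bot" "FR \<le> nhds (ct t)" "eventually (\<lambda>w. exp w \<in> rface e) FR"
    and FL: "FL \<noteq> bot" "FL \<le> nhds (ct t)" "eventually (\<lambda>w. exp w \<in> lface e) FL"
    and jump_edge: "jump FR FL (winding_number ct) (-1)"

context cyl_net begin

lemma side_faces_off_drawing:
  assumes "e \<in> E" "z \<in> rface e \<or> z \<in> lface e"
  shows "z \<notin> drawing N"
proof -
  have "rface e \<in> faces N" "lface e \<in> faces N"
    using sides_props[OF assms(1)] by auto
  then show ?thesis
    using faces_subset assms(2) by blast
qed

text \<open>The piece of the lifted edge is completed on the cover, and \<open>exp\<close> carries
  the Jordan curve down to a completion for the edge itself with the same winding numbers. So the
  sides upstairs lie over the faces found downstairs.\<close>

lemma edge_germ_exists: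
  assumes e: "e \<in> E"
  obtains ct t FR FL where "edge_germ N e ct t FR FL"
proof -
  have "path_image (curve N e) \<subseteq> cylinder"
    using drawing_cylinder e by (auto simp: drawing_def)
  then have "0 \<notin> path_image (curve N e)"
    by (auto simp: cylinder_def)
  then obtain ct where ct: "is_copy ct (curve N e)"
    by (rule copy_exists[OF curve_path[OF e]])
  have exp_ct: "exp (ct s) = curve N e s" if "s \<in> {0..1}" for s
    using ct that by (simp add: is_copy_def)
  have simple: "simple_path ct"
    using ct curve_simple[OF e] unfolding simple_path_def loop_free_def is_copy_def by metis
  define t where "t = (1 / 2 :: real)"
  have t: "0 < t" "t < 1"
    by (auto simp: t_def)
  \<comment> \<open>Radius 1 keeps the Jordan curve within the disc of radius pi, on which
    \<open>exp\<close> is injective.\<close>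
  obtain a b g where J: "right_cap ct a b g" "a < t" "t < b"
    "path_image (subpath a b ct +++ g) \<subseteq> cball (ct t) 1"
    by (rule crosscut[OF simple t zero_less_one])
  let ?J = "subpath a b ct +++ g" and ?J' = "subpath a b (curve N e) +++ (exp \<circ> g)"
  let ?B = "ball (ct t) pi"
  have JB: "path_image ?J \<subseteq> ?B"
    using J(4) pi_gt3 by force
  have inj: "inj_on exp ?B"
  proof (rule inj_onI)
    fix u w assume "u \<in> ?B" "w \<in> ?B" "exp u = exp w"
    then show "u = w"
      using exp_complex_eqI[of u w] abs_Im_le_cmod[of "u - w"] dist_triangle_less_add[of u "ct t" pi w pi]
      by (simp add: dist_norm norm_minus_commute)
  qed
  have ab: "0 \<le> a" "b \<le> 1" "a < b"
    using J by (auto simp: right_cap_def)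
  have J'_eq: "?J' s = (exp \<circ> ?J) s" if "s \<in> {0..1}" for s
  proof (cases "s \<le> 1 / 2")
    case True
    define y where "y = (b - a) * (2 * s)"
    have "y \<le> (b - a) * 1"
      unfolding y_def using True ab by (intro mult_left_mono) auto
    moreover have "0 \<le> y"
      unfolding y_def using that ab by simp
    ultimately have "y + a \<in> {0..1}"
      using ab by simp
    then have "(b - a) * (2 * s) + a \<in> {0..1}"
      by (simp only: y_def)
    then show ?thesis
      using True exp_ct by (simp add: joinpaths_def subpath_def)
  qed (simp add: joinpaths_def)
  have loop: "pathfinish ?J = pathstart ?J" "path ?J"
    using J right_cap_loop[OF J(1)] right_cap_paths[OF J(1)] by auto
  have simpleJ': "simple_path ?J'"
  proof -
    have "simple_path (exp \<circ> ?J)"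
      using J(1) JB inj by (intro simple_path_continuous_image continuous_intros)
        (auto simp: right_cap_def intro: inj_on_subset)
    then show ?thesis
      using simple_path_cong[of ?J' "exp \<circ> ?J"] J'_eq by blast
  qed
  have W: "winding_number ?J' (exp w) = winding_number ?J w" "exp w \<notin> path_image ?J'"
    if "w \<in> ?B" "w \<notin> path_image ?J" for w
  proof -
    have "winding_number ?J' (exp w) = winding_number (exp \<circ> ?J) (exp w)"
      using J'_eq by (intro winding_number_cong) auto
    then show "winding_number ?J' (exp w) = winding_number ?J w"
      using winding_number_exp_local[OF loop(2,1) JB order.refl that] by simp
    have "path_image ?J' = exp ` path_image ?J"
      using J'_eq by (force simp: path_image_def)
    then show "exp w \<notin> path_image ?J'"
      using inj_on_image_mem_iff[OF inj that(1) JB] that(2) by simp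
  qed
  have ends: "pathstart (exp \<circ> g) = curve N e b" "pathfinish (exp \<circ> g) = curve N e a"
    using J(1) exp_ct ab by (auto simp: right_cap_def pathstart_compose pathfinish_compose)
  then have loop': "pathfinish ?J' = pathstart ?J'"
    by simp
  have cap': "right_cap (curve N e) a b (exp \<circ> g)"
  proof -
    \<comment> \<open>One point suffices to see the orientation: the winding number is the same, 1
      or -1, at all points inside a Jordan curve.\<close>
    obtain w where w: "w \<in> ?B" "w \<in> inside (path_image ?J)"
      using right_cap_closure[OF J(1-3) pi_gt_zero] by metis
    then have "w \<notin> path_image ?J"
      using inside_no_overlap[of "path_image ?J"] by blast
    then have w': "winding_number ?J' (exp w) = -1" "exp w \<notin> path_image ?J'"
      using W[OF w(1)] right_cap_inside_iff[OF J(1)] w by auto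
    then have "exp w \<in> inside (path_image ?J')"
      using inside_Un_outside[of "path_image ?J'"] winding_number_zero_in_outside[OF _ loop']
        simpleJ' by (fastforce simp: simple_path_imp_path)
    then have "\<forall>z\<in>inside (path_image ?J'). winding_number ?J' z = -1"
      using simple_closed_path_winding_number_inside[OF simpleJ'] w' by (metis one_neq_neg_one)
    then show ?thesis
      using ab simpleJ' ends by (simp add: right_cap_def)
  qed
  obtain d where d: "0 < d"
    "inside (path_image ?J') \<inter> ball (curve N e t) d \<subseteq> rface e"
    "outside (path_image ?J') \<inter> ball (curve N e t) d \<subseteq> lface e"
    by (rule cap_faces[OF e cap' J(2,3)])
  \<comment> \<open>Both sides of the Jordan curve accumulate at \<open>ct t\<close>, so these
    filters are nontrivial and limits along them are unique.\<close>
  define FR where "FR = at (ct t) within inside (path_image ?J)"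
  define FL where "FL = at (ct t) within outside (path_image ?J)"
  have "isCont exp (ct t)"
    by simp
  then have "eventually (\<lambda>w. exp w \<in> ball (curve N e t) d) (nhds (ct t))"
    unfolding continuous_at_eps_delta eventually_nhds_metric
    using d(1) exp_ct[of t] t by (auto simp: dist_commute dist_norm norm_minus_commute)
  moreover have "eventually (\<lambda>w. w \<in> ?B) (nhds (ct t))"
    by (intro eventually_nhds_in_open) auto
  ultimately have ev: "eventually (\<lambda>w. exp w \<in> ball (curve N e t) d \<and> w \<in> ?B) (nhds (ct t))"
    by (rule eventually_conj)
  have le: "FR \<le> nhds (ct t)" "FL \<le> nhds (ct t)"
    unfolding FR_def FL_def at_within_def by auto
  have inFR: "eventually (\<lambda>w. w \<in> inside (path_image ?J)) FR"
    unfolding FR_def by (simp add: eventually_at_filter)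
  have inFL: "eventually (\<lambda>w. w \<in> outside (path_image ?J)) FL"
    unfolding FL_def by (simp add: eventually_at_filter)
  have evR: "eventually (\<lambda>w. exp w \<in> rface e \<and> winding_number ?J w = -1 \<and> w \<notin> path_image ?J) FR"
    using inFR filter_leD[OF le(1) ev]
  proof eventually_elim
    case (elim w)
    then have "w \<notin> path_image ?J"
      using inside_no_overlap[of "path_image ?J"] by blast
    moreover from this have "winding_number ?J w = -1"
      using right_cap_inside_iff[OF J(1)] elim by simp
    ultimately show ?case
      using W[of w] right_cap_inside_iff(1)[OF cap', of "exp w"] elim d(2) by auto
  qed
  have evL: "eventually (\<lambda>w. exp w \<in> lface e \<and> winding_number ?J w = 0 \<and> w \<notin> path_image ?J) FL"
    using inFL filter_leD[OF le(2) ev]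
  proof eventually_elim
    case (elim w)
    then have "w \<notin> path_image ?J"
      using outside_no_overlap[of "path_image ?J"] by blast
    moreover from this have "winding_number ?J w = 0"
      using right_cap_inside_iff[OF J(1)] elim by simp
    ultimately show ?case
      using W[of w] right_cap_inside_iff(2)[OF cap', of "exp w"] elim d(3) by auto
  qed
  have "ct t \<in> path_image ?J"
    using J ab by (auto simp: right_cap_paths(4)[OF J(1)] path_image_subpath)
  then have "ct t \<notin> inside (path_image ?J)" "ct t \<notin> outside (path_image ?J)"
    using inside_no_overlap[of "path_image ?J"] outside_no_overlap[of "path_image ?J"] by blast+
  moreover have "ct t \<in> closure (inside (path_image ?J))" "ct t \<in> closure (outside (path_image ?J))"
  proof -
    have "simple_path ?J"
      using J(1) by (simp add: right_cap_def)
    then have "frontier (inside (path_image ?J)) = path_image ?J" "frontier (outside (path_image ?J)) = path_image ?J"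
      using Jordan_inside_outside[of ?J] loop(1) by blast+
    with \<open>ct t \<in> path_image ?J\<close> show "ct t \<in> closure (inside (path_image ?J))"
      "ct t \<in> closure (outside (path_image ?J))"
      unfolding frontier_def by blast+
  qed
  ultimately have bot: "FR \<noteq> bot" "FL \<noteq> bot"
    unfolding FR_def FL_def by (simp_all add: trivial_limit_within closure_def)
  obtain h where h: "isCont h (ct t)"
    "\<And>z. z \<notin> path_image ct \<Longrightarrow> z \<notin> path_image g \<Longrightarrow> winding_number ct z = winding_number ?J z + h z"
    using winding_number_cap[OF simple_path_imp_path[OF simple] J(1-3)
        simple_path_interior_point[OF simple ab(1) J(2,3) ab(2)] right_cap_not_in_completion[OF J(1-3)]]
    by metis
  have off: "w \<notin> path_image ct" if "exp w \<in> rface e \<or> exp w \<in> lface e" for w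
  proof
    assume "w \<in> path_image ct"
    then have "exp w \<in> path_image (curve N e)"
      using exp_ct by (auto simp: path_image_def)
    then have "exp w \<in> drawing N"
      using e by (auto simp: drawing_def)
    with side_faces_off_drawing[OF e that] show False
      by contradiction
  qed
  have evJ: "eventually (\<lambda>w. -1 = winding_number ?J w) FR" "eventually (\<lambda>w. 0 = winding_number ?J w) FL"
    using evR evL by (auto elim: eventually_mono)
  have "jump FR FL (winding_number ?J) (-1)"
    unfolding jump_def
    using Lim_transform_eventually[OF tendsto_const evJ(1)] Lim_transform_eventually[OF tendsto_const evJ(2)]
    by (intro exI[of _ 0]) simp
  then have "jump FR FL (\<lambda>w. winding_number ?J w + h w) (-1 + 0)"
    by (rule jump_add) (rule jump_isCont[OF h(1) le])
  moreover have eq: "winding_number ?J w + h w = winding_number ct w"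
    if "exp w \<in> rface e \<or> exp w \<in> lface e" "w \<notin> path_image ?J" for w
    using h(2)[OF off[OF that(1)]] that(2) right_cap_paths(4)[OF J(1)] by simp
  have "eventually (\<lambda>w. winding_number ?J w + h w = winding_number ct w) FR"
    using evR by eventually_elim (rule eq; simp)
  moreover have "eventually (\<lambda>w. winding_number ?J w + h w = winding_number ct w) FL"
    using evL by eventually_elim (rule eq; simp)
  ultimately have "jump FR FL (winding_number ct) (-1 + 0)"
    by (rule jump_cong)
  then have "jump FR FL (winding_number ct) (-1)"
    by simp
  moreover have "eventually (\<lambda>w. exp w \<in> rface e) FR" "eventually (\<lambda>w. exp w \<in> lface e) FL"
    using evR evL by (auto elim: eventually_mono)
  ultimately have "edge_germ N e ct t FR FL"
    using e ct t bot le by unfold_locales auto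
  then show thesis
    by (rule that)
qed

end

section \<open>Curves of step sequences and their copies\<close>

context cyl_net begin

lemma step_props:
  assumes "fst s \<in> E"
  shows "path (step_curve N s)" "path_image (step_curve N s) \<subseteq> drawing N"
    "pathstart (step_curve N s) = pos N (step_start N s)"
    "pathfinish (step_curve N s) = pos N (step_finish N s)"
    "step_start N s \<in> V" "step_finish N s \<in> V"
  using assms curve_path curve_start curve_finish arc_verts
  by (cases s; auto simp: drawing_def)+

lemma steps_props:
  assumes "steps_connect N a ss b" "a \<in> V"
  shows "path (steps_curve N a ss)" "path_image (steps_curve N a ss) \<subseteq> drawing N"
    "pathstart (steps_curve N a ss) = pos N a" "pathfinish (steps_curve N a ss) = pos N b"
    "b \<in> V"
  using assms
proof (induction ss arbitrary: a)
  case Nil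
  {
    case 1 show ?case by (simp only: steps_curve.simps path_linepath)
  next
    case 2 then show ?case by (simp add: drawing_def)
  next
    case 3 show ?case by (simp only: steps_curve.simps pathstart_linepath)
  next
    case 4 then show ?case by (simp only: steps_connect.simps steps_curve.simps pathfinish_linepath)
  next
    case 5 then show ?case by simp
  }
next
  case (Cons s ss)
  {
    case 1
    then show ?case
      using Cons.IH(1)[of "step_finish N s"] Cons.IH(3)[of "step_finish N s"] step_props[of s] by simp
  next
    case 2
    then show ?case
      using Cons.IH(2)[of "step_finish N s"] Cons.IH(3)[of "step_finish N s"] step_props[of s]
      by (simp add: path_image_join)
  next
    case 3
    then show ?case
      using step_props[of s] by simp
  next
    case 4
    then show ?case
      using Cons.IH(4)[of "step_finish N s"] step_props[of s] by simp
  next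
    case 5
    then show ?case
      using Cons.IH(5)[of "step_finish N s"] step_props[of s] by simp
  }
qed

lemma copy_join:
  assumes "is_copy q (c +++ c')" "pathfinish c = pathstart c'"
  obtains q1 q2 where "is_copy q1 c" "is_copy q2 c'" "q = q1 +++ q2" "pathfinish q1 = pathstart q2"
proof -
  define q1 where "q1 = (\<lambda>s. q (s / 2))"
  define q2 where "q2 = (\<lambda>s. q ((s + 1) / 2))"
  have q: "continuous_on {0..1} q" "\<And>s. s \<in> {0..1} \<Longrightarrow> exp (q s) = (c +++ c') s"
    using assms(1) by (auto simp: is_copy_def path_def)
  have "path q1" "path q2"
    unfolding path_def q1_def q2_def
    by (intro continuous_on_compose2[OF q(1)] continuous_intros; auto)+
  moreover have "exp (q1 s) = c s" if "s \<in> {0..1}" for s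
    using q(2)[of "s / 2"] that by (simp add: q1_def joinpaths_def)
  moreover have "exp (q2 s) = c' s" if "s \<in> {0..1}" for s
  \<comment> \<open>The join takes its value at 1/2 from the first path; there the matching end
    points are needed.\<close>
  proof (cases "s = 0")
    case True
    then show ?thesis
      using q(2)[of "1 / 2"] assms(2) by (simp add: q2_def joinpaths_def pathfinish_def pathstart_def)
  next
    case False
    have "2 * ((s + 1) / 2) - 1 = s"
      by (simp add: field_simps)
    then show ?thesis
      using q(2)[of "(s + 1) / 2"] that False by (simp add: q2_def joinpaths_def)
  qed
  moreover have "q = q1 +++ q2"
    by (rule ext) (simp add: joinpaths_def q1_def q2_def)
  moreover have "pathfinish q1 = pathstart q2"
    by (simp add: q1_def q2_def pathfinish_def pathstart_def)
  ultimately show thesis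
    by (intro that[of q1 q2]) (auto simp: is_copy_def)
qed

lemma copy_reversepath: "is_copy q c \<Longrightarrow> is_copy (reversepath q) (reversepath c)"
  by (auto simp: is_copy_def reversepath_def intro: path_reversepath[unfolded reversepath_def, THEN iffD2])

lemma copy_off:
  assumes "is_copy q c" "path_image c \<subseteq> drawing N" "exp w \<notin> drawing N"
  shows "w \<notin> path_image q"
  using assms by (auto simp: is_copy_def path_image_def)

end

section \<open>Jumps of copies, summed over translates\<close>

fun step_count :: "'e \<Rightarrow> 'e step \<Rightarrow> int" where
  "step_count e (e', fwd) = (if e' = e then if fwd then 1 else -1 else 0)"

definition steps_count :: "'e \<Rightarrow> 'e step list \<Rightarrow> int" where
  "steps_count e ss = sum_list (map (step_count e) ss)"

context edge_germ begin

lemma exp_ct: "s \<in> {0..1} \<Longrightarrow> exp (ct s) = curve N e s"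
  using ct by (simp add: is_copy_def)

lemma ev_off_drawing:
  "eventually (\<lambda>w. exp w \<notin> drawing N) FR" "eventually (\<lambda>w. exp w \<notin> drawing N) FL"
  using FR(3) FL(3) side_faces_off_drawing[OF e] by (auto elim: eventually_mono)

lemma jump_0:
  assumes "path \<gamma>" "shift k (ct t) \<notin> path_image \<gamma>"
  shows "jump FR FL (\<lambda>w. winding_number \<gamma> (shift k w)) 0"
proof -
  have "isCont (\<lambda>w. winding_number \<gamma> (shift k w)) (ct t)"
    by (rule isCont_o2[where f = "shift k" and g = "winding_number \<gamma>"])
      (use continuous_at_winding_number[OF assms] in \<open>auto intro!: continuous_intros\<close>)
  then show ?thesis
    using FR(2) FL(2) by (rule jump_isCont)
qed

text \<open>Evaluating at a translate of the point amounts to translating the copy. Since the edge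
  does not return to its inner points, exactly one translate of the copy passes through
  \<open>ct t\<close>; every window containing its index sees this one jump.\<close>

lemma edge_copy_jump:
  assumes q: "is_copy q (curve N e)"
  obtains K0 where "\<And>K. K0 \<le> K \<Longrightarrow>
    jump FR FL (\<lambda>w. \<Sum>k\<in>{-K..K}. winding_number q (shift k w)) (-1)"
proof -
  obtain j where j: "\<And>s. s \<in> {0..1} \<Longrightarrow> q s = shift j (ct s)"
    using copies_differ_by_shift[OF q ct] by metis
  have W: "winding_number q (shift k w) = winding_number ct (shift (k - j) w)" for k w
  proof -
    have "winding_number q (shift k w) = winding_number (\<lambda>s. shift j (ct s)) (shift k w)"
      by (rule winding_number_cong) (use j in auto)
    then show ?thesis
      by (simp only: winding_number_shift)
  qed
  have each: "jump FR FL (\<lambda>w. winding_number q (shift k w)) (if k = j then -1 else 0)" for k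
  proof (cases "k = j")
    case True
    then show ?thesis
      using jump_edge by (simp add: W)
  next
    case False
    have "shift (k - j) (ct t) \<notin> path_image ct"
    proof
      assume "shift (k - j) (ct t) \<in> path_image ct"
      then obtain s where s: "s \<in> {0..1}" "shift (k - j) (ct t) = ct s"
        by (auto simp: path_image_def)
      then have "curve N e t = curve N e s"
        using exp_ct[of s] exp_ct[of t] t exp_shift[of "ct t" "k - j"] by auto
      then have "t = s"
        using curve_simple[OF e] s t unfolding simple_path_def loop_free_def by force
      with s False show False
        by simp
    qed
    moreover have "path ct"
      using ct by (simp add: is_copy_def)
    ultimately have "jump FR FL (\<lambda>w. winding_number ct (shift (k - j) w)) 0"
      by (intro jump_0)
    with False show ?thesis
      by (simp add: W)
  qed
  show thesis
  proof (rule that)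
    fix K assume "\<bar>j\<bar> \<le> K"
    then have "j \<in> {-K..K}"
      by auto
    then show "jump FR FL (\<lambda>w. \<Sum>k\<in>{-K..K}. winding_number q (shift k w)) (-1)"
      using jump_sum[of "{-K..K}" FR FL "\<lambda>k w. winding_number q (shift k w)" "\<lambda>k. if k = j then -1 else 0"] each
      by simp
  qed
qed

lemma step_jump:
  assumes s: "fst s \<in> E" and q: "is_copy q (step_curve N s)"
  obtains K0 where "\<And>K. K0 \<le> K \<Longrightarrow>
    jump FR FL (\<lambda>w. \<Sum>k\<in>{-K..K}. winding_number q (shift k w)) (- of_int (step_count e s))"
proof (cases s)
  case (Pair e' fwd)
  have pq: "path q"
    using q by (simp add: is_copy_def)
  consider "e' \<noteq> e" | "e' = e" "fwd" | "e' = e" "\<not> fwd"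
    by blast
  then show thesis
  proof cases
    case 1
    have "path_image (step_curve N s) = path_image (curve N e')"
      by (simp add: Pair)
    moreover have "curve N e t \<notin> path_image (curve N e')"
      using interior_not_other[OF e t _ 1] s Pair by simp
    moreover have "exp (shift k (ct t)) = curve N e t" for k
      using exp_ct[of t] t by (simp only: exp_shift) simp
    ultimately have "shift k (ct t) \<notin> path_image q" for k
      using q unfolding is_copy_def path_image_def by (metis (no_types, lifting) imageE imageI)
    then have "jump FR FL (\<lambda>w. \<Sum>k\<in>{-K..K}. winding_number q (shift k w)) (\<Sum>k\<in>{-K..K}. 0)" for K
      by (intro jump_sum jump_0[OF pq])
    then show ?thesis
      using 1 Pair by (intro that[of 0]) simp
  next
    case 2
    then have "is_copy q (curve N e)"
      using q Pair by simp
    then show ?thesis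
      using edge_copy_jump that 2 Pair by auto
  next
    case 3
    then have "is_copy (reversepath q) (curve N e)"
      using copy_reversepath[OF q] Pair by simp
    then obtain K0 where K0: "\<And>K. K0 \<le> K \<Longrightarrow>
      jump FR FL (\<lambda>w. \<Sum>k\<in>{-K..K}. winding_number (reversepath q) (shift k w)) (-1)"
      using edge_copy_jump by metis
    show ?thesis
    proof (rule that)
      fix K assume "K0 \<le> K"
      have off: "(\<Sum>k\<in>{-K..K}. winding_number (reversepath q) (shift k w)) =
          - (\<Sum>k\<in>{-K..K}. winding_number q (shift k w))" if "exp w \<notin> drawing N" for w
      proof -
        have "exp (shift k w) \<notin> drawing N" for k
          using that by (simp only: exp_shift) simp
        then have "shift k w \<notin> path_image q" for k
          using copy_off[OF q step_props(2)[OF s]] by blast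
        then show ?thesis
          using winding_number_reversepath[OF pq] by (simp add: sum_negf)
      qed
      have "jump FR FL (\<lambda>w. - (\<Sum>k\<in>{-K..K}. winding_number (reversepath q) (shift k w))) (- (-1))"
        by (rule jump_uminus[OF K0[OF \<open>K0 \<le> K\<close>]])
      then have "jump FR FL (\<lambda>w. \<Sum>k\<in>{-K..K}. winding_number q (shift k w)) (- (-1))"
        by (rule jump_cong) (use ev_off_drawing off in \<open>auto elim!: eventually_mono\<close>)
      then show "jump FR FL (\<lambda>w. \<Sum>k\<in>{-K..K}. winding_number q (shift k w)) (- of_int (step_count e s))"
        using 3 Pair by simp
    qed
  qed
qed

text \<open>The jump adds up along the sequence, with the minus sign coming from the jump -1 of a
  forward edge. Winding numbers add over joins only off the curves, which suffices because both
  filters eventually avoid the lifts of the drawing.\<close>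

lemma steps_jump:
  assumes "steps_connect N a ss b" "a \<in> V" "is_copy q (steps_curve N a ss)"
  shows "\<exists>K0. \<forall>K\<ge>K0. jump FR FL (\<lambda>w. \<Sum>k\<in>{-K..K}. winding_number q (shift k w))
    (- of_int (steps_count e ss))"
  using assms
proof (induction ss arbitrary: a q)
  case Nil
  have pq: "path q"
    using Nil by (simp add: is_copy_def)
  have "exp (shift k (ct t)) = curve N e t" for k
    using exp_ct[of t] t by (simp only: exp_shift) simp
  moreover have "exp w = pos N a" if "w \<in> path_image q" for w
    using Nil(3) that by (auto simp: is_copy_def path_image_def linepath_def algebra_simps scaleR_conv_of_real)
  moreover have "curve N e t \<noteq> pos N a"
    using interior_not_vertex[OF e t Nil(2)] .
  ultimately have "shift k (ct t) \<notin> path_image q" for k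
    by metis
  then have "jump FR FL (\<lambda>w. \<Sum>k\<in>{-K..K}. winding_number q (shift k w)) (\<Sum>k\<in>{-K..K}. 0)" for K
    by (intro jump_sum jump_0[OF pq])
  then show ?case
    by (simp add: steps_count_def)
next
  case (Cons s ss)
  let ?a = "step_finish N s"
  have s: "fst s \<in> E" and conn: "steps_connect N ?a ss b"
    using Cons.prems by auto
  note sp = step_props[OF s]
  note ssp = steps_props[OF conn sp(6)]
  have join: "pathfinish (step_curve N s) = pathstart (steps_curve N ?a ss)"
    using sp ssp by simp
  obtain q1 q2 where q: "is_copy q1 (step_curve N s)" "is_copy q2 (steps_curve N ?a ss)"
    "q = q1 +++ q2" "pathfinish q1 = pathstart q2"
    by (rule copy_join[OF _ join]) (use Cons.prems(3) in simp)
  obtain K1 where K1: "\<And>K. K1 \<le> K \<Longrightarrow>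
    jump FR FL (\<lambda>w. \<Sum>k\<in>{-K..K}. winding_number q1 (shift k w)) (- of_int (step_count e s))"
    using step_jump[OF s q(1)] by metis
  obtain K2 where K2: "\<And>K. K2 \<le> K \<Longrightarrow>
    jump FR FL (\<lambda>w. \<Sum>k\<in>{-K..K}. winding_number q2 (shift k w)) (- of_int (steps_count e ss))"
    using Cons.IH[OF conn sp(6) q(2)] by metis
  show ?case
  proof (intro exI[of _ "max K1 K2"] allI impI)
    fix K assume K: "max K1 K2 \<le> K"
    have off: "(\<Sum>k\<in>{-K..K}. winding_number q1 (shift k w)) + (\<Sum>k\<in>{-K..K}. winding_number q2 (shift k w)) =
        (\<Sum>k\<in>{-K..K}. winding_number q (shift k w))" if "exp w \<notin> drawing N" for w
    proof -
      have "exp (shift k w) \<notin> drawing N" for k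
        using that by (simp only: exp_shift) simp
      then have "shift k w \<notin> path_image q1" "shift k w \<notin> path_image q2" for k
        using copy_off[OF q(1) sp(2)] copy_off[OF q(2) ssp(2)] by blast+
      moreover have "path q1" "path q2"
        using q by (auto simp: is_copy_def)
      ultimately show ?thesis
        using q(4) by (simp add: q(3) winding_number_join sum.distrib)
    qed
    have "jump FR FL (\<lambda>w. (\<Sum>k\<in>{-K..K}. winding_number q1 (shift k w)) +
        (\<Sum>k\<in>{-K..K}. winding_number q2 (shift k w)))
      (- of_int (step_count e s) + - of_int (steps_count e ss))"
      using K by (intro jump_add K1 K2) auto
    then have "jump FR FL (\<lambda>w. \<Sum>k\<in>{-K..K}. winding_number q (shift k w))
      (- of_int (step_count e s) + - of_int (steps_count e ss))"
      by (rule jump_cong) (use ev_off_drawing off in \<open>auto elim!: eventually_mono\<close>)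
    then show "jump FR FL (\<lambda>w. \<Sum>k\<in>{-K..K}. winding_number q (shift k w))
      (- of_int (steps_count e (s # ss)))"
      by (simp add: steps_count_def algebra_simps)
  qed
qed

end

section \<open>Curves crossing the strip\<close>

definition strip :: "complex set" where
  "strip = {z. 0 \<le> Re z \<and> Re z \<le> 1}"

lemma convex_strip: "convex strip"
proof -
  have *: "strip = {z. Re z \<ge> 0} \<inter> {z. Re z \<le> 1}"
    by (auto simp: strip_def)
  show ?thesis
    unfolding * by (intro convex_Int convex_halfspace_Re_ge convex_halfspace_Re_le)
qed

text \<open>With \<open>s\<close> equal to 1 or -1 this treats both boundary lines at once. The
  point \<open>z\<close> may be level with the vertex \<open>a\<close>, as happens when
  \<open>z\<close> lies on the same boundary line as an end of a crossing curve.\<close>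

lemma winding_number_triangle_zero:
  assumes "s * Re z \<le> s * Re a" "s * Re z < s * Re b" "s * Re z < s * Re c" "z \<noteq> a"
  shows "z \<notin> closed_segment a b" "z \<notin> closed_segment b c" "z \<notin> closed_segment c a"
    "winding_number (linepath a b) z + winding_number (linepath b c) z + winding_number (linepath c a) z = 0"
proof -
  let ?X = "convex hull {a, b, c}"
  have z: "z \<notin> ?X"
  proof
    assume "z \<in> ?X"
    then obtain u v w where uvw: "0 \<le> u" "0 \<le> v" "0 \<le> w" "u + v + w = 1"
      "z = u *\<^sub>R a + v *\<^sub>R b + w *\<^sub>R c"
      unfolding convex_hull_3 by blast
    \<comment> \<open>A convex combination of numbers that are at least \<open>Z\<close> equals
      \<open>Z\<close> only if those greater than \<open>Z\<close> get weight 0.\<close>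
    have key: "v = 0 \<and> w = 0" if "Z = u * A + v * B + w * C" "Z \<le> A" "Z < B" "Z < C" for A B C Z :: real
    proof -
      have "u * (A - Z) + v * (B - Z) + w * (C - Z) = (u * A + v * B + w * C) - (u + v + w) * Z"
        by (simp add: algebra_simps)
      also have "\<dots> = 0"
        using that(1) uvw(4) by simp
      finally have "u * (A - Z) + v * (B - Z) + w * (C - Z) = 0" .
      moreover have "0 \<le> u * (A - Z)" "0 \<le> v * (B - Z)" "0 \<le> w * (C - Z)"
        using uvw(1-3) that by simp_all
      ultimately have "v * (B - Z) = 0" "w * (C - Z) = 0"
        by linarith+
      with that show ?thesis
        by auto
    qed
    have "s * Re z = u * (s * Re a) + v * (s * Re b) + w * (s * Re c)"
      by (simp add: uvw(5) algebra_simps)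
    then have "v = 0 \<and> w = 0"
      using key assms(1-3) by blast
    with uvw assms show False by simp
  qed
  have sub: "closed_segment a b \<subseteq> ?X" "closed_segment b c \<subseteq> ?X" "closed_segment c a \<subseteq> ?X"
    by (rule closed_segment_subset_convex_hull; rule hull_inc; simp)+
  then show z': "z \<notin> closed_segment a b" "z \<notin> closed_segment b c" "z \<notin> closed_segment c a"
    using z by blast+
  have "winding_number (linepath a b +++ linepath b c +++ linepath c a) z = 0"
    by (rule winding_number_zero_outside[of _ ?X]) (use z sub in \<open>auto simp: path_image_join\<close>)
  then show "winding_number (linepath a b) z + winding_number (linepath b c) z + winding_number (linepath c a) z = 0"
    using z' by (simp add: winding_number_join not_in_path_image_join add.assoc)
qed

lemma winding_number_linepath_reverse:
  assumes "z \<notin> closed_segment a b"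
  shows "winding_number (linepath b a) z = - winding_number (linepath a b) z"
  using winding_number_reversepath[of "linepath a b" z] assms by simp

text \<open>Checks on the pieces of a join that the straight-line homotopy of
  \<open>winding_number_loops_linear_eq\<close> misses \<open>z\<close>.\<close>

lemma joinpaths_avoid_segments:
  assumes "\<And>t. t \<in> {0..1} \<Longrightarrow> z \<notin> closed_segment (p t) (p' t)"
    "\<And>t. t \<in> {0..1} \<Longrightarrow> z \<notin> closed_segment (r t) (r' t)" "t \<in> {0..1}"
  shows "z \<notin> closed_segment ((p +++ r) t) ((p' +++ r') t)"
  using assms(1)[of "2 * t"] assms(2)[of "2 * t - 1"] assms(3) by (auto simp: joinpaths_def)

lemma closed_segment_Re_eq:
  assumes "z \<in> closed_segment a b" "Re a = Re b" shows "Re z = Re a"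
proof -
  obtain u where "z = (1 - u) *\<^sub>R a + u *\<^sub>R b"
    using assms(1) unfolding closed_segment_def by blast
  then have "Re z = (1 - u) * Re a + u * Re b"
    by simp
  then show ?thesis
    using assms(2) by (simp add: algebra_simps)
qed

lemma closed_segment_Im_bounds:
  assumes "z \<in> closed_segment a b"
  shows "min (Im a) (Im b) \<le> Im z" "Im z \<le> max (Im a) (Im b)"
proof -
  have "closed_segment a b \<subseteq> {w. Im w \<ge> min (Im a) (Im b)}"
    by (rule closed_segment_subset[OF _ _ convex_halfspace_Im_ge]) auto
  moreover have "closed_segment a b \<subseteq> {w. Im w \<le> max (Im a) (Im b)}"
    by (rule closed_segment_subset[OF _ _ convex_halfspace_Im_le]) auto
  ultimately show "min (Im a) (Im b) \<le> Im z" "Im z \<le> max (Im a) (Im b)"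
    using assms by blast+
qed

text \<open>For a crossing curve, 1 means from left to right and -1 from right to left. Its
  right-hand side lies in the direction \<open>- heading q\<close> of the imaginary axis, so a
  factor \<open>heading q\<close> merges the two mirrored cases.\<close>

definition heading :: "(real \<Rightarrow> complex) \<Rightarrow> real" where
  "heading q = (if Re (pathstart q) = 0 then 1 else -1)"

lemma right_mult_heading:
  "right_mult q z = (THE n. \<forall>\<^sub>F d in at_top. of_int n = - winding_number (closing_loop q (- heading q * d)) z)"
  by (simp add: right_mult_def heading_def)

lemma left_mult_heading:
  "left_mult q z = (THE n. \<forall>\<^sub>F d in at_top. of_int n = winding_number (closing_loop q (heading q * d)) z)"
  by (simp add: left_mult_def heading_def)

locale crossing =
  fixes q :: "real \<Rightarrow> complex"
  assumes path: "path q" and in_strip: "path_image q \<subseteq> strip"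
    and ends: "Re (pathstart q) = 0 \<and> Re (pathfinish q) = 1 \<or> Re (pathstart q) = 1 \<and> Re (pathfinish q) = 0"
begin

text \<open>\<open>C0\<close> and \<open>C1\<close> are the corners of the closing loop next to the
  start and the finish of \<open>q\<close>; their real part is -1 or 2, beyond the respective
  boundary line.\<close>

definition C0 :: "real \<Rightarrow> complex" where "C0 h = Complex (3 * Re (pathstart q) - 1) h"
definition C1 :: "real \<Rightarrow> complex" where "C1 h = Complex (3 * Re (pathfinish q) - 1) h"

lemma closing_loop_eq:
  "closing_loop q h = q +++ linepath (pathfinish q) (C1 h) +++ linepath (C1 h) (C0 h) +++ linepath (C0 h) (pathstart q)"
  by (simp add: closing_loop_def C0_def C1_def)

lemma path_closing: "path (closing_loop q h)"
  and closing_closed: "pathfinish (closing_loop q h) = pathstart (closing_loop q h)"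
  using path by (auto simp: closing_loop_eq)

lemma heading_cases:
  "heading q = 1 \<and> Re (pathstart q) = 0 \<and> Re (pathfinish q) = 1 \<or>
   heading q = -1 \<and> Re (pathstart q) = 1 \<and> Re (pathfinish q) = 0"
  using ends by (auto simp: heading_def)

text \<open>Apart from an end point of \<open>q\<close> these segments lie beyond the boundary
  lines. The triangle relations allow the height of a corner to be changed.\<close>

lemma off_sides:
  assumes "z \<in> strip" "z \<notin> path_image q"
  shows "z \<notin> closed_segment (pathfinish q) (C1 h)" "z \<notin> closed_segment (C0 h) (pathstart q)"
    "winding_number (linepath (pathfinish q) (C1 h)) z + winding_number (linepath (C1 h) (C1 h')) z +
     winding_number (linepath (C1 h') (pathfinish q)) z = 0"
    "winding_number (linepath (pathstart q) (C0 h)) z + winding_number (linepath (C0 h) (C0 h')) z +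
     winding_number (linepath (C0 h') (pathstart q)) z = 0"
    "z \<notin> closed_segment (C1 h) (C1 h')" "z \<notin> closed_segment (C0 h) (C0 h')"
proof -
  have ne: "z \<noteq> pathstart q" "z \<noteq> pathfinish q"
    using assms(2) by auto
  have z: "0 \<le> Re z" "Re z \<le> 1"
    using assms(1) by (auto simp: strip_def)
  have 1: "heading q * Re z \<le> heading q * Re (pathfinish q)" "heading q * Re z < heading q * Re (C1 h)" for h
    using z heading_cases by (auto simp: C1_def)
  have 0: "- heading q * Re z \<le> - heading q * Re (pathstart q)" "- heading q * Re z < - heading q * Re (C0 h)" for h
    using z heading_cases by (auto simp: C0_def)
  note T1 = winding_number_triangle_zero[OF 1(1) 1(2)[of h] 1(2)[of h'] ne(2)]
  note T0 = winding_number_triangle_zero[OF 0(1) 0(2)[of h] 0(2)[of h'] ne(1)]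
  show "z \<notin> closed_segment (pathfinish q) (C1 h)" "z \<notin> closed_segment (C0 h) (pathstart q)"
    "z \<notin> closed_segment (C1 h) (C1 h')" "z \<notin> closed_segment (C0 h) (C0 h')"
    "winding_number (linepath (pathfinish q) (C1 h)) z + winding_number (linepath (C1 h) (C1 h')) z +
     winding_number (linepath (C1 h') (pathfinish q)) z = 0"
    "winding_number (linepath (pathstart q) (C0 h)) z + winding_number (linepath (C0 h) (C0 h')) z +
     winding_number (linepath (C0 h') (pathstart q)) z = 0"
    using T0 T1 by (simp_all add: closed_segment_commute)
qed

lemma off_top:
  assumes "h \<noteq> Im z"
  shows "z \<notin> closed_segment (C1 h) (C0 h)"
  using closed_segment_Im_bounds[of z "C1 h" "C0 h"] assms by (auto simp: C0_def C1_def)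

lemma off_closing:
  assumes "z \<in> strip" "z \<notin> path_image q" "h \<noteq> Im z"
  shows "z \<notin> path_image (closing_loop q h)"
  using off_sides(1,2)[OF assms(1,2), of h] off_top[OF assms(3)] assms(2)
  by (simp add: closing_loop_eq path_image_join)

lemma winding_number_closing:
  assumes "z \<in> strip" "z \<notin> path_image q" "h \<noteq> Im z"
  shows "winding_number (closing_loop q h) z = winding_number q z + winding_number (linepath (pathfinish q) (C1 h)) z +
     winding_number (linepath (C1 h) (C0 h)) z + winding_number (linepath (C0 h) (pathstart q)) z"
  using off_sides(1,2)[OF assms(1,2), of h] off_top[OF assms(3)] assms(2) path
  by (simp add: closing_loop_eq winding_number_join not_in_path_image_join)

text \<open>In the straight-line homotopy the corners move vertically outside of the strip, and the
  segment between them stays on one side of \<open>z\<close>.\<close>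

lemma winding_number_closing_height:
  assumes z: "z \<in> strip" "z \<notin> path_image q" and h: "Im z < h \<and> Im z < h' \<or> h < Im z \<and> h' < Im z"
  shows "winding_number (closing_loop q h) z = winding_number (closing_loop q h') z"
proof (rule sym, rule winding_number_loops_linear_eq)
  have ne: "z \<noteq> pathstart q" "z \<noteq> pathfinish q"
    using z(2) by auto
  have Re: "0 \<le> Re z" "Re z \<le> 1"
    using z(1) by (auto simp: strip_def)
  \<comment> \<open>At equal parameters the two segments from \<open>p\<close> have the same real
    part, which is in the strip only for \<open>t = 0\<close>, that is, at \<open>p\<close>
    itself.\<close>
  have side: "z \<notin> closed_segment (linepath p c t) (linepath p c' t)"
    if t: "t \<in> {0..1}" and "z \<noteq> p" and p: "Re p = 1 \<and> Re c = 2 \<and> Re c' = 2 \<or> Re p = 0 \<and> Re c = -1 \<and> Re c' = -1"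
    for t p c c'
  proof
    assume seg: "z \<in> closed_segment (linepath p c t) (linepath p c' t)"
    have "Re (linepath p c t) = Re (linepath p c' t)"
      using p by (auto simp: linepath_def)
    then have eq: "Re z = Re (linepath p c t)"
      using closed_segment_Re_eq[OF seg] by simp
    have "t = 0"
      using p eq Re t by (auto simp: linepath_def algebra_simps)
    then show False
      using seg \<open>z \<noteq> p\<close> by (simp add: linepath_def)
  qed
  have side': "z \<notin> closed_segment (linepath c p t) (linepath c' p t)"
    if t: "t \<in> {0..1}" and "z \<noteq> p" and p: "Re p = 1 \<and> Re c = 2 \<and> Re c' = 2 \<or> Re p = 0 \<and> Re c = -1 \<and> Re c' = -1"
    for t p c c'
    using side[of "1 - t" p c c'] that by (simp add: linepath_def add.commute)
  have top: "z \<notin> closed_segment (linepath (C1 h) (C0 h) t) (linepath (C1 h') (C0 h') t)" for t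
  proof
    assume seg: "z \<in> closed_segment (linepath (C1 h) (C0 h) t) (linepath (C1 h') (C0 h') t)"
    have "Im (linepath (C1 h) (C0 h) t) = h" "Im (linepath (C1 h') (C0 h') t) = h'"
      by (simp_all add: linepath_def C0_def C1_def algebra_simps)
    with closed_segment_Im_bounds[OF seg] h show False
      by auto
  qed
  have q: "z \<notin> closed_segment (q t) (q t)" if "t \<in> {0..1}" for t
    using z(2) that by (auto simp: path_image_def)
  show "z \<notin> closed_segment (closing_loop q h t) (closing_loop q h' t)" if "t \<in> {0..1}" for t
    unfolding closing_loop_eq
    by (intro joinpaths_avoid_segments q side side' top that ne)
      (use heading_cases in \<open>auto simp: C0_def C1_def\<close>)
qed (use path_closing closing_closed in auto)

text \<open>The curve \<open>q\<close> cancels from the difference of the two closings. What remains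
  is the boundary of a rectangle around \<open>z\<close>; its orientation is the heading, which the
  statement absorbs.\<close>

lemma winding_number_closing_opposite:
  assumes z: "z \<in> strip" "z \<notin> path_image q" and d: "\<bar>Im z\<bar> < d"
  shows "winding_number (closing_loop q (heading q * d)) z - winding_number (closing_loop q (- heading q * d)) z = 1"
proof -
  let ?L = "\<lambda>a b. winding_number (linepath a b) z"
  let ?a1 = "Complex (-1) (- d)" and ?a2 = "Complex 2 (- d)" and ?a3 = "Complex 2 d" and ?a4 = "Complex (-1) d"
  have Re: "0 \<le> Re z" "Re z \<le> 1"
    using z(1) by (auto simp: strip_def)
  have zbox: "z \<in> box ?a1 ?a3"
    using Re d by (auto simp: in_box_complex_iff)
  have off: "z \<notin> closed_segment ?a1 ?a2" "z \<notin> closed_segment ?a2 ?a3" "z \<notin> closed_segment ?a3 ?a4" "z \<notin> closed_segment ?a4 ?a1"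
    using closed_segment_Im_bounds[of z ?a1 ?a2] closed_segment_Im_bounds[of z ?a3 ?a4]
      closed_segment_Re_eq[of z ?a2 ?a3] closed_segment_Re_eq[of z ?a4 ?a1] Re d by auto
  have "winding_number (rectpath ?a1 ?a3) z = 1"
    using zbox by (rule winding_number_rectpath)
  moreover have "winding_number (rectpath ?a1 ?a3) z = ?L ?a1 ?a2 + ?L ?a2 ?a3 + ?L ?a3 ?a4 + ?L ?a4 ?a1"
    using off by (simp add: rectpath_def Let_def winding_number_join not_in_path_image_join)
  ultimately have rect: "?L ?a1 ?a2 + ?L ?a2 ?a3 + ?L ?a3 ?a4 + ?L ?a4 ?a1 = 1"
    by simp
  have ne: "d \<noteq> Im z" "- d \<noteq> Im z"
    using d by auto
  have rev: "?L (C1 h) (pathfinish q) = - ?L (pathfinish q) (C1 h)" "?L (pathstart q) (C0 h) = - ?L (C0 h) (pathstart q)" for h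
    using winding_number_linepath_reverse[OF off_sides(1)[OF z]] winding_number_linepath_reverse[OF off_sides(2)[OF z]]
    by blast+
  have rev': "?L ?a2 ?a1 = - ?L ?a1 ?a2" "?L ?a3 ?a2 = - ?L ?a2 ?a3" "?L ?a4 ?a3 = - ?L ?a3 ?a4" "?L ?a1 ?a4 = - ?L ?a4 ?a1"
    using off by (blast intro: winding_number_linepath_reverse)+
  \<comment> \<open>By the triangle relations, the two slanted segments at an end of
    \<open>q\<close> are replaced by one vertical side of the rectangle.\<close>
  have lin: "A - B = - X" if "A + X + C = 0" "C = - B" for A B C X :: complex
    using that by (auto simp: complex_eq_iff)
  have lin': "A - B = X" if "D + X + B = 0" "D = - A" for A B D X :: complex
    using that by (auto simp: complex_eq_iff)
  have lin'': "(q + A + X + B) - (q + A' + X' + B') = (A - A') + (X - X') + (B - B')"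
    for q A X B A' X' B' :: complex
    by simp
  have "winding_number (closing_loop q d) z - winding_number (closing_loop q (- d)) z =
      - ?L (C1 d) (C1 (-d)) + (?L (C1 d) (C0 d) - ?L (C1 (-d)) (C0 (-d))) + ?L (C0 d) (C0 (- d))"
    unfolding winding_number_closing[OF z ne(1)] winding_number_closing[OF z ne(2)] lin''
      lin[OF off_sides(3)[OF z, of d "- d"] rev(1)[of "- d"]]
      lin'[OF off_sides(4)[OF z, of d "- d"] rev(2)[of d]] ..
  also have "\<dots> = of_real (heading q)"
    using heading_cases
  proof
    assume "heading q = 1 \<and> Re (pathstart q) = 0 \<and> Re (pathfinish q) = 1"
    then show ?thesis
      using rect rev' by (simp add: C0_def C1_def) (auto simp: complex_eq_iff)
  next
    assume "heading q = -1 \<and> Re (pathstart q) = 1 \<and> Re (pathfinish q) = 0"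
    then show ?thesis
      using rect rev' by (simp add: C0_def C1_def) (auto simp: complex_eq_iff)
  qed
  finally have eq: "winding_number (closing_loop q d) z - winding_number (closing_loop q (- d)) z = of_real (heading q)" .
  show ?thesis
    using heading_cases
  proof
    assume "heading q = -1 \<and> Re (pathstart q) = 1 \<and> Re (pathfinish q) = 0"
    then show ?thesis
      using eq by (auto simp: complex_eq_iff)
  qed (use eq in auto)
qed

lemma right_mult_eq:
  assumes z: "z \<in> strip" "z \<notin> path_image q" and d: "\<bar>Im z\<bar> < d"
  shows "of_int (right_mult q z) = - winding_number (closing_loop q (- heading q * d)) z"
proof -
  have const: "winding_number (closing_loop q (- heading q * d')) z = winding_number (closing_loop q (- heading q * d)) z"
    if "\<bar>Im z\<bar> < d'" for d'
    by (rule winding_number_closing_height[OF z]) (use d that heading_cases in auto)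
  have "winding_number (closing_loop q (- heading q * d)) z \<in> \<int>"
    by (rule integer_winding_number[OF path_closing closing_closed off_closing[OF z]]) (use d heading_cases in auto)
  then obtain n where n: "winding_number (closing_loop q (- heading q * d)) z = of_int n"
    by (auto elim: Ints_cases)
  have ev: "\<forall>\<^sub>F d' in at_top. winding_number (closing_loop q (- heading q * d')) z = of_int n"
    using eventually_gt_at_top[of "\<bar>Im z\<bar>"] by eventually_elim (use const n in auto)
  have "right_mult q z = - n"
    unfolding right_mult_heading
  proof (rule the_equality)
    show "\<forall>\<^sub>F d in at_top. of_int (- n) = - winding_number (closing_loop q (- heading q * d)) z"
      using ev by eventually_elim simp
    fix m assume "\<forall>\<^sub>F d in at_top. of_int m = - winding_number (closing_loop q (- heading q * d)) z"
    with ev have "\<forall>\<^sub>F d :: real in at_top. m = - n"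
      by eventually_elim (simp add: of_int_eq_iff[symmetric, where 'a = complex] del: of_int_eq_iff)
    then show "m = - n"
      by simp
  qed
  with n show ?thesis
    by simp
qed

lemma left_mult_eq:
  assumes z: "z \<in> strip" "z \<notin> path_image q" and d: "\<bar>Im z\<bar> < d"
  shows "of_int (left_mult q z) = winding_number (closing_loop q (heading q * d)) z"
proof -
  have const: "winding_number (closing_loop q (heading q * d')) z = winding_number (closing_loop q (heading q * d)) z"
    if "\<bar>Im z\<bar> < d'" for d'
    by (rule winding_number_closing_height[OF z]) (use d that heading_cases in auto)
  have "winding_number (closing_loop q (heading q * d)) z \<in> \<int>"
    by (rule integer_winding_number[OF path_closing closing_closed off_closing[OF z]]) (use d heading_cases in auto)
  then obtain n where n: "winding_number (closing_loop q (heading q * d)) z = of_int n"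
    by (auto elim: Ints_cases)
  have ev: "\<forall>\<^sub>F d' in at_top. winding_number (closing_loop q (heading q * d')) z = of_int n"
    using eventually_gt_at_top[of "\<bar>Im z\<bar>"] by eventually_elim (use const n in auto)
  have "left_mult q z = n"
    unfolding left_mult_heading
  proof (rule the_equality)
    show "\<forall>\<^sub>F d in at_top. of_int n = winding_number (closing_loop q (heading q * d)) z"
      using ev by eventually_elim simp
    fix m assume "\<forall>\<^sub>F d in at_top. of_int m = winding_number (closing_loop q (heading q * d)) z"
    with ev have "\<forall>\<^sub>F d :: real in at_top. m = n"
      by eventually_elim (simp add: of_int_eq_iff[symmetric, where 'a = complex] del: of_int_eq_iff)
    then show "m = n"
      by simp
  qed
  with n show ?thesis
    by simp
qed

text \<open>Consequence of \<open>winding_number_closing_opposite\<close>: even for a curve that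
  crosses itself, both sides together count each point once.\<close>

lemma left_mult_right_mult:
  assumes z: "z \<in> strip" "z \<notin> path_image q"
  shows "left_mult q z = 1 - right_mult q z"
proof -
  have d: "\<bar>Im z\<bar> < \<bar>Im z\<bar> + 1"
    by simp
  have "complex_of_int (left_mult q z) = of_int (1 - right_mult q z)"
    using left_mult_eq[OF z d] right_mult_eq[OF z d] winding_number_closing_opposite[OF z d]
    by (simp add: algebra_simps)
  then show ?thesis
    by (simp only: of_int_eq_iff)
qed

lemma right_mult_constant:
  assumes X: "connected X" "X \<subseteq> strip - path_image q" "z \<in> X" "z' \<in> X"
  shows "right_mult q z = right_mult q z'"
proof -
  have "right_mult q constant_on X"
  proof (rule locally_constant_imp_constant[OF X(1)])
    fix z assume "z \<in> X"
    then have z: "z \<in> strip" "z \<notin> path_image q"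
      using X(2) by auto
    \<comment> \<open>The extra 1 makes this height large enough for all points within distance 1,
      so one loop serves a neighbourhood.\<close>
    define d where "d = \<bar>Im z\<bar> + 1"
    let ?C = "closing_loop q (- heading q * d)"
    have "z \<notin> path_image ?C"
      by (rule off_closing[OF z]) (use heading_cases in \<open>auto simp: d_def\<close>)
    moreover have "open (- path_image ?C)"
      using path_closing by (simp add: closed_path_image open_Compl)
    ultimately obtain r where r: "0 < r" "ball z r \<subseteq> - path_image ?C"
      unfolding open_contains_ball by blast
    define T where "T = X \<inter> ball z (min r 1)"
    have "right_mult q w = right_mult q z" if "w \<in> T" for w
    proof -
      have w: "w \<in> strip" "w \<notin> path_image q" "w \<in> ball z r" "dist z w < 1"
        using that X(2) by (auto simp: T_def)
      have "\<bar>Im w - Im z\<bar> < 1"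
        using abs_Im_le_cmod[of "w - z"] w(4) by (simp add: dist_norm norm_minus_commute)
      then have wd: "\<bar>Im w\<bar> < d"
        by (simp add: d_def)
      have "winding_number ?C constant_on ball z r"
        by (rule winding_number_constant[OF path_closing closing_closed]) (use r in auto)
      then have "winding_number ?C w = winding_number ?C z"
        using w r unfolding constant_on_def by (metis centre_in_ball)
      then have "complex_of_int (right_mult q w) = of_int (right_mult q z)"
        using right_mult_eq[OF w(1,2) wd] right_mult_eq[OF z, of d] by (simp add: d_def)
      then show ?thesis
        by (simp only: of_int_eq_iff)
    qed
    moreover have "openin (top_of_set X) T"
      unfolding T_def by (simp add: openin_open_Int)
    moreover have "z \<in> T"
      using \<open>z \<in> X\<close> r by (simp add: T_def)
    ultimately show "\<exists>T. openin (top_of_set X) T \<and> z \<in> T \<and> (\<forall>w\<in>T. right_mult q w = right_mult q z)"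
      by blast
  qed
  with X show ?thesis
    unfolding constant_on_def by metis
qed

text \<open>Closed up on its right-hand side, the curve stays in a half-plane that misses
  \<open>z\<close>.\<close>

lemma right_mult_0:
  assumes z: "z \<in> strip" and above: "\<And>w. w \<in> path_image q \<Longrightarrow> heading q * Im w < heading q * Im z"
  shows "right_mult q z = 0"
proof -
  let ?C = "closing_loop q (- heading q * (\<bar>Im z\<bar> + 1))" and ?X = "{w. heading q * Im w < heading q * Im z}"
  have "z \<notin> path_image q"
    using above by blast
  have X: "convex ?X"
    using heading_cases convex_halfspace_Im_lt convex_halfspace_Im_gt by auto
  have "pathstart q \<in> ?X" "pathfinish q \<in> ?X" "C0 (- heading q * (\<bar>Im z\<bar> + 1)) \<in> ?X" "C1 (- heading q * (\<bar>Im z\<bar> + 1)) \<in> ?X"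
    using above heading_cases by (auto simp: C0_def C1_def)
  moreover have "path_image q \<subseteq> ?X"
    using above by blast
  ultimately have "path_image ?C \<subseteq> ?X"
    using closed_segment_subset[OF _ _ X] by (simp add: closing_loop_eq path_image_join)
  then have "winding_number ?C z = 0"
    by (intro winding_number_zero_outside[OF path_closing X closing_closed]) auto
  then have "complex_of_int (right_mult q z) = 0"
    using right_mult_eq[OF z \<open>z \<notin> path_image q\<close>, of "\<bar>Im z\<bar> + 1"] by simp
  then show ?thesis
    by simp
qed

text \<open>Closed up on its left-hand side, the curve stays in a half-plane that misses
  \<open>z\<close>; so the left multiplicity is 0 and the right one is 1.\<close>

lemma right_mult_1:
  assumes z: "z \<in> strip" and below: "\<And>w. w \<in> path_image q \<Longrightarrow> heading q * Im z < heading q * Im w"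
  shows "right_mult q z = 1"
proof -
  let ?C = "closing_loop q (heading q * (\<bar>Im z\<bar> + 1))" and ?X = "{w. heading q * Im z < heading q * Im w}"
  have zq: "z \<notin> path_image q"
    using below by blast
  have X: "convex ?X"
    using heading_cases convex_halfspace_Im_lt convex_halfspace_Im_gt by auto
  have "pathstart q \<in> ?X" "pathfinish q \<in> ?X" "C0 (heading q * (\<bar>Im z\<bar> + 1)) \<in> ?X" "C1 (heading q * (\<bar>Im z\<bar> + 1)) \<in> ?X"
    using below heading_cases by (auto simp: C0_def C1_def)
  moreover have "path_image q \<subseteq> ?X"
    using below by blast
  ultimately have "path_image ?C \<subseteq> ?X"
    using closed_segment_subset[OF _ _ X] by (simp add: closing_loop_eq path_image_join)
  then have "winding_number ?C z = 0"
    by (intro winding_number_zero_outside[OF path_closing X closing_closed]) auto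
  then have "complex_of_int (left_mult q z) = 0"
    using left_mult_eq[OF z zq, of "\<bar>Im z\<bar> + 1"] by simp
  then show ?thesis
    using left_mult_right_mult[OF z zq] by simp
qed

end

section \<open>The region between two crossing curves\<close>

lemma closed_segment_end_closest:
  fixes z :: complex
  assumes "p \<in> closed_segment z x" "dist z x \<le> dist z p"
  shows "p = x"
proof -
  obtain u where u: "0 \<le> u" "u \<le> 1" "p = (1 - u) *\<^sub>R z + u *\<^sub>R x"
    using assms(1) unfolding closed_segment_def by blast
  have "p - z = u *\<^sub>R (x - z)"
    by (simp add: u algebra_simps)
  then have "dist z p = u * dist z x"
    using u(1) by (metis abs_of_nonneg dist_commute dist_norm norm_scaleR)
  then have "u = 1 \<or> dist z x = 0"
    using assms(2) u by (metis less_eq_real_def mult_less_cancel_right2 not_less zero_le_dist)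
  then show ?thesis
    using u by auto
qed

text \<open>Its negated winding number turns out to be the multiplicity of the region to the right
  of \<open>q\<close> and to the left of \<open>r\<close>, if \<open>r\<close> is completely to the
  right of \<open>q\<close> and both cross in the same direction.\<close>

definition between_loop :: "(real \<Rightarrow> complex) \<Rightarrow> (real \<Rightarrow> complex) \<Rightarrow> real \<Rightarrow> complex" where
  "between_loop q r = q +++ linepath (pathfinish q) (pathfinish r) +++ reversepath r +++
     linepath (pathstart r) (pathstart q)"

lemma crossing_reversepath: "crossing q \<Longrightarrow> crossing (reversepath q)"
  by (auto simp: crossing_def)

lemma heading_reversepath:
  assumes "crossing q"
  shows "heading (reversepath q) = - heading q"
  using crossing.heading_cases[OF assms] by (auto simp: heading_def)

text \<open>Reversal changes the sign of the heading, so both multiplicities close the curve at the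
  same height, and the two loops are reverses of each other. This reduces a path running against the
  trail to one running along the reversed trail.\<close>

lemma left_mult_reversepath:
  assumes r: "crossing r" and z: "z \<in> strip" "z \<notin> path_image r"
  shows "left_mult (reversepath r) z = right_mult r z"
proof -
  let ?r = "reversepath r"
  interpret r: crossing r
    by (rule r)
  interpret rev: crossing ?r
    by (rule crossing_reversepath[OF r])
  define h where "h = - heading r * (\<bar>Im z\<bar> + 1)"
  have d: "\<bar>Im z\<bar> < \<bar>Im z\<bar> + 1"
    by simp
  have z': "z \<notin> path_image ?r"
    using z by simp
  have h: "h \<noteq> Im z"
    using r.heading_cases by (auto simp: h_def)
  have C: "rev.C0 h = r.C1 h" "rev.C1 h = r.C0 h"
    by (simp_all add: rev.C0_def rev.C1_def r.C0_def r.C1_def)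
  have rev: "winding_number (linepath (pathstart r) (r.C0 h)) z = - winding_number (linepath (r.C0 h) (pathstart r)) z"
    "winding_number (linepath (r.C0 h) (r.C1 h)) z = - winding_number (linepath (r.C1 h) (r.C0 h)) z"
    "winding_number (linepath (r.C1 h) (pathfinish r)) z = - winding_number (linepath (pathfinish r) (r.C1 h)) z"
    using winding_number_linepath_reverse[OF r.off_sides(2)[OF z]]
      winding_number_linepath_reverse[OF r.off_top[OF h]]
      winding_number_linepath_reverse[OF r.off_sides(1)[OF z]] by blast+
  have "complex_of_int (left_mult ?r z) = winding_number (closing_loop ?r h) z"
    using rev.left_mult_eq[OF z(1) z' d] heading_reversepath[OF r] by (simp add: h_def)
  also have "\<dots> = - winding_number (closing_loop r h) z"
    unfolding rev.winding_number_closing[OF z(1) z' h] r.winding_number_closing[OF z h] C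
    using rev winding_number_reversepath[OF r.path z(2)] by simp
  also have "\<dots> = of_int (right_mult r z)"
    using r.right_mult_eq[OF z d] by (simp add: h_def)
  finally show ?thesis
    by (simp only: of_int_eq_iff)
qed

locale crossing_pair = q: crossing q + r: crossing r for q r :: "real \<Rightarrow> complex" +
  assumes same_heading: "heading r = heading q"
begin

text \<open>A point that is not once to the right of \<open>q\<close> is connected, avoiding \<open>r\<close>, to the far end of
  the strip on the left of \<open>q\<close>: walk straight towards \<open>q\<close>, then along \<open>q\<close> to an extremal point of
  it, and from there parallel to the boundary.\<close>

lemma not_right_imp_right_mult_0:
  assumes right: "completely_right_of r q"
    and z: "z \<in> strip" "z \<notin> path_image q" and ne: "right_mult q z \<noteq> 1"
  shows "right_mult r z = 0"
proof -
  let ?\<sigma> = "heading q"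
  have disj: "path_image r \<inter> path_image q = {}" and r1: "\<And>w. w \<in> path_image r \<Longrightarrow> right_mult q w = 1"
    using right by (auto simp: completely_right_of_def)
  have not_r: "w \<notin> path_image r" if "w \<in> path_image q" for w
    using that disj by blast
  \<comment> \<open>The segment from \<open>z\<close> to this point of \<open>q\<close> is only
    followed up to \<open>x\<close>, the first point where it meets \<open>q\<close>.\<close>
  let ?y = "pathstart q"
  have "compact (closed_segment z ?y \<inter> path_image q)"
    using q.path by (intro compact_Int) (auto simp: compact_path_image)
  moreover have "?y \<in> closed_segment z ?y \<inter> path_image q"
    by (simp add: pathstart_in_path_image)
  then have "closed_segment z ?y \<inter> path_image q \<noteq> {}"
    by blast
  ultimately have "\<exists>x\<in>closed_segment z ?y \<inter> path_image q.
      \<forall>p\<in>closed_segment z ?y \<inter> path_image q. dist z x \<le> dist z p"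
    by (rule continuous_attains_inf) (intro continuous_intros)
  then obtain x where x: "x \<in> closed_segment z ?y" "x \<in> path_image q"
    and xmin: "\<And>p. p \<in> closed_segment z ?y \<Longrightarrow> p \<in> path_image q \<Longrightarrow> dist z x \<le> dist z p"
    by blast
  have zx: "closed_segment z x \<subseteq> closed_segment z ?y" "closed_segment z x \<subseteq> strip"
  proof -
    show "closed_segment z x \<subseteq> closed_segment z ?y"
      using x(1) by (simp add: subset_closed_segment)
    show "closed_segment z x \<subseteq> strip"
      using z x q.in_strip by (intro closed_segment_subset convex_strip) auto
  qed
  have first: "p = x" if "p \<in> closed_segment z x" "p \<in> path_image q" for p
    using closed_segment_end_closest[OF that(1)] xmin zx(1) that by blast
  \<comment> \<open>Before \<open>x\<close> the right multiplicity with respect to \<open>q\<close>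
    keeps its value at \<open>z\<close>, which is not 1, whereas it is 1 on
    \<open>r\<close>.\<close>
  have seg: "p \<notin> path_image r" if p: "p \<in> closed_segment z x" for p
  proof (cases "p = x")
    case True
    then show ?thesis
      using x not_r by simp
  next
    case False
    have sub: "closed_segment z p \<subseteq> closed_segment z x"
      using p by (simp add: subset_closed_segment)
    have "x \<notin> closed_segment z p"
    proof
      assume "x \<in> closed_segment z p"
      moreover have "dist z p \<le> dist z x"
        using segment_bound(1)[OF p] by (simp add: dist_norm norm_minus_commute)
      ultimately show False
        using closed_segment_end_closest[of x z p] False by simp
    qed
    then have "closed_segment z p \<subseteq> strip - path_image q"
      using sub zx(2) first by blast
    then have "right_mult q p = right_mult q z"
      by (intro q.right_mult_constant[of "closed_segment z p"]) auto
    then show ?thesis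
      using r1 ne by auto
  qed
  have "\<exists>y\<in>path_image q. \<forall>w\<in>path_image q. ?\<sigma> * Im w \<le> ?\<sigma> * Im y"
    by (rule continuous_attains_sup) (use q.path in \<open>auto simp: compact_path_image intro!: continuous_intros\<close>)
  then obtain y where y: "y \<in> path_image q" and ymax: "\<And>w. w \<in> path_image q \<Longrightarrow> ?\<sigma> * Im w \<le> ?\<sigma> * Im y"
    by blast
  \<comment> \<open>The ray from the extremal point \<open>y\<close> of \<open>q\<close> towards the
    far left of \<open>q\<close>. Beyond \<open>y\<close> the right multiplicity is 0, so the ray
    avoids \<open>r\<close>.\<close>
  define Y where "Y = {w. Re w = Re y \<and> ?\<sigma> * Im y \<le> ?\<sigma> * Im w}"
  have "Y = {w. Re w = Re y} \<inter> {w. inner (Complex 0 ?\<sigma>) w \<ge> ?\<sigma> * Im y}"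
    by (auto simp: Y_def inner_complex_def)
  moreover have "convex {w. Re w = Re y}"
    by (auto simp: convex_def algebra_simps) (metis distrib_right mult_1)
  ultimately have "convex Y"
    by (simp add: convex_Int convex_halfspace_ge)
  have "Y \<subseteq> strip"
    using y q.in_strip by (auto simp: Y_def strip_def)
  have Yr: "w \<notin> path_image r" if w: "w \<in> Y" for w
  proof (cases "?\<sigma> * Im w = ?\<sigma> * Im y")
    case True
    then have "w = y"
      using w q.heading_cases by (auto simp: Y_def complex_eq_iff)
    then show ?thesis
      using y not_r by simp
  next
    case False
    moreover have "?\<sigma> * Im y \<le> ?\<sigma> * Im w" "w \<in> strip"
      using w \<open>Y \<subseteq> strip\<close> by (auto simp: Y_def)
    ultimately have "?\<sigma> * Im y < ?\<sigma> * Im w" "w \<in> strip"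
      by linarith+
    then have "right_mult q w = 0"
      using ymax le_less_trans by (intro q.right_mult_0) blast+
    then show ?thesis
      using r1[of w] by auto
  qed
  define X where "X = closed_segment z x \<union> path_image q \<union> Y"
  have c: "connected (closed_segment z x \<union> path_image q)"
    by (rule connected_Un) (use x(2) q.path in \<open>auto simp: connected_path_image\<close>)
  have "y \<in> Y"
    by (simp add: Y_def)
  then have "connected X"
    unfolding X_def using y by (intro connected_Un[OF c convex_connected[OF \<open>convex Y\<close>]]) blast
  have "X \<subseteq> strip - path_image r"
    using seg not_r Yr zx(2) q.in_strip \<open>Y \<subseteq> strip\<close> by (auto simp: X_def)
  have "bounded ((\<lambda>w. ?\<sigma> * Im w) ` path_image r)"
    using r.path by (intro compact_imp_bounded compact_continuous_image continuous_intros) (auto simp: compact_path_image)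
  then obtain B where B: "\<And>w. w \<in> path_image r \<Longrightarrow> \<bar>?\<sigma> * Im w\<bar> \<le> B"
    unfolding bounded_iff by auto
  \<comment> \<open>A point of the ray beyond \<open>y\<close> and beyond all of
    \<open>r\<close>.\<close>
  define w where "w = Complex (Re y) (?\<sigma> * (max B (?\<sigma> * Im y) + 1))"
  have \<sigma>2: "?\<sigma> * ?\<sigma> = 1"
    using q.heading_cases by auto
  have Imw: "?\<sigma> * Im w = max B (?\<sigma> * Im y) + 1"
    by (simp add: w_def mult.assoc[symmetric] \<sigma>2)
  then have "w \<in> Y"
    by (simp add: Y_def) (simp add: w_def)
  have "right_mult r w = 0"
  proof (rule r.right_mult_0)
    show "w \<in> strip"
      using \<open>w \<in> Y\<close> \<open>Y \<subseteq> strip\<close> by blast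
    fix w' assume "w' \<in> path_image r"
    then have "\<bar>?\<sigma> * Im w'\<bar> \<le> B"
      by (rule B)
    then show "heading r * Im w' < heading r * Im w"
      unfolding same_heading Imw by linarith
  qed
  moreover have "right_mult r z = right_mult r w"
    using \<open>connected X\<close> \<open>X \<subseteq> strip - path_image r\<close> \<open>w \<in> Y\<close> by (intro r.right_mult_constant[of X]) (auto simp: X_def)
  ultimately show ?thesis
    by simp
qed

text \<open>If \<open>right_mult q z\<close> is 1, this is \<open>left_mult_right_mult\<close> for
  \<open>r\<close>. Otherwise \<open>right_mult r z\<close> vanishes and
  \<open>left_mult r z\<close> is 1.\<close>

lemma right_times_left:
  assumes "completely_right_of r q" "z \<in> strip" "z \<notin> path_image q" "z \<notin> path_image r"
  shows "right_mult q z * left_mult r z = right_mult q z - right_mult r z"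
  using not_right_imp_right_mult_0[OF assms(1-3)] r.left_mult_right_mult[OF assms(2,4)]
  by (cases "right_mult q z = 1") (auto simp: algebra_simps)

lemma between_loop_closed:
  "path (between_loop q r)" "pathfinish (between_loop q r) = pathstart (between_loop q r)"
  using q.path r.path by (auto simp: between_loop_def)

lemma between_loop_off:
  assumes z: "0 < Re z" "Re z < 1" "z \<notin> path_image q" "z \<notin> path_image r"
  shows "z \<notin> path_image (between_loop q r)"
    "winding_number (between_loop q r) z = winding_number q z +
      winding_number (linepath (pathfinish q) (pathfinish r)) z - winding_number r z +
      winding_number (linepath (pathstart r) (pathstart q)) z"
    "z \<notin> closed_segment (pathfinish q) (pathfinish r)" "z \<notin> closed_segment (pathstart r) (pathstart q)"
proof -
  have "Re (pathfinish q) = Re (pathfinish r)" "Re (pathstart r) = Re (pathstart q)"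
    "Re (pathfinish q) \<noteq> Re z" "Re (pathstart r) \<noteq> Re z"
    using q.heading_cases r.heading_cases same_heading z by auto
  then show off: "z \<notin> closed_segment (pathfinish q) (pathfinish r)" "z \<notin> closed_segment (pathstart r) (pathstart q)"
    using closed_segment_Re_eq by metis+
  show "z \<notin> path_image (between_loop q r)"
    using off z by (simp add: between_loop_def path_image_join)
  show "winding_number (between_loop q r) z = winding_number q z +
      winding_number (linepath (pathfinish q) (pathfinish r)) z - winding_number r z +
      winding_number (linepath (pathstart r) (pathstart q)) z"
    using off z q.path r.path
    by (simp add: between_loop_def winding_number_join not_in_path_image_join winding_number_reversepath)
qed

text \<open>Both curves are closed up through the same corners, so the horizontal segment cancels.
  At either end the triangle relation turns the two closing segments into the boundary segment from
  one curve to the other.\<close>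

lemma right_mult_diff:
  assumes z: "0 < Re z" "Re z < 1" "z \<notin> path_image q" "z \<notin> path_image r"
  shows "of_int (right_mult q z - right_mult r z) = - winding_number (between_loop q r) z"
proof -
  let ?L = "\<lambda>a b. winding_number (linepath a b) z"
  have strip: "z \<in> strip"
    using z by (simp add: strip_def)
  define h where "h = - heading q * (\<bar>Im z\<bar> + 1)"
  have d: "\<bar>Im z\<bar> < \<bar>Im z\<bar> + 1"
    by simp
  have h: "h \<noteq> Im z"
    using q.heading_cases by (auto simp: h_def)
  have C: "r.C0 h = q.C0 h" "r.C1 h = q.C1 h"
    using q.heading_cases r.heading_cases same_heading by (auto simp: q.C0_def q.C1_def r.C0_def r.C1_def)
  note Q = q.off_sides(1,2)[OF strip z(3), of h] and R = r.off_sides(1,2)[OF strip z(4), of h, unfolded C]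
  let ?s = "heading q"
  have fin: "?s * Re z < ?s * Re (pathfinish q)" "?s * Re z < ?s * Re (q.C1 h)" "?s * Re z < ?s * Re (pathfinish r)"
    and start: "- ?s * Re z < - ?s * Re (pathstart q)" "- ?s * Re z < - ?s * Re (q.C0 h)" "- ?s * Re z < - ?s * Re (pathstart r)"
    using q.heading_cases r.heading_cases same_heading z by (auto simp: q.C0_def q.C1_def)
  have nefs: "z \<noteq> pathfinish q" "z \<noteq> pathstart r"
    using fin(1) start(3) by auto
  have T1: "?L (pathfinish q) (q.C1 h) + ?L (q.C1 h) (pathfinish r) + ?L (pathfinish r) (pathfinish q) = 0"
    by (rule winding_number_triangle_zero(4)[OF less_imp_le[OF fin(1)] fin(2,3) nefs(1)])
  have T0: "?L (pathstart r) (q.C0 h) + ?L (q.C0 h) (pathstart q) + ?L (pathstart q) (pathstart r) = 0"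
    by (rule winding_number_triangle_zero(4)[OF less_imp_le[OF start(3)] start(2,1) nefs(2)])
  have rev: "?L (q.C1 h) (pathfinish r) = - ?L (pathfinish r) (q.C1 h)"
    "?L (pathfinish r) (pathfinish q) = - ?L (pathfinish q) (pathfinish r)"
    "?L (pathstart r) (q.C0 h) = - ?L (q.C0 h) (pathstart r)"
    "?L (pathstart q) (pathstart r) = - ?L (pathstart r) (pathstart q)"
    using winding_number_linepath_reverse[OF R(1)] winding_number_linepath_reverse[OF R(2)]
      winding_number_linepath_reverse[OF between_loop_off(3)[OF z]]
      winding_number_linepath_reverse[OF between_loop_off(4)[OF z]] by blast+
  have lin: "- (Wq + A + T + B) + (Wr + A' + T + B') = - (Wq + F - Wr + S)"
    if "A + - A' + - F = 0" "- B' + B + - S = 0" for Wq A T B Wr A' B' F S :: complex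
    using that by (auto simp: complex_eq_iff)
  have "complex_of_int (right_mult q z - right_mult r z) =
      - winding_number (closing_loop q h) z + winding_number (closing_loop r h) z"
    using q.right_mult_eq[OF strip z(3) d] r.right_mult_eq[OF strip z(4) d] same_heading by (simp add: h_def)
  also have "\<dots> = - winding_number (between_loop q r) z"
    unfolding q.winding_number_closing[OF strip z(3) h] r.winding_number_closing[OF strip z(4) h] C
      between_loop_off(2)[OF z]
    by (rule lin) (use T0 T1 in \<open>simp_all only: rev\<close>)
  finally show ?thesis .
qed

end

text \<open>Provides an admissible copy of the trail by moving any copy far along the strip.\<close>

lemma shifted_completely_right:
  assumes q: "crossing q" and r: "path r" "path_image r \<subseteq> strip"
  obtains k where "completely_right_of (\<lambda>s. shift k (r s)) q"
proof -
  interpret q: crossing q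
    by (rule q)
  have "bounded (path_image q)" "bounded (path_image r)"
    using q.path r by (auto simp: bounded_path_image)
  then obtain A B where AB: "\<And>w. w \<in> path_image q \<Longrightarrow> norm w \<le> A" "\<And>w. w \<in> path_image r \<Longrightarrow> norm w \<le> B"
    unfolding bounded_iff by blast
  obtain n :: nat where n: "A + B < real n"
    using reals_Archimedean2 by blast
  \<comment> \<open>The right-hand side is below for heading 1 and above otherwise. A shift by
    \<open>n\<close> moves by 2 pi \<open>n\<close>, which exceeds the bound \<open>A + B\<close> on
    both heights.\<close>
  define k where "k = (if heading q = 1 then - int n else int n)"
  have n': "A + B < 2 * pi * real n"
  proof -
    have "1 * real n \<le> 2 * pi * real n"
      using pi_gt3 by (intro mult_right_mono) auto
    with n show ?thesis by simp
  qed
  have below: "heading q * Im z < heading q * Im w" "z \<in> strip"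
    if z: "z \<in> path_image (\<lambda>s. shift k (r s))" and w: "w \<in> path_image q" for z w
  proof -
    obtain s where s: "s \<in> {0..1}" "z = shift k (r s)"
      using z by (auto simp: path_image_def)
    then have rs: "r s \<in> path_image r"
      by (auto simp: path_image_def)
    have "\<bar>Im (r s)\<bar> \<le> B" "\<bar>Im w\<bar> \<le> A"
      using AB(1)[OF w] AB(2)[OF rs] abs_Im_le_cmod order.trans by blast+
    then show "heading q * Im z < heading q * Im w"
      using n' q.heading_cases by (auto simp: s(2) k_def)
    show "z \<in> strip"
      using rs r(2) by (auto simp: s(2) strip_def)
  qed
  have "path_image (\<lambda>s. shift k (r s)) \<inter> path_image q = {}"
    using below(1) by blast
  moreover have "right_mult q z = 1" if "z \<in> path_image (\<lambda>s. shift k (r s))" for z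
    using below(1)[OF that] below(2)[OF that, of "pathstart q"] by (intro q.right_mult_1) auto
  ultimately show thesis
    by (intro that[of k]) (auto simp: completely_right_of_def)
qed

section \<open>Weights of regions\<close>

lemma exp_in_cylinder: "exp w \<in> cylinder \<longleftrightarrow> w \<in> strip"
  by (auto simp: cylinder_def strip_def)

lemma exp_in_open_cylinder: "exp w \<in> open_cylinder \<longleftrightarrow> 0 < Re w \<and> Re w < 1"
  by (auto simp: open_cylinder_def)

lemma prod_powi_sum:
  fixes y :: "'b :: field"
  assumes "y \<noteq> 0"
  shows "(\<Prod>i\<in>A. y powi n i) = y powi (\<Sum>i\<in>A. n i)"
  by (induction A rule: infinite_finite_induct) (auto simp: power_int_add assms)

lemma face_mult_eq:
  assumes "\<And>z z'. z \<in> F \<Longrightarrow> z' \<in> F \<Longrightarrow> m z = m z'" "w \<in> F"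
  shows "face_mult m F = m w"
  unfolding face_mult_def
proof (rule the_equality)
  show "\<forall>z\<in>F. m z = m w"
    using assms by blast
next
  fix n assume "\<forall>z\<in>F. m z = n"
  then show "n = m w"
    using assms(2) by simp
qed

lemma connected_image_shift: "connected F \<Longrightarrow> connected (shift k ` F)"
  by (intro connected_continuous_image continuous_intros)

text \<open>Common frame for both kinds of regions: the loop will be \<open>boundary_loop q\<close>
  or \<open>between_loop q r\<close>. The formula for \<open>m\<close> is demanded over the faces
  only, where the loop is never met.\<close>

locale winding_multiplicity = cyl_net N for N :: "('v, 'e) network" +
  fixes \<Lambda> :: "real \<Rightarrow> complex" and m :: "complex \<Rightarrow> int"
  assumes loop: "path \<Lambda>" "pathfinish \<Lambda> = pathstart \<Lambda>"
    and off: "\<And>w. exp w \<in> open_cylinder - drawing N \<Longrightarrow> w \<notin> path_image \<Lambda>"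
    and mult: "\<And>w. exp w \<in> open_cylinder - drawing N \<Longrightarrow> of_int (m w) = - winding_number \<Lambda> w"
begin

text \<open>A height beyond which the multiplicity vanishes; it exists because the loop is bounded,
  as shown in \<open>mult_far\<close>.\<close>

definition B :: real where
  "B = (SOME B. \<forall>w. exp w \<in> open_cylinder - drawing N \<longrightarrow> B < \<bar>Im w\<bar> \<longrightarrow> m w = 0)"

lemma mult_far:
  assumes "exp w \<in> open_cylinder - drawing N" "B < \<bar>Im w\<bar>"
  shows "m w = 0"
proof -
  have "bounded (path_image \<Lambda>)"
    using loop(1) by (rule bounded_path_image)
  then obtain B' where B': "path_image \<Lambda> \<subseteq> ball 0 B'"
    using bounded_subset_ballD by metis
  have "\<exists>B. \<forall>w. exp w \<in> open_cylinder - drawing N \<longrightarrow> B < \<bar>Im w\<bar> \<longrightarrow> m w = 0"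
  proof (intro exI allI impI)
    fix w assume w: "exp w \<in> open_cylinder - drawing N" "B' < \<bar>Im w\<bar>"
    then have "w \<notin> ball 0 B'"
      using abs_Im_le_cmod[of w] by simp
    then have "winding_number \<Lambda> w = 0"
      using B' by (intro winding_number_zero_outside[OF loop(1) convex_ball loop(2)])
    with mult[OF w(1)] show "m w = 0"
      by simp
  qed
  then have "\<forall>w. exp w \<in> open_cylinder - drawing N \<longrightarrow> B < \<bar>Im w\<bar> \<longrightarrow> m w = 0"
    unfolding B_def by (rule someI_ex)
  with assms show ?thesis
    by simp
qed

section \<open>The lifts of a single face\<close>

context
  fixes f assumes f: "f \<in> faces N"
begin

lemma face_off: "exp w \<in> f \<Longrightarrow> exp w \<in> open_cylinder - drawing N"
  using faces_subset[OF f] by blast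

lemma mult_constant:
  assumes F: "connected F" "F \<subseteq> exp -` f" "w \<in> F" "w' \<in> F"
  shows "m w = m w'"
proof -
  have "F \<inter> path_image \<Lambda> = {}"
    using F(2) off face_off by blast
  then have "winding_number \<Lambda> w = winding_number \<Lambda> w'"
    using winding_number_constant[OF loop F(1)] F(3,4) unfolding constant_on_def by metis
  moreover have "exp w \<in> f" "exp w' \<in> f"
    using F by blast+
  ultimately have "complex_of_int (m w) = of_int (m w')"
    using mult[OF face_off, of w] mult[OF face_off, of w'] by simp
  then show ?thesis
    by (simp only: of_int_eq_iff)
qed

lemma face_mult_component:
  assumes "F \<in> components (exp -` f)" "w \<in> F"
  shows "face_mult m F = m w"
  using mult_constant[OF in_components_connected[OF assms(1)] in_components_subset[OF assms(1)]] assms(2)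
  by (intro face_mult_eq)

text \<open>Such a component is unbounded, but the multiplicity vanishes far away.\<close>

lemma periodic_component_mult_0:
  assumes F: "F \<in> components (exp -` f)" and w: "w \<in> F" "shift k w \<in> F" and "k \<noteq> 0"
  shows "m w = 0"
proof -
  have "shift k ` F \<subseteq> F"
  proof (rule components_maximal[OF F])
    show "connected (shift k ` F)"
      using in_components_connected[OF F] by (rule connected_image_shift)
    have "exp (shift k v) \<in> f" if "v \<in> F" for v
      using in_components_subset[OF F] that by (simp only: exp_shift) blast
    then show "shift k ` F \<subseteq> exp -` f"
      by blast
    show "F \<inter> shift k ` F \<noteq> {}"
      using w by blast
  qed
  have n: "shift (int n * k) w \<in> F" for n
  proof (induction n)
    case (Suc n)
    have "shift k (shift (int n * k) w) \<in> F"
      using Suc \<open>shift k ` F \<subseteq> F\<close> by blast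
    then show ?case
      by (simp add: algebra_simps)
  qed (use w in simp)
  obtain n :: nat where n': "B + \<bar>Im w\<bar> < real n"
    using reals_Archimedean2 by blast
  have "B < \<bar>Im (shift (int n * k) w)\<bar>"
  proof -
    have "1 * real n \<le> (2 * pi * real_of_int \<bar>k\<bar>) * real n"
    proof (rule mult_right_mono)
      have "1 \<le> real_of_int \<bar>k\<bar>"
        using \<open>k \<noteq> 0\<close> by linarith
      then have "1 * 1 \<le> (2 * pi) * real_of_int \<bar>k\<bar>"
        using pi_gt3 by (intro mult_mono) auto
      then show "1 \<le> 2 * pi * real_of_int \<bar>k\<bar>"
        by simp
    qed simp
    also have "\<dots> = \<bar>2 * pi * (real n * real_of_int k)\<bar>"
      by (simp add: abs_mult)
    finally have "B + \<bar>Im w\<bar> < \<bar>2 * pi * (real n * real_of_int k)\<bar>"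
      using n' by linarith
    then show ?thesis
      by simp
  qed
  moreover have "exp (shift (int n * k) w) \<in> open_cylinder - drawing N"
    using in_components_subset[OF F] n[of n] face_off by blast
  ultimately have "m (shift (int n * k) w) = 0"
    by (intro mult_far)
  moreover have "m (shift (int n * k) w) = m w"
    using mult_constant[OF in_components_connected[OF F] in_components_subset[OF F] n w(1)] .
  ultimately show ?thesis
    by simp
qed

text \<open>Path lifting: a path in the face from the image of a point of \<open>F\<close> to
  \<open>z\<close> lifts to a path starting at that point, and this path stays in
  \<open>F\<close>.\<close>

lemma component_over_point:
  assumes F: "F \<in> components (exp -` f)" and z: "z \<in> f"
  obtains w where "w \<in> F" "exp w = z"
proof -
  obtain w0 where w0: "w0 \<in> F"
    using in_components_nonempty[OF F] by blast
  then have "exp w0 \<in> f"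
    using in_components_subset[OF F] by blast
  have "open f" "connected f"
    using f open_complement open_components in_components_connected unfolding faces_def by blast+
  then have "path_connected f"
    by (simp add: connected_open_path_connected)
  then obtain g where g: "path g" "path_image g \<subseteq> f" "pathstart g = exp w0" "pathfinish g = z"
    using \<open>exp w0 \<in> f\<close> z unfolding path_connected_def by metis
  have "0 \<notin> path_image g"
    using g(2) faces_subset[OF f] by (auto simp: open_cylinder_def)
  then obtain q where q: "is_copy q g"
    by (rule copy_exists[OF g(1)])
  then have "exp (q 0) = exp w0" "exp (q 1) = z"
    using g by (auto simp: is_copy_def pathstart_def pathfinish_def)
  then obtain k where k: "w0 = shift k (q 0)"
    using exp_eq_shift[of w0 "q 0"] by metis
  have "shift k ` path_image q \<subseteq> F"
  proof (rule components_maximal[OF F])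
    show "connected (shift k ` path_image q)"
      using q by (intro connected_image_shift connected_path_image) (simp add: is_copy_def)
    have "exp (shift k v) \<in> f" if "v \<in> path_image q" for v
      using q g(2) that by (simp only: exp_shift) (auto simp: is_copy_def path_image_def)
    then show "shift k ` path_image q \<subseteq> exp -` f"
      by blast
    show "F \<inter> shift k ` path_image q \<noteq> {}"
      using w0 k by (auto simp: path_image_def)
  qed
  moreover have "q 1 \<in> path_image q"
    by (simp add: path_image_def)
  ultimately have "shift k (q 1) \<in> F"
    by blast
  moreover have "exp (shift k (q 1)) = z"
    using \<open>exp (q 1) = z\<close> by (simp only: exp_shift)
  ultimately show thesis
    by (rule that)
qed

text \<open>Every lift contains some translate of \<open>w\<close> by
  \<open>component_over_point\<close>. Two different translates in one lift would make its
  multiplicity 0 by \<open>periodic_component_mult_0\<close>, so on nonzero multiplicities the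
  correspondence is one-to-one.\<close>

lemma component_bij:
  assumes w: "exp w \<in> f"
  shows "bij_betw (\<lambda>k. connected_component_set (exp -` f) (shift k w)) {k. m (shift k w) \<noteq> 0}
    {F \<in> components (exp -` f). face_mult m F \<noteq> 0}"
proof -
  let ?\<phi> = "\<lambda>k. connected_component_set (exp -` f) (shift k w)"
  have "exp (shift k w) \<in> f" for k
    using w by (simp only: exp_shift)
  then have in_f: "shift k w \<in> exp -` f" for k
    by simp
  have comp: "?\<phi> k \<in> components (exp -` f)" "shift k w \<in> ?\<phi> k" for k
    using in_f[of k] by (auto intro: componentsI)
  show ?thesis
  proof (rule bij_betw_imageI)
    show "inj_on ?\<phi> {k. m (shift k w) \<noteq> 0}"
    proof (rule inj_onI)
      fix k k' assume k: "k \<in> {k. m (shift k w) \<noteq> 0}" and eq: "?\<phi> k = ?\<phi> k'"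
      have sh: "shift (k' - k) (shift k w) = shift k' w"
        by (simp add: algebra_simps)
      have "shift (k' - k) (shift k w) \<in> ?\<phi> k"
        unfolding sh eq by (rule comp(2))
      then show "k = k'"
        using periodic_component_mult_0[OF comp(1) comp(2), of k "k' - k"] k by auto
    qed
    show "?\<phi> ` {k. m (shift k w) \<noteq> 0} = {F \<in> components (exp -` f). face_mult m F \<noteq> 0}"
    proof (intro subset_antisym subsetI)
      fix F assume "F \<in> ?\<phi> ` {k. m (shift k w) \<noteq> 0}"
      then obtain k where k: "m (shift k w) \<noteq> 0" "F = ?\<phi> k"
        by blast
      then show "F \<in> {F \<in> components (exp -` f). face_mult m F \<noteq> 0}"
        using comp face_mult_component[OF comp(1) comp(2)] by simp
    next
      fix F assume F: "F \<in> {F \<in> components (exp -` f). face_mult m F \<noteq> 0}"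
      then obtain w' where w': "w' \<in> F" "exp w' = exp w"
        using component_over_point w by blast
      then obtain k where k: "w' = shift k w"
        using exp_eq_shift[of w' w] by blast
      have "F = ?\<phi> k"
        using components_eqI[OF _ comp(1), of F w' k] comp(2)[of k] F w' k by simp
      moreover have "m (shift k w) \<noteq> 0"
        using F w' k face_mult_component[of F w'] by simp
      ultimately show "F \<in> ?\<phi> ` {k. m (shift k w) \<noteq> 0}"
        by blast
    qed
  qed
qed

lemma far_multiplicity:
  assumes w: "exp w \<in> f" and K: "B + \<bar>Im w\<bar> < real_of_int K" "K \<ge> 0"
  shows "{k. m (shift k w) \<noteq> 0} \<subseteq> {-K..K}"
proof
  fix k assume k: "k \<in> {k. m (shift k w) \<noteq> 0}"
  have "exp (shift k w) \<in> open_cylinder - drawing N"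
    using face_off[OF w] by (simp only: exp_shift)
  then have "\<not> B < \<bar>Im (shift k w)\<bar>"
    using k mult_far by blast
  then have "\<bar>2 * pi * real_of_int k\<bar> \<le> B + \<bar>Im w\<bar>"
    by simp
  moreover have "1 * \<bar>real_of_int k\<bar> \<le> (2 * pi) * \<bar>real_of_int k\<bar>"
    using pi_gt3 by (intro mult_right_mono) auto
  ultimately have "\<bar>real_of_int k\<bar> < real_of_int K"
    using K by (simp add: abs_mult)
  then show "k \<in> {-K..K}"
    by auto
qed

text \<open>The exponent with which the weight of \<open>f\<close> enters the region weight.\<close>

definition total :: int where
  "total = (\<Sum>F\<in>{F \<in> components (exp -` f). face_mult m F \<noteq> 0}. face_mult m F)"

text \<open>By \<open>component_bij\<close> the lifts may be replaced by the translates of any point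
  over \<open>f\<close>. So the right-hand side can be followed as \<open>w\<close> approaches an
  edge, while \<open>total\<close> stays fixed.\<close>

lemma total_eq:
  assumes w: "exp w \<in> f" and K: "B + \<bar>Im w\<bar> < real_of_int K" "K \<ge> 0"
  shows "total = (\<Sum>k\<in>{-K..K}. m (shift k w))"
    "finite {F \<in> components (exp -` f). face_mult m F \<noteq> 0}"
proof -
  have sub: "{k. m (shift k w) \<noteq> 0} \<subseteq> {-K..K}"
    by (rule far_multiplicity[OF w K])
  then show "finite {F \<in> components (exp -` f). face_mult m F \<noteq> 0}"
    using bij_betw_finite[OF component_bij[OF w]] finite_subset by blast
  have "exp (shift k w) \<in> f" for k
    using w by (simp only: exp_shift)
  then have "face_mult m (connected_component_set (exp -` f) (shift k w)) = m (shift k w)" for k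
    by (intro face_mult_component componentsI) auto
  then have "total = (\<Sum>k\<in>{k. m (shift k w) \<noteq> 0}. m (shift k w))"
    unfolding total_def using sum.reindex_bij_betw[OF component_bij[OF w], of "face_mult m"] by simp
  also have "\<dots> = (\<Sum>k\<in>{-K..K}. m (shift k w))"
    by (rule sum.mono_neutral_left) (use sub in auto)
  finally show "total = (\<Sum>k\<in>{-K..K}. m (shift k w))" .
qed

lemma finite_lifts: "finite {F \<in> components (exp -` f). face_mult m F \<noteq> 0}"
proof -
  obtain z where "z \<in> f"
    using f in_components_nonempty unfolding faces_def by blast
  moreover from this have "z \<noteq> 0"
    using faces_subset[OF f] by (auto simp: open_cylinder_def)
  ultimately have w: "exp (Ln z) \<in> f"
    by simp
  obtain n :: nat where "B + \<bar>Im (Ln z)\<bar> < real n"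
    using reals_Archimedean2 by blast
  then show ?thesis
    using total_eq(2)[OF w, of "int n"] by simp
qed

end

text \<open>The totals of the two faces along \<open>e\<close> are the limits of the windowed sum
  along \<open>FR\<close> and \<open>FL\<close>; their difference is therefore the jump.\<close>

lemma total_jump:
  assumes germ: "edge_germ N e ct t FR FL"
    and jump: "\<And>K. K0 \<le> K \<Longrightarrow> jump FR FL (\<lambda>w. \<Sum>k\<in>{-K..K}. - winding_number \<Lambda> (shift k w)) (of_int n)"
  shows "n = total (rface e) - total (lface e)"
proof -
  interpret edge_germ N e ct t FR FL
    by (rule germ)
  have faces: "rface e \<in> faces N" "lface e \<in> faces N"
    using sides_props[OF e] by auto
  \<comment> \<open>The 1 leaves room for all points within distance 1 of \<open>ct t\<close>, so
    that one window serves a neighbourhood.\<close>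
  obtain N0 :: nat where N0: "B + \<bar>Im (ct t)\<bar> + 1 < real N0"
    using reals_Archimedean2 by blast
  define K where "K = max K0 (int N0)"
  let ?\<psi> = "\<lambda>w. \<Sum>k\<in>{-K..K}. - winding_number \<Lambda> (shift k w)"
  have K: "K0 \<le> K" "K \<ge> 0" "B + \<bar>Im (ct t)\<bar> + 1 < real_of_int K"
    using N0 by (auto simp: K_def)
  have val: "of_int (total f) = ?\<psi> w" if "f \<in> faces N" "exp w \<in> f" "dist w (ct t) < 1" for f w
  proof -
    have "\<bar>Im w - Im (ct t)\<bar> < 1"
      using abs_Im_le_cmod[of "w - ct t"] that(3) by (simp add: dist_norm)
    then have "B + \<bar>Im w\<bar> < real_of_int K"
      using K by linarith
    then have "total f = (\<Sum>k\<in>{-K..K}. m (shift k w))"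
      using total_eq(1)[OF that(1,2)] K by blast
    moreover have "complex_of_int (m (shift k w)) = - winding_number \<Lambda> (shift k w)" for k
      using face_off[OF that(1,2)] by (intro mult) (simp only: exp_shift)
    ultimately show ?thesis
      by simp
  qed
  have near: "eventually (\<lambda>w. dist w (ct t) < 1) (nhds (ct t))"
    unfolding eventually_nhds_metric by (intro exI[of _ 1]) auto
  have "eventually (\<lambda>w. of_int (total (rface e)) = ?\<psi> w) FR"
    using FR(3) filter_leD[OF FR(2) near] by eventually_elim (rule val[OF faces(1)])
  then have R: "(?\<psi> \<longlongrightarrow> of_int (total (rface e))) FR"
    by (rule Lim_transform_eventually[OF tendsto_const])
  have "eventually (\<lambda>w. of_int (total (lface e)) = ?\<psi> w) FL"
    using FL(3) filter_leD[OF FL(2) near] by eventually_elim (rule val[OF faces(2)])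
  then have L: "(?\<psi> \<longlongrightarrow> of_int (total (lface e))) FL"
    by (rule Lim_transform_eventually[OF tendsto_const])
  obtain l where l: "(?\<psi> \<longlongrightarrow> l + of_int n) FR" "(?\<psi> \<longlongrightarrow> l) FL"
    using jump[OF K(1)] unfolding jump_def by blast
  have "l + of_int n = of_int (total (rface e))" "l = of_int (total (lface e))"
    using tendsto_unique[OF FR(1) l(1) R] tendsto_unique[OF FL(1) l(2) L] by auto
  then have "complex_of_int n = of_int (total (rface e) - total (lface e))"
    by (simp add: algebra_simps)
  then show ?thesis
    by (simp only: of_int_eq_iff)
qed

text \<open>Grouping the lifts by faces, and then the faces by edges, leaves one exponent for each
  edge, which is read off at a single germ of that edge.\<close>

lemma region_weight_eq:
  assumes "E \<noteq> {}"
    and jump: "\<And>e ct t FR FL. edge_germ N e ct t FR FL \<Longrightarrow> \<exists>K0. \<forall>K\<ge>K0.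
      jump FR FL (\<lambda>w. \<Sum>k\<in>{-K..K}. - winding_number \<Lambda> (shift k w)) (of_int (n e))"
  shows "region_weight N (face_weight N) m = (\<Prod>e\<in>E. weight N e powi n e)"
proof -
  let ?G = "\<lambda>f. {F \<in> components (exp -` f). face_mult m F \<noteq> 0}"
  have "{(f, F). f \<in> faces N \<and> F \<in> components (exp -` f) \<and> face_mult m F \<noteq> 0} = Sigma (faces N) ?G"
    by auto
  then have "region_weight N (face_weight N) m = (\<Prod>(f, F)\<in>Sigma (faces N) ?G. face_weight N f powi face_mult m F)"
    by (simp only: region_weight_def)
  also have "\<dots> = (\<Prod>f\<in>faces N. \<Prod>F\<in>?G f. face_weight N f powi face_mult m F)"
    using finite_faces[OF assms(1)] finite_lifts by (intro prod.Sigma[symmetric]) auto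
  also have "\<dots> = (\<Prod>f\<in>faces N. face_weight N f powi total f)"
  proof (intro prod.cong refl)
    fix f assume f: "f \<in> faces N"
    have "weight N e \<noteq> 0" if "e \<in> E" for e
      using weight_pos[OF that] by simp
    then have "face_weight N f \<noteq> 0"
      using finite_E by (auto simp: face_weight_eq[OF f])
    then show "(\<Prod>F\<in>?G f. face_weight N f powi face_mult m F) = face_weight N f powi total f"
      unfolding total_def[OF f] by (rule prod_powi_sum)
  qed
  also have "\<dots> = (\<Prod>e\<in>E. weight N e powi (total (rface e) - total (lface e)))"
    by (rule prod_face_weights[OF assms(1)])
  also have "\<dots> = (\<Prod>e\<in>E. weight N e powi n e)"
  proof (intro prod.cong refl)
    fix e assume e: "e \<in> E"
    obtain ct t FR FL where germ: "edge_germ N e ct t FR FL"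
      by (rule edge_germ_exists[OF e])
    obtain K0 where "\<And>K. K0 \<le> K \<Longrightarrow>
        jump FR FL (\<lambda>w. \<Sum>k\<in>{-K..K}. - winding_number \<Lambda> (shift k w)) (of_int (n e))"
      using jump[OF germ] by blast
    then have "n e = total (rface e) - total (lface e)"
      by (rule total_jump[OF germ])
    then show "weight N e powi (total (rface e) - total (lface e)) = weight N e powi n e"
      by simp
  qed
  finally show ?thesis .
qed

end

section \<open>Weights of paths\<close>

context cyl_net begin

lemma prod_steps_count:
  assumes "steps_connect N a ss b"
  shows "(\<Prod>e\<in>E. weight N e powi steps_count e ss) = trail_weight N ss"
  using assms
proof (induction ss arbitrary: a)
  case Nil
  show ?case
    by (simp add: steps_count_def trail_weight_def)
next
  case (Cons s ss)
  obtain e' fwd where s: "s = (e', fwd)"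
    by (cases s)
  have e': "e' \<in> E" "steps_connect N (step_finish N s) ss b"
    using Cons.prems by (auto simp: s)
  have ne: "weight N e \<noteq> 0" if "e \<in> E" for e
    using weight_pos[OF that] by simp
  have "(\<Prod>e\<in>E. weight N e powi steps_count e (s # ss)) =
      (\<Prod>e\<in>E. weight N e powi step_count e s * weight N e powi steps_count e ss)"
    using ne by (intro prod.cong refl) (simp add: steps_count_def power_int_add)
  also have "\<dots> = (\<Prod>e\<in>E. weight N e powi step_count e s) * trail_weight N ss"
    using Cons.IH[OF e'(2)] by (simp add: prod.distrib)
  also have "(\<Prod>e\<in>E. weight N e powi step_count e s) = (\<Prod>e\<in>E. if e = e' then step_weight N s else 1)"
    by (intro prod.cong refl) (auto simp: s power_int_minus)
  also have "\<dots> = step_weight N s"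
    using finite_E e' by simp
  finally show ?case
    by (simp add: trail_weight_def)
qed

lemma trail_weight_nonzero:
  assumes "steps_connect N a ss b"
  shows "trail_weight N ss \<noteq> 0"
proof -
  have "weight N e \<noteq> 0" if "e \<in> E" for e
    using weight_pos[OF that] by simp
  then show ?thesis
    using finite_E by (auto simp flip: prod_steps_count[OF assms])
qed

lemma trail_weight_path: "trail_weight N (map (\<lambda>e. (e, True)) p) = path_weight N p"
  by (induction p) (auto simp: trail_weight_def path_weight_def)

lemma awalk_steps_connect:
  assumes "pre_digraph.awalk (graph N) u p v"
  shows "steps_connect N u (map (\<lambda>e. (e, True)) p) v"
proof -
  have "steps_connect N u (map (\<lambda>e. (e, True)) p) v"
    if "set p \<subseteq> E" "pre_digraph.cas (graph N) u p v"
    using that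
  proof (induction p arbitrary: u)
    case Nil
    then show ?case
      by (simp add: pre_digraph.cas.simps)
  next
    case (Cons e p)
    then show ?case
      by (simp add: pre_digraph.cas.simps)
  qed
  then show ?thesis
    using assms by (simp add: pre_digraph.awalk_def)
qed

lemma steps_copy_exists:
  assumes "steps_connect N a ss b" "a \<in> V"
  obtains q where "is_copy q (steps_curve N a ss)"
proof (rule copy_exists)
  show "path (steps_curve N a ss)"
    by (rule steps_props(1)[OF assms])
  show "0 \<notin> path_image (steps_curve N a ss)"
    using steps_props(2)[OF assms] drawing_cylinder by (auto simp: cylinder_def)
qed

lemma steps_copy_props:
  assumes ss: "steps_connect N a ss b" "a \<in> V" and q: "is_copy q (steps_curve N a ss)"
  shows "path q" "path_image q \<subseteq> strip" "exp (pathstart q) = pos N a" "exp (pathfinish q) = pos N b"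
    "exp (Re (pathstart q)) = cmod (pos N a)" "exp (Re (pathfinish q)) = cmod (pos N b)"
    "exp w \<notin> drawing N \<Longrightarrow> w \<notin> path_image q"
proof -
  show "path q"
    using q by (simp add: is_copy_def)
  have "exp z \<in> drawing N" if "z \<in> path_image q" for z
    using q steps_props(2)[OF ss] that by (auto simp: is_copy_def path_image_def)
  then show "path_image q \<subseteq> strip" "exp w \<notin> drawing N \<Longrightarrow> w \<notin> path_image q"
    using drawing_cylinder exp_in_cylinder by blast+
  show *: "exp (pathstart q) = pos N a" "exp (pathfinish q) = pos N b"
    using q steps_props(3,4)[OF ss] by (auto simp: is_copy_def pathstart_def pathfinish_def)
  show "exp (Re (pathstart q)) = cmod (pos N a)" "exp (Re (pathfinish q)) = cmod (pos N b)"
    by (simp_all flip: *)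
qed

lemma boundary_cmod:
  assumes "v \<in> boundary_verts N"
  shows "cmod (pos N v) = exp 0 \<or> cmod (pos N v) = exp 1" "v \<in> V"
  using assms by (auto simp: boundary_verts_def cylinder_def open_cylinder_def)

lemma boundary_copy_ends:
  assumes ss: "steps_connect N a ss b" and q: "is_copy q (steps_curve N a ss)"
    and bd: "a \<in> boundary_verts N" "b \<in> boundary_verts N"
  shows "Re (pathstart q) \<in> {0, 1}" "Re (pathfinish q) \<in> {0, 1}"
proof -
  note p = steps_copy_props[OF ss boundary_cmod(2)[OF bd(1)] q]
  show "Re (pathstart q) \<in> {0, 1}" "Re (pathfinish q) \<in> {0, 1}"
    using p(5,6) boundary_cmod(1)[OF bd(1)] boundary_cmod(1)[OF bd(2)] by (metis exp_inj_iff insert_iff)+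
qed

lemma crossing_copy:
  assumes ss: "steps_connect N a ss b" and q: "is_copy q (steps_curve N a ss)"
    and bd: "a \<in> boundary_verts N" "b \<in> boundary_verts N" and ne: "Re (pathstart q) \<noteq> Re (pathfinish q)"
  shows "crossing q"
  using steps_copy_props(1,2)[OF ss boundary_cmod(2)[OF bd(1)] q] boundary_copy_ends[OF ss q bd] ne
  by unfold_locales auto

end

lemma open_cylinder_imp_strip: "exp w \<in> open_cylinder \<Longrightarrow> w \<in> strip"
  by (auto simp: exp_in_open_cylinder strip_def)

context edge_germ begin

text \<open>Inner points of edges lie over the open cylinder, hence off both boundary lines.\<close>

lemma boundary_line_jump:
  assumes "Re a = Re b" "Re a \<in> {0, 1}"
  shows "jump FR FL (\<lambda>w. \<Sum>k\<in>{-K..K}. winding_number (linepath a b) (shift k w)) 0"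
proof -
  have "curve N e t \<in> edge_interior N e"
    using t by (auto simp: edge_interior_def)
  then have "exp (ct t) \<in> open_cylinder"
    using edge_interior[OF e] exp_ct[of t] t by auto
  then have "shift k (ct t) \<notin> closed_segment a b" for k
    using closed_segment_Re_eq[of "shift k (ct t)" a b] assms by (auto simp: exp_in_open_cylinder)
  then have "jump FR FL (\<lambda>w. \<Sum>k\<in>{-K..K}. winding_number (linepath a b) (shift k w)) (\<Sum>k\<in>{-K..K}. 0)"
    by (intro jump_sum jump_0) auto
  then show ?thesis
    by simp
qed

lemma ev_open: "eventually (\<lambda>w. exp w \<in> open_cylinder - drawing N) FR"
  "eventually (\<lambda>w. exp w \<in> open_cylinder - drawing N) FL"
proof -
  have "rface e \<subseteq> open_cylinder - drawing N" "lface e \<subseteq> open_cylinder - drawing N"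
    using sides_props[OF e] faces_subset by auto
  then show "eventually (\<lambda>w. exp w \<in> open_cylinder - drawing N) FR"
    "eventually (\<lambda>w. exp w \<in> open_cylinder - drawing N) FL"
    using FR(3) FL(3) by (auto elim: eventually_mono)
qed

end

context cyl_net begin

text \<open>The closing boundary segment does not jump across edges, so the exponents are the step
  counts of the path alone.\<close>

lemma region_weight_enclosed:
  assumes E: "E \<noteq> {}" and ss: "steps_connect N u ss v" and q: "is_copy q (steps_curve N u ss)"
    and bd: "u \<in> boundary_verts N" "v \<in> boundary_verts N" and same: "Re (pathstart q) = Re (pathfinish q)"
  shows "region_weight N (face_weight N) (enclosed_mult q) = trail_weight N ss"
proof -
  have u: "u \<in> V"
    using bd(1) by (rule boundary_cmod)
  note p = steps_copy_props[OF ss u q]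
  note ends = boundary_copy_ends[OF ss q bd]
  let ?l = "linepath (pathfinish q) (pathstart q)"
  have off: "w \<notin> path_image q" "w \<notin> path_image ?l" if "exp w \<in> open_cylinder - drawing N" for w
  proof -
    show "w \<notin> path_image q"
      using p(7) that by blast
    have "0 < Re w" "Re w < 1"
      using that by (auto simp: exp_in_open_cylinder)
    then show "w \<notin> path_image ?l"
      using closed_segment_Re_eq[of w "pathfinish q" "pathstart q"] same ends by auto
  qed
  have W: "winding_number (boundary_loop q) w = winding_number q w + winding_number ?l w"
    if "exp w \<in> open_cylinder - drawing N" for w
    using off[OF that] p(1) by (simp add: boundary_loop_def winding_number_join)
  interpret winding_multiplicity N "boundary_loop q" "enclosed_mult q"
  proof
    show "path (boundary_loop q)" "pathfinish (boundary_loop q) = pathstart (boundary_loop q)"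
      using p(1) by (auto simp: boundary_loop_def)
    fix w assume w: "exp w \<in> open_cylinder - drawing N"
    show off': "w \<notin> path_image (boundary_loop q)"
      using off[OF w] by (simp add: boundary_loop_def path_image_join)
    have "winding_number (boundary_loop q) w \<in> \<int>"
      using p(1) off' by (intro integer_winding_number) (auto simp: boundary_loop_def)
    then obtain n where n: "winding_number (boundary_loop q) w = of_int n"
      by (auto elim: Ints_cases)
    then have "enclosed_mult q w = - n"
      by (intro enclosed_mult_eqI) simp
    with n show "of_int (enclosed_mult q w) = - winding_number (boundary_loop q) w"
      by simp
  qed
  have "region_weight N (face_weight N) (enclosed_mult q) = (\<Prod>e\<in>E. weight N e powi steps_count e ss)"
  proof (rule region_weight_eq[OF E])
    fix e ct t FR FL assume "edge_germ N e ct t FR FL"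
    then interpret edge_germ N e ct t FR FL .
    obtain K0 where K0: "\<And>K. K0 \<le> K \<Longrightarrow>
        jump FR FL (\<lambda>w. \<Sum>k\<in>{-K..K}. winding_number q (shift k w)) (- of_int (steps_count e ss))"
      using steps_jump[OF ss u q] by blast
    have "jump FR FL (\<lambda>w. \<Sum>k\<in>{-K..K}. - winding_number (boundary_loop q) (shift k w)) (of_int (steps_count e ss))"
      if "K0 \<le> K" for K
    proof -
      have "jump FR FL (\<lambda>w. - ((\<Sum>k\<in>{-K..K}. winding_number q (shift k w)) +
          (\<Sum>k\<in>{-K..K}. winding_number ?l (shift k w)))) (- (- of_int (steps_count e ss) + 0))"
        using same ends by (intro jump_uminus jump_add K0[OF that] boundary_line_jump) auto
      moreover have "- ((\<Sum>k\<in>{-K..K}. winding_number q (shift k w)) + (\<Sum>k\<in>{-K..K}. winding_number ?l (shift k w))) =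
          (\<Sum>k\<in>{-K..K}. - winding_number (boundary_loop q) (shift k w))"
        if "exp w \<in> open_cylinder - drawing N" for w
      proof -
        have w: "exp (shift k w) \<in> open_cylinder - drawing N" for k
          using that by (simp only: exp_shift)
        show ?thesis
          by (simp only: W[OF w] minus_add_distrib sum.distrib sum_negf)
      qed
      ultimately have "jump FR FL (\<lambda>w. \<Sum>k\<in>{-K..K}. - winding_number (boundary_loop q) (shift k w))
          (- (- of_int (steps_count e ss) + 0))"
        by (elim jump_cong) (use ev_open in \<open>auto elim!: eventually_mono\<close>)
      then show ?thesis
        by simp
    qed
    then show "\<exists>K0. \<forall>K\<ge>K0. jump FR FL (\<lambda>w. \<Sum>k\<in>{-K..K}. - winding_number (boundary_loop q) (shift k w))
        (of_int (steps_count e ss))"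
      by blast
  qed
  then show ?thesis
    using prod_steps_count[OF ss] by simp
qed

text \<open>The curve \<open>r\<close> is a copy of the trail or the reverse of one.\<close>

lemma region_weight_between:
  fixes n :: "'e \<Rightarrow> int"
  assumes E: "E \<noteq> {}" and ss: "steps_connect N u ss v" and q: "is_copy q (steps_curve N u ss)"
    and bd: "u \<in> boundary_verts N" "v \<in> boundary_verts N"
    and pair: "crossing_pair q r" and right: "completely_right_of r q"
    and off_r: "\<And>w. exp w \<notin> drawing N \<Longrightarrow> w \<notin> path_image r"
    and m: "\<And>w. exp w \<in> open_cylinder - drawing N \<Longrightarrow> m w = right_mult q w * left_mult r w"
    and jump_r: "\<And>e ct t FR FL. edge_germ N e ct t FR FL \<Longrightarrow> \<exists>K0. \<forall>K\<ge>K0.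
      jump FR FL (\<lambda>w. \<Sum>k\<in>{-K..K}. winding_number r (shift k w)) (- of_int (n e))"
  shows "region_weight N (face_weight N) m = trail_weight N ss / (\<Prod>e\<in>E. weight N e powi n e)"
proof -
  have u: "u \<in> V"
    using bd(1) by (rule boundary_cmod)
  note p = steps_copy_props[OF ss u q]
  interpret crossing_pair q r
    by (rule pair)
  let ?l1 = "linepath (pathfinish q) (pathfinish r)" and ?l2 = "linepath (pathstart r) (pathstart q)"
  have off_qr: "w \<notin> path_image q" "w \<notin> path_image r" "0 < Re w" "Re w < 1" "w \<in> strip"
    if "exp w \<in> open_cylinder - drawing N" for w
    using p(7)[of w] off_r[of w] that open_cylinder_imp_strip[of w] by (auto simp: exp_in_open_cylinder)
  interpret winding_multiplicity N "between_loop q r" m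
  proof
    fix w assume w: "exp w \<in> open_cylinder - drawing N"
    note o = off_qr[OF w]
    show "w \<notin> path_image (between_loop q r)"
      by (rule between_loop_off(1)[OF o(3,4,1,2)])
    \<comment> \<open>Here the product of two multiplicities becomes a difference, which the loop
      between \<open>q\<close> and \<open>r\<close> realizes.\<close>
    have "m w = right_mult q w - right_mult r w"
      using m[OF w] right_times_left[OF right o(5,1,2)] by simp
    then show "of_int (m w) = - winding_number (between_loop q r) w"
      using right_mult_diff[OF o(3,4,1,2)] by simp
  qed (use between_loop_closed in auto)
  have "region_weight N (face_weight N) m = (\<Prod>e\<in>E. weight N e powi (steps_count e ss - n e))"
  proof (rule region_weight_eq[OF E])
    fix e ct t FR FL assume germ: "edge_germ N e ct t FR FL"
    then interpret edge_germ N e ct t FR FL .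
    obtain K1 where K1: "\<And>K. K1 \<le> K \<Longrightarrow>
        jump FR FL (\<lambda>w. \<Sum>k\<in>{-K..K}. winding_number q (shift k w)) (- of_int (steps_count e ss))"
      using steps_jump[OF ss u q] by blast
    obtain K2 where K2: "\<And>K. K2 \<le> K \<Longrightarrow>
        jump FR FL (\<lambda>w. \<Sum>k\<in>{-K..K}. winding_number r (shift k w)) (- of_int (n e))"
      using jump_r[OF germ] by blast
    have "jump FR FL (\<lambda>w. \<Sum>k\<in>{-K..K}. - winding_number (between_loop q r) (shift k w)) (of_int (steps_count e ss - n e))"
      if K: "max K1 K2 \<le> K" for K
    proof -
      let ?S = "\<lambda>g w. \<Sum>k\<in>{-K..K}. winding_number g (shift k w)"
      have "jump FR FL (?S ?l1) 0" "jump FR FL (?S ?l2) 0"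
        by (rule boundary_line_jump; use q.heading_cases r.heading_cases same_heading in auto)+
      then have "jump FR FL (\<lambda>w. - (?S q w) + - (?S ?l1 w) + ?S r w + - (?S ?l2 w))
          (- (- of_int (steps_count e ss)) + - 0 + - of_int (n e) + - 0)"
        using K by (intro jump_add jump_uminus K1 K2) auto
      moreover have "- (?S q w) + - (?S ?l1 w) + ?S r w + - (?S ?l2 w) =
          (\<Sum>k\<in>{-K..K}. - winding_number (between_loop q r) (shift k w))"
        if "exp w \<in> open_cylinder - drawing N" for w
      proof -
        have w: "exp (shift k w) \<in> open_cylinder - drawing N" for k
          using that by (simp only: exp_shift)
        have "- winding_number (between_loop q r) (shift k w) = - winding_number q (shift k w) +
            - winding_number ?l1 (shift k w) + winding_number r (shift k w) + - winding_number ?l2 (shift k w)" for k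
          unfolding between_loop_off(2)[OF off_qr(3,4,1,2)[OF w[of k]]] by (simp del: add_uminus_conv_diff)
        then show ?thesis
          by (simp only: sum.distrib sum_negf)
      qed
      ultimately have "jump FR FL (\<lambda>w. \<Sum>k\<in>{-K..K}. - winding_number (between_loop q r) (shift k w))
          (- (- of_int (steps_count e ss)) + - 0 + - of_int (n e) + - 0)"
        by (elim jump_cong) (use ev_open in \<open>auto elim!: eventually_mono\<close>)
      then show ?thesis
        by simp
    qed
    then show "\<exists>K0. \<forall>K\<ge>K0. jump FR FL (\<lambda>w. \<Sum>k\<in>{-K..K}. - winding_number (between_loop q r) (shift k w))
        (of_int (steps_count e ss - n e))"
      by blast
  qed
  also have "\<dots> = (\<Prod>e\<in>E. weight N e powi steps_count e ss / weight N e powi n e)"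
    by (intro prod.cong refl power_int_diff) (use weight_pos in force)
  also have "\<dots> = trail_weight N ss / (\<Prod>e\<in>E. weight N e powi n e)"
    using prod_steps_count[OF ss] by (simp add: prod_dividef)
  finally show ?thesis .
qed

end

theorem theorem3p9:
  fixes N :: "('v, 'e) network"
    and a b u v :: 'v and T :: "'e step list" and p :: "'e awalk"
  assumes "cylinder_network N"
    and "is_trail N a T b"
    and "u \<in> boundary_verts N" and "v \<in> boundary_verts N"
    and "pre_digraph.awalk (graph N) u p v"
  shows "wt N a T (face_weight N) (trail_weight N T) u p = path_weight N p"
proof -
  interpret cyl_net N
    using assms(1) by unfold_locales
  let ?ss = "map (\<lambda>e. (e, True)) p"
  have T: "steps_connect N a T b" "a \<in> boundary_verts N" "b \<in> boundary_verts N" "cmod (pos N a) \<noteq> cmod (pos N b)"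
    using assms(2) by (auto simp: is_trail_def)
  have aV: "a \<in> V" and uV: "u \<in> V"
    using boundary_cmod(2) T(2) assms(3) by auto
  \<comment> \<open>An empty trail would start and end at the same vertex, but its ends have
    different absolute values.\<close>
  have E: "E \<noteq> {}"
    using T(1,4) by (cases T) auto
  have ss: "steps_connect N u ?ss v"
    using assms(5) by (rule awalk_steps_connect)
  have trail_ends: "Re (pathstart r) \<noteq> Re (pathfinish r)" if "is_copy r (steps_curve N a T)" for r
    using steps_copy_props(5,6)[OF T(1) aV that] T(4) by auto
  have trail_jump: "\<exists>K0. \<forall>K\<ge>K0. jump FR FL (\<lambda>w. \<Sum>k\<in>{-K..K}. winding_number r (shift k w))
      (- of_int (steps_count e T))"
    if "is_copy r (steps_curve N a T)" "edge_germ N e ct t FR FL" for r e ct t FR FL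
    using edge_germ.steps_jump[OF that(2) T(1) aV that(1)] .
  \<comment> \<open>Every admissible choice of copies yields the same value, as the description in
    \<open>wt\<close> requires.\<close>
  have unique: "w = path_weight N p"
    if "wt_value N a T (face_weight N) (trail_weight N T) u p w" for w
    using that
  proof cases
    case (same_boundary q)
    then show ?thesis
      using region_weight_enclosed[OF E ss _ assms(3,4)] trail_weight_path by (simp add: path_curve_def)
  next
    case (along_trail q r)
    have q: "is_copy q (steps_curve N u ?ss)" "crossing q"
      using along_trail crossing_copy[OF ss _ assms(3,4)] by (auto simp: path_curve_def)
    have r: "crossing r"
      using crossing_copy[OF T(1) along_trail(3) T(2,3)] trail_ends along_trail(3) by blast
    have "crossing_pair q r"
      using q r along_trail(5) by (simp add: crossing_pair_def crossing_pair_axioms_def heading_def)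
    then have "region_weight N (face_weight N) (\<lambda>z. right_mult q z * left_mult r z) =
        trail_weight N ?ss / (\<Prod>e\<in>E. weight N e powi steps_count e T)"
      by (rule region_weight_between[OF E ss q(1) assms(3,4) _ along_trail(6)])
        (use steps_copy_props(7)[OF T(1) aV along_trail(3)] trail_jump[OF along_trail(3)] in auto)
    then show ?thesis
      using along_trail(1) trail_weight_nonzero[OF T(1)] trail_weight_path prod_steps_count[OF T(1)] by simp
  next
    case (against_trail q r)
    \<comment> \<open>The reversed trail has the heading of the path, and its left is the right of
      the trail. Its signed counts are the negatives of those of the trail, so the trail product
      appears inverted and cancels the factor \<open>inverse t\<close>.\<close>
    let ?r = "reversepath r"
    have q: "is_copy q (steps_curve N u ?ss)" "crossing q"
      using against_trail crossing_copy[OF ss _ assms(3,4)] by (auto simp: path_curve_def)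
    have r: "crossing r" "path r"
      using crossing_copy[OF T(1) against_trail(3) T(2,3)] trail_ends against_trail(3) by (auto simp: is_copy_def)
    note off = steps_copy_props(7)[OF T(1) aV against_trail(3)]
    have "crossing_pair q ?r"
      using q crossing_reversepath[OF r(1)] against_trail(5)
      by (simp add: crossing_pair_def crossing_pair_axioms_def heading_def)
    moreover have "completely_right_of ?r q"
      using against_trail(6) by (simp add: completely_right_of_def)
    ultimately have "region_weight N (face_weight N) (\<lambda>z. right_mult q z * right_mult r z) =
        trail_weight N ?ss / (\<Prod>e\<in>E. weight N e powi (- steps_count e T))"
    proof (rule region_weight_between[OF E ss q(1) assms(3,4)])
      fix w assume w: "exp w \<in> open_cylinder - drawing N"
      then show "right_mult q w * right_mult r w = right_mult q w * left_mult ?r w"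
        using left_mult_reversepath[OF r(1) open_cylinder_imp_strip off] by simp
    next
      fix e ct t FR FL assume germ: "edge_germ N e ct t FR FL"
      then interpret edge_germ N e ct t FR FL .
      obtain K0 where K0: "\<And>K. K0 \<le> K \<Longrightarrow>
          jump FR FL (\<lambda>w. \<Sum>k\<in>{-K..K}. winding_number r (shift k w)) (- of_int (steps_count e T))"
        using trail_jump[OF against_trail(3) germ] by blast
      have "jump FR FL (\<lambda>w. \<Sum>k\<in>{-K..K}. winding_number ?r (shift k w)) (- of_int (- steps_count e T))"
        if "K0 \<le> K" for K
      proof -
        have "- (\<Sum>k\<in>{-K..K}. winding_number r (shift k w)) = (\<Sum>k\<in>{-K..K}. winding_number ?r (shift k w))"
          if "exp w \<notin> drawing N" for w
        proof -
          have "exp (shift k w) \<notin> drawing N" for k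
            using that by (simp only: exp_shift) simp
          then show ?thesis
            using winding_number_reversepath[OF r(2) off] by (simp add: sum_negf)
        qed
        then have "jump FR FL (\<lambda>w. \<Sum>k\<in>{-K..K}. winding_number ?r (shift k w)) (- (- of_int (steps_count e T)))"
          by (intro jump_cong[OF jump_uminus[OF K0[OF that]]])
            (use ev_off_drawing in \<open>auto elim!: eventually_mono\<close>)
        then show ?thesis
          by simp
      qed
      then show "\<exists>K0. \<forall>K\<ge>K0. jump FR FL (\<lambda>w. \<Sum>k\<in>{-K..K}. winding_number ?r (shift k w))
          (- of_int (- steps_count e T))"
        by blast
    qed (use off in auto)
    moreover have "(\<Prod>e\<in>E. weight N e powi (- steps_count e T)) = inverse (trail_weight N T)"
      using prod_steps_count[OF T(1)] prod_inversef[of "\<lambda>e. weight N e powi steps_count e T" E]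
      by (simp add: power_int_minus o_def)
    ultimately show ?thesis
      using against_trail(1) trail_weight_nonzero[OF T(1)] trail_weight_path by (simp add: field_simps)
  qed
  \<comment> \<open>A copy of the path determines the case; in the crossing cases the trail copy is
    moved until it is admissible.\<close>
  have "\<exists>w. wt_value N a T (face_weight N) (trail_weight N T) u p w"
  proof -
    obtain q where q: "is_copy q (steps_curve N u ?ss)"
      by (rule steps_copy_exists[OF ss uV])
    then have qp: "is_copy q (path_curve N u p)"
      by (simp add: path_curve_def)
    show ?thesis
    proof (cases "Re (pathstart q) = Re (pathfinish q)")
      case True
      then show ?thesis
        using wt_value.same_boundary[OF qp] by blast
    next
      case False
      have cq: "crossing q"
        by (rule crossing_copy[OF ss q assms(3,4) False])
      obtain r0 where r0: "is_copy r0 (steps_curve N a T)"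
        by (rule steps_copy_exists[OF T(1) aV])
      obtain k where k: "completely_right_of (\<lambda>s. shift k (r0 s)) q"
        by (rule shifted_completely_right[OF cq steps_copy_props(1,2)[OF T(1) aV r0]])
      let ?r = "\<lambda>s. shift k (r0 s)"
      have "path ?r"
        using r0 unfolding is_copy_def path_def by (intro continuous_intros) auto
      then have r: "is_copy ?r (steps_curve N a T)"
        using r0 by (simp only: is_copy_def exp_shift) simp
      have "Re (pathstart q) = Re (pathstart ?r) \<or> Re (pathstart q) = Re (pathfinish ?r)"
        using crossing.ends[OF cq] crossing.ends[OF crossing_copy[OF T(1) r T(2,3) trail_ends[OF r]]] by auto
      then show ?thesis
        using wt_value.along_trail[OF qp r False _ k] wt_value.against_trail[OF qp r False _ k] by blast
    qed
  qed
  then show ?thesis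
    unfolding wt_def using unique by (metis the_equality)
qed

end
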